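(* Let $\mathbb K$ be an algebraically closed field of characteristic $3$. Let $\mathfrak{br}_3=\mathfrak g(A)$ be the contragredient Lie algebra with purely even Cartan matrix $A=\begin{pmatrix}2&-1&0\\-1&2&-1\\0&-1&0\end{pmatrix}$, and let $\mathfrak{brj}_{2;3}=\mathfrak g(\widetilde A)$ be the contragredient Lie superalgebra with Cartan matrix $\widetilde A=\begin{pmatrix}0&-1\\-1&0\end{pmatrix}$ in which the first index is odd and the second index is even. Then the semisimplification of $\mathfrak{br}_3$, as an object in $\mathrm{Rep}\,\alpha_3$ under the adjoint action of $e_1$, is (isomorphic as a Lie superalgebra to) $\mathfrak{brj}_{2;3}$.
   Context: **Contragredient Lie superalgebras.** Lie superalgebras in characteristic $3$ are required to satisfy $[x,[x,x]]=0$ for odd $x$. Let $A=(a_{ij})$ be an $n\times n$ integer matrix (a Cartan matrix) with a parity $\mathrm{par}(i)\in\mathbb Z/2$ for each index; let $\overline A=(\overline a_{ij})$ be its reduction mod $3$, of rank $s$. Let $\widetilde{\mathfrak h}$ be a $\mathbb K$-vector space of dimension $2n-s$ with linearly independent $h_1,\dots,h_n\in\widetilde{\mathfrak h}$ and linearly independent $\alpha_1,\dots,\alpha_n\in\widetilde{\mathfrak h}^*$ such that $\alpha_j(h_i)=\overline a_{ij}$. $\widetilde{\mathfrak g}(A)$ is the Lie superalgebra generated by $\widetilde{\mathfrak h}$ (even) and $e_i,f_i$ ($1\le i\le n$) of parity $\mathrm{par}(i)$, with relations $[e_i,f_j]=\delta_{ij}h_i$, $[h,e_j]=\alpha_j(h)e_j$,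 $[h,f_j]=-\alpha_j(h)f_j$, $[\widetilde{\mathfrak h},\widetilde{\mathfrak h}]=0$. It is graded by the free abelian group $Q=\bigoplus_k\mathbb Z\alpha_k$ with $\deg e_i=\alpha_i$, $\deg f_i=-\alpha_i$, $\deg h=0$. $\mathfrak g(A)=\widetilde{\mathfrak g}(A)/\mathfrak r$, where $\mathfrak r$ is the largest $Q$-graded ideal meeting $\widetilde{\mathfrak h}$ trivially; images of $e_i,f_i,h_i$ keep their names. If all parities are $0$, $\mathfrak g(A)$ is a Lie algebra. **Semisimplification.** $\mathrm{Rep}\,\alpha_3$ (representations of the Frobenius kernel of $\mathbb G_a$) is the symmetric tensor category of finite-dimensional $\mathbb K[t]/(t^3)$-modules, with $t$ acting on $V\otimes W$ by $t\otimes1+1\otimes t$ and the flip as braiding. Its indecomposables are $J_1,J_2,J_3$, where $t$ acts on $J_n=\mathbb K^n$ as one nilpotent Jordan block. A Lie algebra $\mathfrak g$ with a derivation $d$, $d^3=0$, is a Lie algebra in $\mathrm{Rep}\,\alpha_3$ with $t$ acting by $d$; "under the adjoint action of $x$" means $d=\mathrm{ad}\,x$. The semisimplification functor $V\mapsto\overline V$ is the quotient of $\mathrm{Rep}\,\alpha_3$ by negligible morphisms ($u:V\to W$ with $\mathrm{tr}(u\circ v)=0$ for all $v:W\to V$), with target the Verlinde category $\mathrm{Ver}_3$, whose simple objects are $L_1=\overline{J_1}$, $L_2=\overline{J_2}$ ($\overline{J_3}=0$); $\mathrm{Ver}_3$ is identified with super vector spaces, $L_1$ being an even line and $L_2$ an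 odd line, so $\overline{\mathfrak g}$ is a Lie superalgebra. Explicitly, decompose $\mathfrak g$ into Jordan blocks $x_i$ ($i\le n_1$), $x_i\mapsto x_i'$ ($n_1<i\le n_1+n_2$), and blocks $x_i\mapsto x_i'\mapsto x_i''$ (arrows are the action of $d$). Then $\overline{\mathfrak g}$ has basis $y_i$ ($i\le n_1+n_2$), even for $i\le n_1$ and odd for $i>n_1$; the coefficient of $y_k$ in $[y_i,y_j]$ is the coefficient of $x_k$ in $[x_i,x_j]$ if the parities of $y_i,y_j,y_k$ are compatible and $y_i,y_j$ are not both odd; it is the coefficient of $x_k$ in $-[x_i,x_j']+[x_i',x_j]$ if $i,j>n_1$, $k\le n_1$; and $0$ otherwise. *)

theory Defs
  imports
    "Jordan_Normal_Form.DL_Rank"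
    "HOL-Algebra.QuotRing"
    "HOL-Library.Poly_Mapping"
    "HOL-Library.Z2"
    "HOL-Computational_Algebra.Polynomial"
begin

section \<open>Superalgebras\<close>

text \<open>
  A superalgebra over the field \<open>'k\<close> is a module over \<^term>\<open>class_ring\<close> with a distinguished
  even part \<open>homog G 0\<close> and odd part \<open>homog G 1\<close>. The ring multiplication \<open>\<otimes>\<close> plays
  the role of the bracket; the field \<open>one\<close> of the ring record carries no information.
\<close>

record ('k, 'v) superalgebra = "('k, 'v) module" +
  homog :: "bit \<Rightarrow> 'v set"

definition koszul_sign :: "bit \<Rightarrow> bit \<Rightarrow> 'k::ring_1" where
  "koszul_sign p q = (if p = 1 \<and> q = 1 then - 1 else 1)"

text \<open>
  The expressions that have to vanish in a Lie superalgebra: super skew-symmetry, the super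
  Jacobi identity, and \<open>[x,[x,x]]\<close> for odd \<open>x\<close>. In characteristic 3 the last one does not
  follow from the Jacobi identity.
\<close>

definition lie_relators :: "('k::field, 'v) superalgebra \<Rightarrow> 'v set" where
  "lie_relators G =
     {(x \<otimes>\<^bsub>G\<^esub> y) \<oplus>\<^bsub>G\<^esub> (koszul_sign p q \<odot>\<^bsub>G\<^esub> (y \<otimes>\<^bsub>G\<^esub> x)) | x y p q.
        x \<in> homog G p \<and> y \<in> homog G q} \<union>
     {(x \<otimes>\<^bsub>G\<^esub> (y \<otimes>\<^bsub>G\<^esub> z)) \<ominus>\<^bsub>G\<^esub>
        (((x \<otimes>\<^bsub>G\<^esub> y) \<otimes>\<^bsub>G\<^esub> z) \<oplus>\<^bsub>G\<^esub> (koszul_sign p q \<odot>\<^bsub>G\<^esub> (y \<otimes>\<^bsub>G\<^esub> (x \<otimes>\<^bsub>G\<^esub> z)))) | x y z p q r.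
        x \<in> homog G p \<and> y \<in> homog G q \<and> z \<in> homog G r} \<union>
     {x \<otimes>\<^bsub>G\<^esub> (x \<otimes>\<^bsub>G\<^esub> x) | x. x \<in> homog G 1}"

definition lie_superalgebra :: "('k::field, 'v) superalgebra \<Rightarrow> bool" where
  "lie_superalgebra G \<longleftrightarrow>
     vectorspace class_ring G \<and>
     (\<forall>p. VectorSpace.subspace class_ring (homog G p) G) \<and>
     homog G 0 \<inter> homog G 1 = {\<zero>\<^bsub>G\<^esub>} \<and>
     homog G 0 <+>\<^bsub>G\<^esub> homog G 1 = carrier G \<and>
     (\<forall>x \<in> carrier G. (\<lambda>y. x \<otimes>\<^bsub>G\<^esub> y) \<in> LinearCombinations.module_hom class_ring G G \<and>
                       (\<lambda>y. y \<otimes>\<^bsub>G\<^esub> x) \<in> LinearCombinations.module_hom class_ring G G) \<and>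
     (\<forall>p q. \<forall>x \<in> homog G p. \<forall>y \<in> homog G q. x \<otimes>\<^bsub>G\<^esub> y \<in> homog G (p + q)) \<and>
     lie_relators G \<subseteq> {\<zero>\<^bsub>G\<^esub>}"

definition isomorphic_superalgebras ::
    "('k::field, 'v) superalgebra \<Rightarrow> ('k, 'w) superalgebra \<Rightarrow> bool" where
  "isomorphic_superalgebras G H \<longleftrightarrow>
     (\<exists>\<phi>. \<phi> \<in> LinearCombinations.module_hom class_ring G H \<and> bij_betw \<phi> (carrier G) (carrier H) \<and>
          (\<forall>x \<in> carrier G. \<forall>y \<in> carrier G. \<phi> (x \<otimes>\<^bsub>G\<^esub> y) = \<phi> x \<otimes>\<^bsub>H\<^esub> \<phi> y) \<and>
          (\<forall>p. \<phi> ` homog G p = homog H p))"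

definition ad :: "('k, 'v) superalgebra \<Rightarrow> 'v \<Rightarrow> 'v \<Rightarrow> 'v" where
  "ad G x y = x \<otimes>\<^bsub>G\<^esub> y"

definition alg_ideal :: "('k::field, 'v) superalgebra \<Rightarrow> 'v set \<Rightarrow> bool" where
  "alg_ideal G I \<longleftrightarrow> VectorSpace.subspace class_ring I G \<and>
     (\<forall>x \<in> carrier G. \<forall>y \<in> I. x \<otimes>\<^bsub>G\<^esub> y \<in> I \<and> y \<otimes>\<^bsub>G\<^esub> x \<in> I)"

definition ideal_generated :: "('k::field, 'v) superalgebra \<Rightarrow> 'v set \<Rightarrow> 'v set" where
  "ideal_generated G S = \<Inter> {I. alg_ideal G I \<and> S \<subseteq> I}"

definition quotient_superalgebra ::
    "('k::field, 'v) superalgebra \<Rightarrow> 'v set \<Rightarrow> ('k, 'v set) superalgebra" where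
  "quotient_superalgebra G I =
     \<lparr>carrier = carrier (G Quot I), mult = mult (G Quot I), one = one (G Quot I),
      zero = zero (G Quot I), add = add (G Quot I),
      smult = (\<lambda>c X. \<Union>x\<in>X. I +>\<^bsub>G\<^esub> (c \<odot>\<^bsub>G\<^esub> x)),
      homog = (\<lambda>p. (\<lambda>x. I +>\<^bsub>G\<^esub> x) ` homog G p)\<rparr>"


section \<open>Free non-associative superalgebras\<close>

datatype 'x nword = Letter 'x | Brk "'x nword" "'x nword"

fun word_parity :: "('x \<Rightarrow> bit) \<Rightarrow> 'x nword \<Rightarrow> bit" where
  "word_parity par (Letter x) = par x"
| "word_parity par (Brk u v) = word_parity par u + word_parity par v"

definition free_superalgebra ::
    "'x set \<Rightarrow> ('x \<Rightarrow> bit) \<Rightarrow> ('k::field, 'x nword \<Rightarrow>\<^sub>0 'k) superalgebra" where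
  "free_superalgebra X par =
     \<lparr>carrier = {a. \<forall>w \<in> Poly_Mapping.keys a. set_nword w \<subseteq> X},
      mult = (\<lambda>a b. \<Sum>u \<in> Poly_Mapping.keys a. \<Sum>v \<in> Poly_Mapping.keys b.
                Poly_Mapping.single (Brk u v) (Poly_Mapping.lookup a u * Poly_Mapping.lookup b v)),
      one = 0, zero = 0, add = (+),
      smult = (\<lambda>c. Poly_Mapping.map ((*) c)),
      homog = (\<lambda>p. {a. \<forall>w \<in> Poly_Mapping.keys a. set_nword w \<subseteq> X \<and> word_parity par w = p})\<rparr>"


section \<open>Contragredient Lie superalgebras\<close>

text \<open>
  A realization consists of the space \<open>h\<close>, the vectors \<open>h\<^sub>i\<close> and the functionals
  \<open>\<alpha>\<^sub>j\<close>. Indices run over \<open>{..<n}\<close>, so the generators usually numbered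
  \<open>1, ..., n\<close> are numbered \<open>0, ..., n - 1\<close> here.
\<close>

record ('k, 'h) realization =
  cartan_space :: "('k, 'h) module"
  coroot :: "nat \<Rightarrow> 'h"
  simple_root :: "nat \<Rightarrow> 'h \<Rightarrow> 'k"

definition realizes :: "int mat \<Rightarrow> ('k::field, 'h) realization \<Rightarrow> bool" where
  "realizes A R \<longleftrightarrow>
     (let n = dim_row A; h = cartan_space R; A' = (map_mat of_int A :: 'k mat) in
      A \<in> carrier_mat n n \<and>
      vectorspace class_ring h \<and> vectorspace.fin_dim class_ring h \<and>
      vectorspace.dim class_ring h = 2 * n - vec_space.rank n A' \<and>
      coroot R ` {..<n} \<subseteq> carrier h \<and> inj_on (coroot R) {..<n} \<and>
      \<not> LinearCombinations.module.lin_dep class_ring h (coroot R ` {..<n}) \<and>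
      (\<forall>j<n. \<forall>x \<in> carrier h. \<forall>y \<in> carrier h. simple_root R j (x \<oplus>\<^bsub>h\<^esub> y) = simple_root R j x + simple_root R j y) \<and>
      (\<forall>j<n. \<forall>c. \<forall>x \<in> carrier h. simple_root R j (c \<odot>\<^bsub>h\<^esub> x) = c * simple_root R j x) \<and>
      (\<forall>c. (\<forall>x \<in> carrier h. (\<Sum>j<n. c j * simple_root R j x) = 0) \<longrightarrow> (\<forall>j<n. c j = 0)) \<and>
      (\<forall>i<n. \<forall>j<n. simple_root R j (coroot R i) = A' $$ (i, j)))"

datatype 'h generator = GenH 'h | GenE nat | GenF nat

definition generators :: "nat \<Rightarrow> ('k, 'h) realization \<Rightarrow> 'h generator set" where
  "generators n R = GenH ` carrier (cartan_space R) \<union> GenE ` {..<n} \<union> GenF ` {..<n}"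

fun gen_parity :: "(nat \<Rightarrow> bit) \<Rightarrow> 'h generator \<Rightarrow> bit" where
  "gen_parity par (GenH x) = 0"
| "gen_parity par (GenE i) = par i"
| "gen_parity par (GenF i) = par i"

text \<open>\<open>Q\<close> is the free abelian group \<^typ>\<open>nat \<Rightarrow>\<^sub>0 int\<close>, not the group spanned by the
  functionals \<open>\<alpha>\<^sub>j\<close>, which has exponent 3 in characteristic 3.\<close>

fun word_degree :: "'h generator nword \<Rightarrow> (nat \<Rightarrow>\<^sub>0 int)" where
  "word_degree (Letter (GenH x)) = 0"
| "word_degree (Letter (GenE i)) = Poly_Mapping.single i 1"
| "word_degree (Letter (GenF i)) = - Poly_Mapping.single i 1"
| "word_degree (Brk u v) = word_degree u + word_degree v"

type_synonym ('k, 'h) free_elem = "'h generator nword \<Rightarrow>\<^sub>0 'k"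

abbreviation letter :: "'h generator \<Rightarrow> ('k::field, 'h) free_elem" where
  "letter x \<equiv> Poly_Mapping.single (Letter x) 1"

definition free_contragredient ::
    "int mat \<Rightarrow> (nat \<Rightarrow> bit) \<Rightarrow> ('k::field, 'h) realization \<Rightarrow> ('k, ('k, 'h) free_elem) superalgebra" where
  "free_contragredient A par R = free_superalgebra (generators (dim_row A) R) (gen_parity par)"

text \<open>The first two families make \<open>GenH\<close> linear.\<close>

definition contragredient_relators ::
    "int mat \<Rightarrow> (nat \<Rightarrow> bit) \<Rightarrow> ('k::field, 'h) realization \<Rightarrow> ('k, 'h) free_elem set" where
  "contragredient_relators A par R =
     (let n = dim_row A; h = cartan_space R; L = free_contragredient A par R in
      {letter (GenH (x \<oplus>\<^bsub>h\<^esub> y)) - (letter (GenH x) + letter (GenH y)) | x y.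
         x \<in> carrier h \<and> y \<in> carrier h} \<union>
      {letter (GenH (c \<odot>\<^bsub>h\<^esub> x)) - c \<odot>\<^bsub>L\<^esub> letter (GenH x) | c x. x \<in> carrier h} \<union>
      {letter (GenE i) \<otimes>\<^bsub>L\<^esub> letter (GenF j) - (if i = j then letter (GenH (coroot R i)) else 0) | i j.
         i < n \<and> j < n} \<union>
      {letter (GenH x) \<otimes>\<^bsub>L\<^esub> letter (GenE j) - simple_root R j x \<odot>\<^bsub>L\<^esub> letter (GenE j) | x j.
         x \<in> carrier h \<and> j < n} \<union>
      {letter (GenH x) \<otimes>\<^bsub>L\<^esub> letter (GenF j) + simple_root R j x \<odot>\<^bsub>L\<^esub> letter (GenF j) | x j.
         x \<in> carrier h \<and> j < n} \<union>
      {letter (GenH x) \<otimes>\<^bsub>L\<^esub> letter (GenH y) | x y. x \<in> carrier h \<and> y \<in> carrier h})"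

definition tilde_ideal ::
    "int mat \<Rightarrow> (nat \<Rightarrow> bit) \<Rightarrow> ('k::field, 'h) realization \<Rightarrow> ('k, 'h) free_elem set" where
  "tilde_ideal A par R =
     (let L = free_contragredient A par R in
      ideal_generated L (lie_relators L \<union> contragredient_relators A par R))"

definition tilde_contragredient ::
    "int mat \<Rightarrow> (nat \<Rightarrow> bit) \<Rightarrow> ('k::field, 'h) realization \<Rightarrow>
      ('k, ('k, 'h) free_elem set) superalgebra" where
  "tilde_contragredient A par R =
     quotient_superalgebra (free_contragredient A par R) (tilde_ideal A par R)"

definition tilde_class ::
    "int mat \<Rightarrow> (nat \<Rightarrow> bit) \<Rightarrow> ('k::field, 'h) realization \<Rightarrow>
      ('k, 'h) free_elem \<Rightarrow> ('k, 'h) free_elem set" where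
  "tilde_class A par R a = tilde_ideal A par R +>\<^bsub>free_contragredient A par R\<^esub> a"

definition tilde_component ::
    "int mat \<Rightarrow> (nat \<Rightarrow> bit) \<Rightarrow> ('k::field, 'h) realization \<Rightarrow> (nat \<Rightarrow>\<^sub>0 int) \<Rightarrow>
      ('k, 'h) free_elem set set" where
  "tilde_component A par R q = tilde_class A par R `
     {a \<in> carrier (free_contragredient A par R). \<forall>w \<in> Poly_Mapping.keys a. word_degree w = q}"

definition graded_ideal_avoiding_cartan ::
    "int mat \<Rightarrow> (nat \<Rightarrow> bit) \<Rightarrow> ('k::field, 'h) realization \<Rightarrow>
      ('k, 'h) free_elem set set \<Rightarrow> bool" where
  "graded_ideal_avoiding_cartan A par R I \<longleftrightarrow>
     (let G = tilde_contragredient A par R in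
      alg_ideal G I \<and>
      I = LinearCombinations.module.span class_ring G (\<Union>q. I \<inter> tilde_component A par R q) \<and>
      I \<inter> (\<lambda>x. tilde_class A par R (letter (GenH x))) ` carrier (cartan_space R) = {\<zero>\<^bsub>G\<^esub>})"

definition max_ideal ::
    "int mat \<Rightarrow> (nat \<Rightarrow> bit) \<Rightarrow> ('k::field, 'h) realization \<Rightarrow> ('k, 'h) free_elem set set" where
  "max_ideal A par R = (GREATEST I. graded_ideal_avoiding_cartan A par R I)"

definition contragredient ::
    "int mat \<Rightarrow> (nat \<Rightarrow> bit) \<Rightarrow> ('k::field, 'h) realization \<Rightarrow>
      ('k, ('k, 'h) free_elem set set) superalgebra" where
  "contragredient A par R =
     quotient_superalgebra (tilde_contragredient A par R) (max_ideal A par R)"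

definition contragredient_gen ::
    "int mat \<Rightarrow> (nat \<Rightarrow> bit) \<Rightarrow> ('k::field, 'h) realization \<Rightarrow> 'h generator \<Rightarrow>
      ('k, 'h) free_elem set set" where
  "contragredient_gen A par R x =
     max_ideal A par R +>\<^bsub>tilde_contragredient A par R\<^esub> tilde_class A par R (letter x)"


section \<open>Semisimplification of Lie algebras in \<open>Rep \<alpha>\<^sub>3\<close>\<close>

definition lie_algebra_in_Rep_alpha3 ::
    "('k::field, 'v) superalgebra \<Rightarrow> ('v \<Rightarrow> 'v) \<Rightarrow> bool" where
  "lie_algebra_in_Rep_alpha3 G d \<longleftrightarrow>
     lie_superalgebra G \<and> homog G 1 = {\<zero>\<^bsub>G\<^esub>} \<and> vectorspace.fin_dim class_ring G \<and>
     d \<in> LinearCombinations.module_hom class_ring G G \<and>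
     (\<forall>x \<in> carrier G. \<forall>y \<in> carrier G. d (x \<otimes>\<^bsub>G\<^esub> y) = (d x \<otimes>\<^bsub>G\<^esub> y) \<oplus>\<^bsub>G\<^esub> (x \<otimes>\<^bsub>G\<^esub> d y)) \<and>
     (\<forall>x \<in> carrier G. d (d (d x)) = \<zero>\<^bsub>G\<^esub>)"

text \<open>
  A decomposition into Jordan blocks generated by \<open>x 0, ..., x (n\<^sub>1 + n\<^sub>2 + n\<^sub>3 - 1)\<close>: first
  \<open>n\<^sub>1\<close> blocks of size 1, then \<open>n\<^sub>2\<close> of size 2, then \<open>n\<^sub>3\<close> of size 3.
\<close>

definition block_size :: "nat \<Rightarrow> nat \<Rightarrow> nat \<Rightarrow> nat" where
  "block_size n1 n2 i = (if i < n1 then 1 else if i < n1 + n2 then 2 else 3)"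

definition jordan_basis ::
    "('v \<Rightarrow> 'v) \<Rightarrow> nat \<Rightarrow> nat \<Rightarrow> nat \<Rightarrow> (nat \<Rightarrow> 'v) \<Rightarrow> 'v set" where
  "jordan_basis d n1 n2 n3 x = {(d ^^ k) (x i) | i k. i < n1 + n2 + n3 \<and> k < block_size n1 n2 i}"

definition jordan_decomposition ::
    "('k::field, 'v) superalgebra \<Rightarrow> ('v \<Rightarrow> 'v) \<Rightarrow> nat \<Rightarrow> nat \<Rightarrow> nat \<Rightarrow> (nat \<Rightarrow> 'v) \<Rightarrow> bool" where
  "jordan_decomposition G d n1 n2 n3 x \<longleftrightarrow>
     (\<forall>i < n1 + n2 + n3. (d ^^ block_size n1 n2 i) (x i) = \<zero>\<^bsub>G\<^esub>) \<and>
     inj_on (\<lambda>(i, k). (d ^^ k) (x i)) (SIGMA i:{..<n1 + n2 + n3}. {..<block_size n1 n2 i}) \<and>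
     vectorspace.basis class_ring G (jordan_basis d n1 n2 n3 x)"

definition coefficient ::
    "('k::field, 'v) superalgebra \<Rightarrow> 'v set \<Rightarrow> 'v \<Rightarrow> 'v \<Rightarrow> 'k" where
  "coefficient G B b v =
     (THE c. c \<in> extensional B \<and> LinearCombinations.module.lincomb G c B = v) b"

definition semisimp_parity :: "nat \<Rightarrow> nat \<Rightarrow> bit" where
  "semisimp_parity n1 i = (if i < n1 then 0 else 1)"

definition semisimp_coeff ::
    "('k::field, 'v) superalgebra \<Rightarrow> ('v \<Rightarrow> 'v) \<Rightarrow> nat \<Rightarrow> nat \<Rightarrow> nat \<Rightarrow> (nat \<Rightarrow> 'v) \<Rightarrow>
      nat \<Rightarrow> nat \<Rightarrow> nat \<Rightarrow> 'k" where
  "semisimp_coeff G d n1 n2 n3 x i j k =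
     (let par = semisimp_parity n1;
          co = (\<lambda>v. coefficient G (jordan_basis d n1 n2 n3 x) (x k) v) in
      if par k \<noteq> par i + par j then 0
      else if par i = 1 \<and> par j = 1
        then co ((\<ominus>\<^bsub>G\<^esub> (x i \<otimes>\<^bsub>G\<^esub> d (x j))) \<oplus>\<^bsub>G\<^esub> (d (x i) \<otimes>\<^bsub>G\<^esub> x j))
      else co (x i \<otimes>\<^bsub>G\<^esub> x j))"

text \<open>
  The basis vector \<open>y\<^sub>i\<close> of the semisimplification is the unit vector \<open>unit_vec (n\<^sub>1 + n\<^sub>2) i\<close>.
  Blocks of size 3 are negligible and contribute nothing.
\<close>

definition semisimplification ::
    "('k::field, 'v) superalgebra \<Rightarrow> ('v \<Rightarrow> 'v) \<Rightarrow> nat \<Rightarrow> nat \<Rightarrow> nat \<Rightarrow> (nat \<Rightarrow> 'v) \<Rightarrow>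
      ('k, 'k vec) superalgebra" where
  "semisimplification G d n1 n2 n3 x =
     (let m = n1 + n2 in
      \<lparr>carrier = carrier_vec m,
       mult = (\<lambda>a b. vec m (\<lambda>k. \<Sum>i<m. \<Sum>j<m. a $ i * b $ j * semisimp_coeff G d n1 n2 n3 x i j k)),
       one = 0\<^sub>v m, zero = 0\<^sub>v m, add = (+), smult = (\<cdot>\<^sub>v),
       homog = (\<lambda>p. {a \<in> carrier_vec m. \<forall>i<m. a $ i \<noteq> 0 \<longrightarrow> semisimp_parity n1 i = p})\<rparr>)"


section \<open>The algebras \<open>br\<^sub>3\<close> and \<open>brj\<^sub>2\<^sub>;\<^sub>3\<close>\<close>

definition br3_matrix :: "int mat" where
  "br3_matrix = mat_of_rows_list 3 [[2, -1, 0], [-1, 2, -1], [0, -1, 0]]"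

definition br3 :: "('k::field, 'h) realization \<Rightarrow> ('k, ('k, 'h) free_elem set set) superalgebra" where
  "br3 R = contragredient br3_matrix (\<lambda>_. 0) R"

definition br3_e1 :: "('k::field, 'h) realization \<Rightarrow> ('k, 'h) free_elem set set" where
  "br3_e1 R = contragredient_gen br3_matrix (\<lambda>_. 0) R (GenE 0)"

definition brj23_matrix :: "int mat" where
  "brj23_matrix = mat_of_rows_list 2 [[0, -1], [-1, 0]]"

definition brj23 :: "('k::field, 'h) realization \<Rightarrow> ('k, ('k, 'h) free_elem set set) superalgebra" where
  "brj23 R = contragredient brj23_matrix (\<lambda>i. if i = 0 then 1 else 0) R"

end

(* Let g0 = so(5), let g1 be the 8-dimensional g0-module occurring below, and let V be the natural
   module of sl2. There are compatible maps S^2 g1 -> g0 and Lambda^2 g1 -> K making g0 + sl2 + g1 (x) V a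
   model of br3, with e_1 the standard nilpotent E of sl2, and g0 + g1 a model of brj(2;3).

   A model is recognized as a contragredient superalgebra as follows. The free superalgebra maps onto it,
   by a map killing the defining relations. In degree 0 every word reduces modulo the relations to a Cartan
   element, on which the map is injective, so its kernel avoids the Cartan subalgebra. The kernel is the
   largest such graded ideal: in the model, every nonzero homogeneous element of nonzero degree can be
   moved by a generator to a nonzero element closer to degree 0.

   Under ad E the model of br3 is a sum of the trivial module g0, of dim g1 copies of J_2, and of
   sl2 = J_3, which is negligible. The projection onto g0 and the projection of g1 (x) V onto its lowest
   weight space induce the isomorphism of the semisimplification with g0 + g1, whatever the chosen Jordan
   decomposition: they kill the image of ad E, and every element of ker (ad E)^2 killed by the second one is
   the sum of an element of ker (ad E) and an image. *)

theory Submission imports Defs begin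

section \<open>Linear extension\<close>

text \<open>Both algebras are quotients of a free nonassociative superalgebra by an ideal known only
  as the greatest one with a certain property, so no bracket can be computed in them directly. All
  computation is therefore done in tables of structure constants, entered as integers and read
  modulo 3, and the results are carried over along isomorphisms. The degrees have to be integral. In
  characteristic 3 the Cartan subalgebra has too few weights to separate the root spaces, while over
  the integers every root space of nonzero degree in either model is a line spanned by a basis
  vector. Both Cartan matrices are invertible modulo 3. Hence the Cartan space has dimension n and
  the simple roots are coordinates on it, which dictates where each Cartan element goes in the
  model. Characteristic 3 also decides the final comparison: the odd bracket
  \<open>- [x, y'] + [x', y]\<close> of the semisimplification produces the symmetric map of
  \<open>g1\<close> into \<open>g0\<close> twice with a minus sign, and -2 = 1.\<close>

definition scale :: "'k::field \<Rightarrow> ('b \<Rightarrow>\<^sub>0 'k) \<Rightarrow> ('b \<Rightarrow>\<^sub>0 'k)" where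
  "scale c = Poly_Mapping.map ((*) c)"

lemma lookup_scale [simp]: "Poly_Mapping.lookup (scale c a) k = c * Poly_Mapping.lookup a k"
  unfolding scale_def by transfer (simp add: when_def)

interpretation pm: vector_space scale
  by unfold_locales (auto intro!: poly_mapping_eqI simp: lookup_add algebra_simps)

lemma scale_single [simp]: "scale c (Poly_Mapping.single k d) = Poly_Mapping.single k (c * d)"
  by (rule poly_mapping_eqI) (simp add: lookup_single when_def)

lemma keys_scale: "Poly_Mapping.keys (scale c a) \<subseteq> Poly_Mapping.keys a"
  by (auto simp: in_keys_iff)

lemma keys_diff_subset: "Poly_Mapping.keys (a - b :: 'b \<Rightarrow>\<^sub>0 'k::ab_group_add) \<subseteq> Poly_Mapping.keys a \<union> Poly_Mapping.keys b"
  by (auto simp: in_keys_iff lookup_minus)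

lemma keys_sum_subset:
  "(\<And>i. i \<in> I \<Longrightarrow> Poly_Mapping.keys (f i) \<subseteq> X) \<Longrightarrow> Poly_Mapping.keys (sum f I) \<subseteq> X"
  by (induction I rule: infinite_finite_induct) (auto dest!: subsetD[OF keys_add])

definition lext :: "('b \<Rightarrow> ('c \<Rightarrow>\<^sub>0 'k)) \<Rightarrow> ('b \<Rightarrow>\<^sub>0 'k::field) \<Rightarrow> ('c \<Rightarrow>\<^sub>0 'k)" where
  "lext f a = (\<Sum>k\<in>Poly_Mapping.keys a. scale (Poly_Mapping.lookup a k) (f k))"

lemma lext_eq_sum:
  assumes "finite X" "Poly_Mapping.keys a \<subseteq> X"
  shows "lext f a = (\<Sum>k\<in>X. scale (Poly_Mapping.lookup a k) (f k))"
  unfolding lext_def using assms by (intro sum.mono_neutral_left) (auto simp: in_keys_iff)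

lemma lext_add: "lext f (a + b) = lext f a + lext f b"
  by (subst (1 2 3) lext_eq_sum[of "Poly_Mapping.keys a \<union> Poly_Mapping.keys b"])
    (auto simp: lookup_add pm.scale_left_distrib sum.distrib dest: subsetD[OF keys_add])

lemma lext_scale: "lext f (scale c a) = scale c (lext f a)"
  by (subst (1 2) lext_eq_sum[of "Poly_Mapping.keys a"])
    (auto simp: pm.scale_sum_right dest: subsetD[OF keys_scale])

abbreviation pm_linear :: "(('b \<Rightarrow>\<^sub>0 'k::field) \<Rightarrow> ('c \<Rightarrow>\<^sub>0 'k)) \<Rightarrow> bool" where
  "pm_linear \<equiv> Vector_Spaces.linear scale scale"

lemma pm_linearI:
  "(\<And>a b. f (a + b) = f a + f b) \<Longrightarrow> (\<And>c a. f (scale c a) = scale c (f a)) \<Longrightarrow> pm_linear f"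
  by unfold_locales auto

lemma pm_linear_lext: "pm_linear (lext f)"
  by (intro pm_linearI lext_add lext_scale)

lemmas pm_linear_simps =
  module_hom.add[OF Vector_Spaces.linear.axioms(3)] module_hom.scale[OF Vector_Spaces.linear.axioms(3)]
  module_hom.sum[OF Vector_Spaces.linear.axioms(3)] module_hom.zero[OF Vector_Spaces.linear.axioms(3)]
  module_hom.neg[OF Vector_Spaces.linear.axioms(3)] module_hom.diff[OF Vector_Spaces.linear.axioms(3)]

lemmas lext_simps [simp] = pm_linear_simps[OF pm_linear_lext]

lemma lext_single [simp]: "lext f (Poly_Mapping.single k c) = scale c (f k)"
  by (simp add: lext_def)

lemma lext_id: "lext (\<lambda>k. Poly_Mapping.single k 1) a = a"
  unfolding lext_def by (intro poly_mapping_eqI)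
    (auto simp: lookup_sum lookup_single when_def sum.delta' in_keys_iff)

lemma lext_cong: "(\<And>k. k \<in> Poly_Mapping.keys a \<Longrightarrow> f k = g k) \<Longrightarrow> lext f a = lext g a"
  by (simp add: lext_def cong: sum.cong)

lemma lext_of_linear:
  assumes "pm_linear f" shows "f a = lext (\<lambda>k. f (Poly_Mapping.single k 1)) a"
proof -
  have "f a = f (lext (\<lambda>k. Poly_Mapping.single k 1) a)" by (simp add: lext_id)
  then show ?thesis
    by (simp add: lext_def pm_linear_simps[OF assms] flip: scale_single)
qed

text \<open>Agreement is asked only on the support of \<open>a\<close>. Parity, degree and
  membership in a kernel are all conditions on the support, and this is the point where they enter
  later arguments.\<close>

lemma linear_eq_on_keys:
  assumes "pm_linear f" "pm_linear g"
    and "\<And>k. k \<in> Poly_Mapping.keys a \<Longrightarrow> f (Poly_Mapping.single k 1) = g (Poly_Mapping.single k 1)"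
  shows "f a = g a"
  using lext_of_linear[OF assms(1), of a] lext_of_linear[OF assms(2), of a] assms(3)
  by (metis (no_types, lifting) lext_cong)

lemma keys_lext: "Poly_Mapping.keys (lext f a) \<subseteq> (\<Union>k\<in>Poly_Mapping.keys a. Poly_Mapping.keys (f k))"
  unfolding lext_def by (rule keys_sum_subset) (use keys_scale in fastforce)

definition bil :: "('b \<Rightarrow> 'b \<Rightarrow> ('c \<Rightarrow>\<^sub>0 'k)) \<Rightarrow> ('b \<Rightarrow>\<^sub>0 'k::field) \<Rightarrow> ('b \<Rightarrow>\<^sub>0 'k) \<Rightarrow> ('c \<Rightarrow>\<^sub>0 'k)" where
  "bil T a b = lext (\<lambda>u. lext (T u) b) a"

lemma linear_bil_left: "pm_linear (\<lambda>a. bil T a b)"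
  unfolding bil_def by (rule pm_linear_lext)

lemma linear_bil_right: "pm_linear (bil T a)"
  by (rule pm_linearI)
    (simp_all add: bil_def lext_def[of _ a] pm.scale_right_distrib sum.distrib pm.scale_sum_right mult.commute)

lemmas bil_simps [simp] = pm_linear_simps[OF linear_bil_left] pm_linear_simps[OF linear_bil_right]

lemma bil_single [simp]:
  "bil T (Poly_Mapping.single u c) (Poly_Mapping.single v d) = scale (c * d) (T u v)"
  by (simp add: bil_def)

lemma keys_bil:
  "Poly_Mapping.keys (bil T a b) \<subseteq> (\<Union>u\<in>Poly_Mapping.keys a. \<Union>v\<in>Poly_Mapping.keys b. Poly_Mapping.keys (T u v))"
  unfolding bil_def by (rule order.trans[OF keys_lext UN_mono[OF subset_refl keys_lext]])

lemma bil_eq_sum: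
  "bil T a b = (\<Sum>u\<in>Poly_Mapping.keys a. \<Sum>v\<in>Poly_Mapping.keys b.
     scale (Poly_Mapping.lookup a u * Poly_Mapping.lookup b v) (T u v))"
  unfolding bil_def lext_def pm.scale_sum_right pm.scale_scale ..

lemma bilinear_eqI:
  assumes "\<And>b. pm_linear (\<lambda>a. F a b)" "\<And>a. pm_linear (F a)"
    and "\<And>b. pm_linear (\<lambda>a. G a b)" "\<And>a. pm_linear (G a)"
    and "\<And>u v. u \<in> Poly_Mapping.keys a \<Longrightarrow> v \<in> Poly_Mapping.keys b \<Longrightarrow>
      F (Poly_Mapping.single u 1) (Poly_Mapping.single v 1) = G (Poly_Mapping.single u 1) (Poly_Mapping.single v 1)"
  shows "F a b = G a b"
proof (rule linear_eq_on_keys[OF assms(1,3)])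
  fix u assume u: "u \<in> Poly_Mapping.keys a"
  show "F (Poly_Mapping.single u 1) b = G (Poly_Mapping.single u 1) b"
    by (rule linear_eq_on_keys[OF assms(2,4)]) (rule assms(5)[OF u])
qed

text \<open>When \<open>k\<close> occurs in \<open>f b\<close> for a single \<open>b\<close>, and
  there with coefficient 1, nothing can mix into that coordinate. Elements of kernels are later
  analysed coordinate by coordinate in this way.\<close>

lemma lookup_lext_delta:
  assumes "\<And>b. Poly_Mapping.lookup (f b) k = (if b = b0 then 1 else 0)"
  shows "Poly_Mapping.lookup (lext f a) k = Poly_Mapping.lookup a b0"
proof -
  have "Poly_Mapping.lookup (lext f a) k = (\<Sum>b\<in>Poly_Mapping.keys a. if b = b0 then Poly_Mapping.lookup a b0 else 0)"
    unfolding lext_def lookup_sum by (rule sum.cong) (auto simp: assms)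
  then show ?thesis by (simp add: in_keys_iff)
qed

lemma linear_zeroI:
  assumes "pm_linear f" "\<And>k. k \<in> Poly_Mapping.keys a \<Longrightarrow> f (Poly_Mapping.single k 1) = 0"
  shows "f a = 0"
  using lext_of_linear[OF assms(1), of a] assms(2) by (simp add: lext_def)

lemma linear_idI:
  fixes a :: "'a \<Rightarrow>\<^sub>0 'b::field"
  assumes "pm_linear f" "\<And>k. k \<in> Poly_Mapping.keys a \<Longrightarrow> f (Poly_Mapping.single k 1) = Poly_Mapping.single k 1"
  shows "f a = a"
proof -
  have "pm_linear (\<lambda>x :: 'a \<Rightarrow>\<^sub>0 'b. x)" by (rule pm_linearI) simp_all
  from linear_eq_on_keys[OF assms(1) this] assms(2) show ?thesis by blast
qed

section \<open>Epimorphisms and quotients of superalgebras\<close>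

text \<open>Only bilinearity is assumed: the free superalgebra, where the ideals and quotients are
  formed, does not satisfy the Lie axioms.\<close>

locale bilinear_superalgebra =
  fixes G :: "('k::field, 'v) superalgebra" (structure)
  assumes vs: "vectorspace class_ring G"
    and mult_closed [simp, intro]: "x \<in> carrier G \<Longrightarrow> y \<in> carrier G \<Longrightarrow> x \<otimes> y \<in> carrier G"
    and mult_add_left: "x \<in> carrier G \<Longrightarrow> y \<in> carrier G \<Longrightarrow> z \<in> carrier G \<Longrightarrow>
      (x \<oplus> y) \<otimes> z = (x \<otimes> z) \<oplus> (y \<otimes> z)"
    and mult_add_right: "x \<in> carrier G \<Longrightarrow> y \<in> carrier G \<Longrightarrow> z \<in> carrier G \<Longrightarrow>
      z \<otimes> (x \<oplus> y) = (z \<otimes> x) \<oplus> (z \<otimes> y)"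
    and mult_smult_left: "x \<in> carrier G \<Longrightarrow> y \<in> carrier G \<Longrightarrow> (c \<odot> x) \<otimes> y = c \<odot> (x \<otimes> y)"
    and mult_smult_right: "x \<in> carrier G \<Longrightarrow> y \<in> carrier G \<Longrightarrow> x \<otimes> (c \<odot> y) = c \<odot> (x \<otimes> y)"
begin

sublocale V: vectorspace class_ring G by (rule vs)

lemma zero_mult [simp]: "x \<in> carrier G \<Longrightarrow> \<zero> \<otimes> x = \<zero>"
  using mult_add_left[of \<zero> \<zero> x] by (metis V.M.add.r_cancel_one' V.M.zero_closed V.M.l_zero mult_closed)

lemma mult_zero [simp]: "x \<in> carrier G \<Longrightarrow> x \<otimes> \<zero> = \<zero>"
  using mult_add_right[of \<zero> \<zero> x] by (metis V.M.add.r_cancel_one' V.M.zero_closed V.M.l_zero mult_closed)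

lemma a_inv_smult: "x \<in> carrier G \<Longrightarrow> \<ominus> x = (- 1) \<odot> x"
proof -
  assume x: "x \<in> carrier G"
  have "((- 1) \<odot> x) \<oplus> x = ((- 1) \<odot> x) \<oplus> (1 \<odot> x)"
    using V.smult_one[OF x] by (simp add: class_ring_simps)
  also have "\<dots> = ((- 1) + 1) \<odot> x"
    using V.smult_l_distr[of "- 1" 1 x] x by (simp add: class_ring_simps)
  also have "\<dots> = \<zero>" using V.lmult_0[OF x] by (simp add: class_ring_simps)
  finally show ?thesis using x V.smult_closed[of "- 1" x]
    by (intro V.M.minus_equality) (auto simp: class_ring_simps)
qed

lemma ideal_abelian_subgroup:
  assumes "alg_ideal G I" shows "abelian_subgroup I G"
proof -
  from assms have sm: "submodule class_ring I G"
    unfolding alg_ideal_def subspace_def by auto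
  interpret I: submodule class_ring I G by (rule sm)
  have "subgroup I (add_monoid G)"
  proof (rule V.M.add.subgroupI)
    show "I \<subseteq> carrier G" by (rule I.subset)
    show "I \<noteq> {}" using I.zero_closed by blast
    show "\<ominus> a \<in> I" if "a \<in> I" for a
      using that I.smult_closed[of "- 1" a] a_inv_smult[of a] I.subset by (auto simp: class_ring_simps)
  qed auto
  then show ?thesis
    by (intro abelian_subgroupI3 additive_subgroup.intro V.abelian_group_axioms)
qed

lemma carrier_quotient: "carrier (quotient_superalgebra G I) = (+>) I ` carrier G"
  by (auto simp: quotient_superalgebra_def FactRing_def A_RCOSETS_def' a_r_coset_def')

end

definition superalgebra_epi :: "('v \<Rightarrow> 'w) \<Rightarrow> ('k::field, 'v) superalgebra \<Rightarrow> ('k, 'w) superalgebra \<Rightarrow> bool" where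
  "superalgebra_epi \<pi> G H \<longleftrightarrow>
     \<pi> ` carrier G = carrier H \<and> \<pi> \<zero>\<^bsub>G\<^esub> = \<zero>\<^bsub>H\<^esub> \<and>
     (\<forall>x\<in>carrier G. \<forall>y\<in>carrier G. \<pi> (x \<oplus>\<^bsub>G\<^esub> y) = \<pi> x \<oplus>\<^bsub>H\<^esub> \<pi> y \<and> \<pi> (x \<otimes>\<^bsub>G\<^esub> y) = \<pi> x \<otimes>\<^bsub>H\<^esub> \<pi> y) \<and>
     (\<forall>c. \<forall>x\<in>carrier G. \<pi> (c \<odot>\<^bsub>G\<^esub> x) = c \<odot>\<^bsub>H\<^esub> \<pi> x) \<and>
     (\<forall>p. \<pi> ` homog G p = homog H p)"

lemma superalgebra_epiD:
  assumes "superalgebra_epi \<pi> G H"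
  shows "\<pi> ` carrier G = carrier H" "\<pi> \<zero>\<^bsub>G\<^esub> = \<zero>\<^bsub>H\<^esub>"
    "x \<in> carrier G \<Longrightarrow> y \<in> carrier G \<Longrightarrow> \<pi> (x \<oplus>\<^bsub>G\<^esub> y) = \<pi> x \<oplus>\<^bsub>H\<^esub> \<pi> y"
    "x \<in> carrier G \<Longrightarrow> y \<in> carrier G \<Longrightarrow> \<pi> (x \<otimes>\<^bsub>G\<^esub> y) = \<pi> x \<otimes>\<^bsub>H\<^esub> \<pi> y"
    "x \<in> carrier G \<Longrightarrow> \<pi> (c \<odot>\<^bsub>G\<^esub> x) = c \<odot>\<^bsub>H\<^esub> \<pi> x"
    "\<pi> ` homog G p = homog H p"
    "x \<in> carrier G \<Longrightarrow> \<pi> x \<in> carrier H"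
  using assms unfolding superalgebra_epi_def by auto

lemma superalgebra_epi_comp:
  assumes "superalgebra_epi \<pi> G H" "superalgebra_epi \<sigma> H K"
  shows "superalgebra_epi (\<sigma> \<circ> \<pi>) G K"
proof -
  note d = superalgebra_epiD[OF assms(1)] and e = superalgebra_epiD[OF assms(2)]
  show ?thesis unfolding superalgebra_epi_def image_comp[symmetric] by (simp add: d e)
qed

text \<open>Every axiom is an equation between elements that have preimages in \<open>G\<close>, so
  it is transported along the surjection. This is how all quotients acquire their vector space
  structure.\<close>

lemma (in bilinear_superalgebra) epi_bilinear:
  assumes "superalgebra_epi \<pi> G H"
  shows "bilinear_superalgebra H"
proof -
  note d = superalgebra_epiD[OF assms]
  have ex: "\<exists>u\<in>carrier G. x = \<pi> u" if "x \<in> carrier H" for x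
    using that d(1) by blast
  note [simp] = d(3,4,5)[symmetric] d(2)[symmetric] d(7)
  have ab: "abelian_group H"
  proof (rule abelian_groupI)
    fix x assume "x \<in> carrier H"
    then obtain u where u: "u \<in> carrier G" "x = \<pi> u" using ex by blast
    then have "\<pi> (\<ominus> u) \<oplus>\<^bsub>H\<^esub> x = \<zero>\<^bsub>H\<^esub>" by (simp add: V.M.l_neg)
    moreover have "\<pi> (\<ominus> u) \<in> carrier H" using u by simp
    ultimately show "\<exists>y\<in>carrier H. y \<oplus>\<^bsub>H\<^esub> x = \<zero>\<^bsub>H\<^esub>" by blast
  qed (auto dest!: ex simp: V.M.a_ac)
  have smult: "c \<odot> x \<in> carrier G" "(b + c) \<odot> x = (b \<odot> x) \<oplus> (c \<odot> x)"
      "c \<odot> (x \<oplus> y) = (c \<odot> x) \<oplus> (c \<odot> y)" "(b * c) \<odot> x = b \<odot> (c \<odot> x)" "1 \<odot> x = x"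
    if "x \<in> carrier G" "y \<in> carrier G" for b c x y
    using V.smult_closed[of c x] V.smult_l_distr[of b c x] V.smult_r_distr[of c x y]
      V.smult_assoc1[of b c x] V.smult_one[of x] that by (simp_all add: class_ring_simps)
  have "module class_ring H"
    by (rule moduleI[OF V.R.cring_axioms ab]; simp add: class_ring_simps; (drule ex)+; clarify; simp add: smult)
  then have vs: "vectorspace class_ring H"
    by (rule vectorspace.intro) (rule V.field.field_axioms)
  show ?thesis
    by (rule bilinear_superalgebra.intro[OF vs]; (drule ex)+; clarify;
      simp add: smult mult_add_left mult_add_right mult_smult_left mult_smult_right)
qed

lemma (in bilinear_superalgebra) epi_image_submodule:
  assumes "superalgebra_epi \<pi> G H" "submodule class_ring I G"
  shows "submodule class_ring (\<pi> ` I) H"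
proof -
  note d = superalgebra_epiD[OF assms(1)]
  interpret H: bilinear_superalgebra H by (rule epi_bilinear[OF assms(1)])
  interpret I: submodule class_ring I G by (rule assms(2))
  show ?thesis
  proof
    show "\<pi> ` I \<subseteq> carrier H" using I.subset d(7) by blast
    show "\<zero>\<^bsub>H\<^esub> \<in> \<pi> ` I" using d(2) I.zero_closed by (metis imageI)
    show "v \<oplus>\<^bsub>H\<^esub> w \<in> \<pi> ` I" if vw: "v \<in> \<pi> ` I" "w \<in> \<pi> ` I" for v w
    proof -
      obtain x where x: "v = \<pi> x" "x \<in> I" using vw(1) by (rule imageE)
      obtain y where y: "w = \<pi> y" "y \<in> I" using vw(2) by (rule imageE)
      show ?thesis
        unfolding x(1) y(1) d(3)[OF subsetD[OF I.subset x(2)] subsetD[OF I.subset y(2)], symmetric]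
        by (rule imageI[OF I.m_closed[OF x(2) y(2)]])
    qed
    show "c \<odot>\<^bsub>H\<^esub> v \<in> \<pi> ` I" if v: "v \<in> \<pi> ` I" for c v
    proof -
      obtain x where x: "v = \<pi> x" "x \<in> I" using v by (rule imageE)
      show ?thesis
        unfolding x(1) d(5)[OF subsetD[OF I.subset x(2)], symmetric]
        by (rule imageI[OF I.smult_closed[OF _ x(2)]]) simp
    qed
  qed
qed

lemma (in bilinear_superalgebra) epi_image_ideal:
  assumes "superalgebra_epi \<pi> G H" "alg_ideal G I"
  shows "alg_ideal H (\<pi> ` I)"
proof -
  note d = superalgebra_epiD[OF assms(1)]
  interpret H: bilinear_superalgebra H by (rule epi_bilinear[OF assms(1)])
  have sm: "submodule class_ring I G" and id: "x \<in> carrier G \<Longrightarrow> y \<in> I \<Longrightarrow> x \<otimes> y \<in> I \<and> y \<otimes> x \<in> I" for x y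
    using assms(2) unfolding alg_ideal_def subspace_def by auto
  then have IG: "I \<subseteq> carrier G" unfolding submodule_def by blast
  have "x \<otimes>\<^bsub>H\<^esub> y \<in> \<pi> ` I \<and> y \<otimes>\<^bsub>H\<^esub> x \<in> \<pi> ` I" if xy: "x \<in> carrier H" "y \<in> \<pi> ` I" for x y
  proof -
    obtain u where u: "x = \<pi> u" "u \<in> carrier G" using xy(1) d(1) by blast
    obtain v where v: "y = \<pi> v" "v \<in> I" using xy(2) by (rule imageE)
    show ?thesis
      unfolding u(1) v(1) d(4)[OF u(2) subsetD[OF IG v(2)], symmetric]
        d(4)[OF subsetD[OF IG v(2)] u(2), symmetric]
      using id[OF u(2) v(2)] by blast
  qed
  then show ?thesis
    unfolding alg_ideal_def subspace_def using H.vs epi_image_submodule[OF assms(1) sm] by blast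
qed

text \<open>Products and scalar multiples of cosets are defined as unions over all representatives.
  Since \<open>I\<close> is a subspace and a two-sided ideal, all cosets in such a union coincide,
  and the union collapses to a single coset.\<close>

lemma (in bilinear_superalgebra) quotient_epi:
  assumes "alg_ideal G I"
  shows "superalgebra_epi ((+>) I) G (quotient_superalgebra G I)"
proof -
  interpret I: abelian_subgroup I G by (rule ideal_abelian_subgroup[OF assms])
  have ideal: "x \<otimes> y \<in> I" "y \<otimes> x \<in> I" if "x \<in> carrier G" "y \<in> I" for x y
    using assms that unfolding alg_ideal_def by auto
  have smult_I: "c \<odot> y \<in> I" if "y \<in> I" for c y
    using assms that unfolding alg_ideal_def subspace_def submodule_def by (auto simp: class_ring_simps)
  have smult_closed: "c \<odot> x \<in> carrier G" if "x \<in> carrier G" for c x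
    using V.smult_closed[of c x] that by (simp add: class_ring_simps)
  have smult_add: "c \<odot> (x \<oplus> y) = (c \<odot> x) \<oplus> (c \<odot> y)" if "x \<in> carrier G" "y \<in> carrier G" for c x y
    using V.smult_r_distr[of c x y] that by (simp add: class_ring_simps)
  have rep: "\<exists>h\<in>I. u = h \<oplus> x" if "u \<in> I +> x" for u x
    using that by (auto simp: a_r_coset_def')
  have coset: "I +> (h \<oplus> x) = I +> x" if "h \<in> I" "x \<in> carrier G" for h x
    by (rule I.a_repr_independence'[symmetric]) (use that in \<open>auto simp: a_r_coset_def'\<close>)
  have m: "rcoset_mult G I (I +> x) (I +> y) = I +> (x \<otimes> y)" if xy: "x \<in> carrier G" "y \<in> carrier G" for x y
  proof -
    have "I +> (u \<otimes> v) = I +> (x \<otimes> y)" if uv: "u \<in> I +> x" "v \<in> I +> y" for u v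
    proof -
      obtain h k where h: "h \<in> I" "u = h \<oplus> x" and k: "k \<in> I" "v = k \<oplus> y"
        using rep[OF uv(1)] rep[OF uv(2)] by blast
      note c = I.a_Hcarr[OF h(1)] I.a_Hcarr[OF k(1)]
      have "u \<otimes> v = (h \<otimes> v \<oplus> x \<otimes> k) \<oplus> x \<otimes> y"
        using xy c k h by (simp add: mult_add_left mult_add_right V.M.a_ac)
      moreover have "h \<otimes> v \<oplus> x \<otimes> k \<in> I"
        using xy c h(1) k by (intro I.a_closed ideal) auto
      ultimately show ?thesis using coset xy by simp
    qed
    then show ?thesis
      unfolding rcoset_mult_def using I.a_rcos_self xy by blast
  qed
  have s: "(\<Union>u\<in>I +> x. I +> (c \<odot> u)) = I +> (c \<odot> x)" if x: "x \<in> carrier G" for c x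
  proof -
    have "I +> (c \<odot> u) = I +> (c \<odot> x)" if u: "u \<in> I +> x" for u
    proof -
      obtain h where h: "h \<in> I" "u = h \<oplus> x" using rep[OF u] by blast
      show ?thesis using h x I.a_Hcarr[OF h(1)] smult_I[OF h(1)] smult_closed
        by (simp add: smult_add coset)
    qed
    then show ?thesis using I.a_rcos_self x by blast
  qed
  have z: "I +> \<zero> = I"
    using I.a_subset V.M.a_coset_add_zero by blast
  show ?thesis
    unfolding superalgebra_epi_def carrier_quotient
    by (simp add: quotient_superalgebra_def FactRing_def z m s I.a_rcos_sum)
qed

lemma (in bilinear_superalgebra) coset_eq_iff:
  assumes "alg_ideal G I" "x \<in> carrier G" "y \<in> carrier G"
  shows "I +> x = I +> y \<longleftrightarrow> x \<ominus> y \<in> I"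
proof -
  interpret I: abelian_subgroup I G by (rule ideal_abelian_subgroup[OF assms(1)])
  show ?thesis
    using I.a_rcos_module[OF assms(3,2)] I.a_repr_independence'[of x y] I.a_rcos_self assms(2,3)
    unfolding a_minus_def by metis
qed

definition superalgebra_iso :: "('v \<Rightarrow> 'w) \<Rightarrow> ('k::field, 'v) superalgebra \<Rightarrow> ('k, 'w) superalgebra \<Rightarrow> bool" where
  "superalgebra_iso \<phi> G H \<longleftrightarrow> superalgebra_epi \<phi> G H \<and> inj_on \<phi> (carrier G)"

lemma superalgebra_iso_isomorphic:
  "superalgebra_iso \<phi> G H \<Longrightarrow> isomorphic_superalgebras G H"
  unfolding isomorphic_superalgebras_def
  by (intro exI[of _ \<phi>])
    (auto simp: superalgebra_iso_def superalgebra_epi_def LinearCombinations.module_hom_def bij_betw_def)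

text \<open>The map is forced by \<open>\<phi> (\<pi> x) = \<sigma> x\<close>; equality of the
  fibres makes it well defined and injective. With \<open>G\<close> the free superalgebra,
  \<open>H\<close> the model and \<open>K\<close> the contragredient superalgebra, recognizing
  \<open>K\<close> becomes a comparison of kernels.\<close>

lemma superalgebra_epi_factor:
  assumes G: "bilinear_superalgebra G" "\<And>p. homog G p \<subseteq> carrier G"
    and \<pi>: "superalgebra_epi \<pi> G H" and \<sigma>: "superalgebra_epi \<sigma> G K"
    and ker: "\<And>x y. x \<in> carrier G \<Longrightarrow> y \<in> carrier G \<Longrightarrow> \<pi> x = \<pi> y \<longleftrightarrow> \<sigma> x = \<sigma> y"
  obtains \<phi> where "superalgebra_iso \<phi> H K" "\<And>x. x \<in> carrier G \<Longrightarrow> \<phi> (\<pi> x) = \<sigma> x"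
proof -
  interpret bilinear_superalgebra G by (rule G)
  note d = superalgebra_epiD[OF \<pi>] and e = superalgebra_epiD[OF \<sigma>]
  define \<phi> where "\<phi> = \<sigma> \<circ> inv_into (carrier G) \<pi>"
  have \<phi>: "\<phi> (\<pi> x) = \<sigma> x" if "x \<in> carrier G" for x
    using that ker[of "inv_into (carrier G) \<pi> (\<pi> x)" x]
    by (simp add: \<phi>_def inv_into_into f_inv_into_f)
  have ex: "\<exists>u\<in>carrier G. x = \<pi> u" if "x \<in> carrier H" for x
    using that d(1) by blast
  have im: "\<phi> ` \<pi> ` X = \<sigma> ` X" if "X \<subseteq> carrier G" for X
    unfolding image_image using \<phi> that by (intro image_cong) auto
  have "superalgebra_epi \<phi> H K"
    unfolding superalgebra_epi_def
  proof (intro conjI ballI allI)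
    show "\<phi> ` carrier H = carrier K" using im[of "carrier G"] d(1) e(1) by simp
    show "\<phi> \<zero>\<^bsub>H\<^esub> = \<zero>\<^bsub>K\<^esub>" using \<phi>[OF V.M.zero_closed] d(2) e(2) by simp
    show "\<phi> ` homog H p = homog K p" for p using im[OF G(2)[of p]] d(6) e(6) by simp
    show "\<phi> (x \<oplus>\<^bsub>H\<^esub> y) = \<phi> x \<oplus>\<^bsub>K\<^esub> \<phi> y" "\<phi> (x \<otimes>\<^bsub>H\<^esub> y) = \<phi> x \<otimes>\<^bsub>K\<^esub> \<phi> y"
      if "x \<in> carrier H" "y \<in> carrier H" for x y
      using that by (auto dest!: ex simp: d(3,4)[symmetric] \<phi> e(3,4))
    show "\<phi> (c \<odot>\<^bsub>H\<^esub> x) = c \<odot>\<^bsub>K\<^esub> \<phi> x" if "x \<in> carrier H" for x c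
      using that V.smult_closed[of c] by (auto dest!: ex simp: d(5)[symmetric] \<phi> e(5) class_ring_simps)
  qed
  moreover have "inj_on \<phi> (carrier H)"
    by (rule inj_onI) (auto dest!: ex simp: \<phi> ker)
  ultimately show ?thesis using that \<phi> unfolding superalgebra_iso_def by blast
qed

lemma superalgebra_iso_inverse:
  assumes "bilinear_superalgebra G" "\<And>p. homog G p \<subseteq> carrier G" "superalgebra_iso \<phi> G H"
  obtains \<psi> where "superalgebra_iso \<psi> H G" "\<And>x. x \<in> carrier G \<Longrightarrow> \<psi> (\<phi> x) = x"
proof -
  have id: "superalgebra_epi (\<lambda>x. x) G G" unfolding superalgebra_epi_def by auto
  have \<phi>: "superalgebra_epi \<phi> G H" "inj_on \<phi> (carrier G)"
    using assms(3) unfolding superalgebra_iso_def by auto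
  show ?thesis
    by (rule superalgebra_epi_factor[OF assms(1,2) \<phi>(1) id])
      (use \<phi>(2) that in \<open>auto simp: inj_on_eq_iff\<close>)
qed

lemma bilinear_lie_superalgebra:
  assumes "lie_superalgebra G" shows "bilinear_superalgebra G"
proof -
  have h: "(\<lambda>y. x \<otimes>\<^bsub>G\<^esub> y) \<in> LinearCombinations.module_hom class_ring G G" "(\<lambda>y. y \<otimes>\<^bsub>G\<^esub> x) \<in> LinearCombinations.module_hom class_ring G G"
    if "x \<in> carrier G" for x
    using assms that unfolding lie_superalgebra_def by auto
  have "vectorspace class_ring G" using assms unfolding lie_superalgebra_def by simp
  then show ?thesis
    by (rule bilinear_superalgebra.intro)
      (use h in \<open>simp_all add: LinearCombinations.module_hom_def Pi_iff\<close>)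
qed

lemma lie_superalgebra_homog_subset: "lie_superalgebra G \<Longrightarrow> homog G p \<subseteq> carrier G"
  unfolding lie_superalgebra_def subspace_def submodule_def by auto

text \<open>The Lie axioms are verified in the model and reach the contragredient superalgebra
  through this lemma. Each relator of \<open>H\<close> is the image of the same relator of
  \<open>G\<close> formed with homogeneous preimages.\<close>

lemma lie_superalgebra_iso:
  assumes G: "lie_superalgebra G" and \<phi>: "superalgebra_iso \<phi> G H"
  shows "lie_superalgebra H"
proof -
  have epi: "superalgebra_epi \<phi> G H" and inj: "inj_on \<phi> (carrier G)"
    using \<phi> unfolding superalgebra_iso_def by blast+
  note d = superalgebra_epiD[OF epi]
  interpret G: bilinear_superalgebra G by (rule bilinear_lie_superalgebra[OF G])
  interpret H: bilinear_superalgebra H by (rule G.epi_bilinear[OF epi])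
  have hG: "x \<in> homog G q \<Longrightarrow> x \<in> carrier G" for x q using lie_superalgebra_homog_subset[OF G] by blast
  have sub: "submodule class_ring (homog G q) G" for q
    using G unfolding lie_superalgebra_def subspace_def by blast
  have ex: "\<exists>u\<in>homog G q. x = \<phi> u" if "x \<in> homog H q" for x q using that d(6) by blast
  have subH: "submodule class_ring (homog H q) H" for q
    using G.epi_image_submodule[OF epi sub[of q]] unfolding d(6) .
  have smult: "c \<odot>\<^bsub>G\<^esub> u \<in> carrier G" if "u \<in> carrier G" for c u
    using G.V.smult_closed[of c u] that by (simp add: class_ring_simps)
  have smultH: "c \<odot>\<^bsub>H\<^esub> u \<in> carrier H" if "u \<in> carrier H" for c u
    using H.V.smult_closed[of c u] that by (simp add: class_ring_simps)
  have neg: "\<phi> (\<ominus>\<^bsub>G\<^esub> u) = \<ominus>\<^bsub>H\<^esub> \<phi> u" if "u \<in> carrier G" for u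
    unfolding G.a_inv_smult[OF that] H.a_inv_smult[OF d(7)[OF that]] by (rule d(5)[OF that])
  show ?thesis
    unfolding lie_superalgebra_def
  proof (intro conjI allI ballI)
    show "vectorspace class_ring H" by (rule H.vs)
    show "subspace class_ring (homog H q) H" for q unfolding subspace_def using subH H.vs by blast
    show "homog H 0 \<inter> homog H 1 = {\<zero>\<^bsub>H\<^esub>}"
    proof
      show "homog H 0 \<inter> homog H 1 \<subseteq> {\<zero>\<^bsub>H\<^esub>}"
      proof
        fix x assume "x \<in> homog H 0 \<inter> homog H 1"
        then obtain u w where u: "u \<in> homog G 0" "x = \<phi> u" and w: "w \<in> homog G 1" "x = \<phi> w" using ex by blast
        then have "u = w" using inj_onD[OF inj] hG by metis
        then have "u \<in> homog G 0 \<inter> homog G 1" using u w by blast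
        also have "\<dots> = {\<zero>\<^bsub>G\<^esub>}" using G unfolding lie_superalgebra_def by blast
        finally show "x \<in> {\<zero>\<^bsub>H\<^esub>}" using u(2) d(2) by simp
      qed
      show "{\<zero>\<^bsub>H\<^esub>} \<subseteq> homog H 0 \<inter> homog H 1" using submodule.zero_closed[OF subH] by blast
    qed
    show "homog H 0 <+>\<^bsub>H\<^esub> homog H 1 = carrier H"
    proof
      show "homog H 0 <+>\<^bsub>H\<^esub> homog H 1 \<subseteq> carrier H"
      proof
        fix x assume "x \<in> homog H 0 <+>\<^bsub>H\<^esub> homog H 1"
        then obtain a b where "a \<in> homog H 0" "b \<in> homog H 1" "x = a \<oplus>\<^bsub>H\<^esub> b" unfolding set_add_def' by blast
        moreover have "homog H q \<subseteq> carrier H" for q using subH[of q] unfolding submodule_def by blast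
        ultimately show "x \<in> carrier H" by (metis H.V.M.add.m_closed subsetD)
      qed
      show "carrier H \<subseteq> homog H 0 <+>\<^bsub>H\<^esub> homog H 1"
      proof
        fix x assume "x \<in> carrier H"
        then obtain u where u: "u \<in> carrier G" "x = \<phi> u" using d(1) by blast
        have "carrier G = homog G 0 <+>\<^bsub>G\<^esub> homog G 1" using G unfolding lie_superalgebra_def by blast
        then obtain a b where ab: "a \<in> homog G 0" "b \<in> homog G 1" "u = a \<oplus>\<^bsub>G\<^esub> b"
          using u(1) unfolding set_add_def' by blast
        then have "x = \<phi> a \<oplus>\<^bsub>H\<^esub> \<phi> b" using u(2) d(3) hG by metis
        moreover have "\<phi> a \<in> homog H 0" "\<phi> b \<in> homog H 1" using ab d(6) by blast+
        ultimately show "x \<in> homog H 0 <+>\<^bsub>H\<^esub> homog H 1" unfolding set_add_def' by blast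
      qed
    qed
    show "(\<lambda>y. x \<otimes>\<^bsub>H\<^esub> y) \<in> LinearCombinations.module_hom class_ring H H"
      "(\<lambda>y. y \<otimes>\<^bsub>H\<^esub> x) \<in> LinearCombinations.module_hom class_ring H H" if "x \<in> carrier H" for x
      using that unfolding LinearCombinations.module_hom_def
      by (simp_all add: Pi_iff H.mult_add_left H.mult_add_right H.mult_smult_left H.mult_smult_right)
    show "x \<otimes>\<^bsub>H\<^esub> y \<in> homog H (q + r)" if xy: "x \<in> homog H q" "y \<in> homog H r" for q r x y
    proof -
      obtain u w where u: "u \<in> homog G q" "x = \<phi> u" and w: "w \<in> homog G r" "y = \<phi> w"
        using ex[OF xy(1)] ex[OF xy(2)] by blast
      have "u \<otimes>\<^bsub>G\<^esub> w \<in> homog G (q + r)" using G u(1) w(1) unfolding lie_superalgebra_def by blast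
      then have "\<phi> (u \<otimes>\<^bsub>G\<^esub> w) \<in> homog H (q + r)" using d(6) by blast
      then show ?thesis using d(4)[OF hG[OF u(1)] hG[OF w(1)]] u(2) w(2) by simp
    qed
    have rel: "lie_relators G \<subseteq> {\<zero>\<^bsub>G\<^esub>}" using G unfolding lie_superalgebra_def by blast
    show "lie_relators H \<subseteq> {\<zero>\<^bsub>H\<^esub>}"
    proof
      fix a assume "a \<in> lie_relators H"
      then consider
        (skew) x y r q where "x \<in> homog H r" "y \<in> homog H q" "a = (x \<otimes>\<^bsub>H\<^esub> y) \<oplus>\<^bsub>H\<^esub> (koszul_sign r q \<odot>\<^bsub>H\<^esub> (y \<otimes>\<^bsub>H\<^esub> x))"
      | (jacobi) x y z r q s where "x \<in> homog H r" "y \<in> homog H q" "z \<in> homog H s"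
          "a = (x \<otimes>\<^bsub>H\<^esub> (y \<otimes>\<^bsub>H\<^esub> z)) \<ominus>\<^bsub>H\<^esub> (((x \<otimes>\<^bsub>H\<^esub> y) \<otimes>\<^bsub>H\<^esub> z) \<oplus>\<^bsub>H\<^esub> (koszul_sign r q \<odot>\<^bsub>H\<^esub> (y \<otimes>\<^bsub>H\<^esub> (x \<otimes>\<^bsub>H\<^esub> z))))"
      | (cube) x where "x \<in> homog H 1" "a = x \<otimes>\<^bsub>H\<^esub> (x \<otimes>\<^bsub>H\<^esub> x)"
        unfolding lie_relators_def by blast
      then have "\<exists>b\<in>lie_relators G. a = \<phi> b"
      proof cases
        case skew
        obtain u w where u: "u \<in> homog G r" "x = \<phi> u" and w: "w \<in> homog G q" "y = \<phi> w"
          using ex[OF skew(1)] ex[OF skew(2)] by blast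
        let ?b = "(u \<otimes>\<^bsub>G\<^esub> w) \<oplus>\<^bsub>G\<^esub> (koszul_sign r q \<odot>\<^bsub>G\<^esub> (w \<otimes>\<^bsub>G\<^esub> u))"
        have "?b \<in> lie_relators G" unfolding lie_relators_def using u(1) w(1) by blast
        moreover have "a = \<phi> ?b"
          unfolding skew(3) u(2) w(2) using hG[OF u(1)] hG[OF w(1)] by (simp add: d smult)
        ultimately show ?thesis by blast
      next
        case jacobi
        obtain u w t where u: "u \<in> homog G r" "x = \<phi> u" and w: "w \<in> homog G q" "y = \<phi> w"
          and t: "t \<in> homog G s" "z = \<phi> t"
          using ex[OF jacobi(1)] ex[OF jacobi(2)] ex[OF jacobi(3)] by blast
        let ?b = "(u \<otimes>\<^bsub>G\<^esub> (w \<otimes>\<^bsub>G\<^esub> t)) \<ominus>\<^bsub>G\<^esub> (((u \<otimes>\<^bsub>G\<^esub> w) \<otimes>\<^bsub>G\<^esub> t) \<oplus>\<^bsub>G\<^esub> (koszul_sign r q \<odot>\<^bsub>G\<^esub> (w \<otimes>\<^bsub>G\<^esub> (u \<otimes>\<^bsub>G\<^esub> t))))"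
        have "?b \<in> lie_relators G" unfolding lie_relators_def using u(1) w(1) t(1) by blast
        moreover have "a = \<phi> ?b"
          unfolding jacobi(4) u(2) w(2) t(2) a_minus_def using hG[OF u(1)] hG[OF w(1)] hG[OF t(1)]
          by (simp add: d smult neg)
        ultimately show ?thesis by blast
      next
        case cube
        obtain u where u: "u \<in> homog G 1" "x = \<phi> u" using ex[OF cube(1)] by blast
        have "u \<otimes>\<^bsub>G\<^esub> (u \<otimes>\<^bsub>G\<^esub> u) \<in> lie_relators G" unfolding lie_relators_def using u(1) by blast
        moreover have "a = \<phi> (u \<otimes>\<^bsub>G\<^esub> (u \<otimes>\<^bsub>G\<^esub> u))" unfolding cube(2) u(2) using hG[OF u(1)] by (simp add: d)
        ultimately show ?thesis by blast
      qed
      then show "a \<in> {\<zero>\<^bsub>H\<^esub>}" using rel d(2) by blast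
    qed
  qed
qed

lemma isomorphic_superalgebras_trans:
  assumes "isomorphic_superalgebras G H" "isomorphic_superalgebras H K"
  shows "isomorphic_superalgebras G K"
proof -
  obtain \<phi> where \<phi>: "\<phi> \<in> LinearCombinations.module_hom class_ring G H" "bij_betw \<phi> (carrier G) (carrier H)"
    "\<forall>x\<in>carrier G. \<forall>y\<in>carrier G. \<phi> (x \<otimes>\<^bsub>G\<^esub> y) = \<phi> x \<otimes>\<^bsub>H\<^esub> \<phi> y" "\<forall>p. \<phi> ` homog G p = homog H p"
    using assms(1) unfolding isomorphic_superalgebras_def by blast
  obtain \<psi> where \<psi>: "\<psi> \<in> LinearCombinations.module_hom class_ring H K" "bij_betw \<psi> (carrier H) (carrier K)"
    "\<forall>x\<in>carrier H. \<forall>y\<in>carrier H. \<psi> (x \<otimes>\<^bsub>H\<^esub> y) = \<psi> x \<otimes>\<^bsub>K\<^esub> \<psi> y" "\<forall>p. \<psi> ` homog H p = homog K p"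
    using assms(2) unfolding isomorphic_superalgebras_def by blast
  have c: "\<phi> x \<in> carrier H" if "x \<in> carrier G" for x using \<phi>(2) that by (auto simp: bij_betw_def)
  have "\<psi> \<circ> \<phi> \<in> LinearCombinations.module_hom class_ring G K"
    using \<phi>(1) \<psi>(1) c by (simp add: LinearCombinations.module_hom_def Pi_iff)
  moreover have "(\<psi> \<circ> \<phi>) ` homog G p = homog K p" for p
    unfolding image_comp[symmetric] using \<phi>(4) \<psi>(4) by simp
  moreover have "(\<psi> \<circ> \<phi>) (x \<otimes>\<^bsub>G\<^esub> y) = (\<psi> \<circ> \<phi>) x \<otimes>\<^bsub>K\<^esub> (\<psi> \<circ> \<phi>) y"
    if "x \<in> carrier G" "y \<in> carrier G" for x y
    using \<phi>(3) \<psi>(3) c that by simp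
  ultimately show ?thesis
    unfolding isomorphic_superalgebras_def using bij_betw_trans[OF \<phi>(2) \<psi>(2)] by blast
qed

section \<open>Superalgebras with given structure constants\<close>

text \<open>One format for two kinds of algebras: with words as basis and \<open>Brk\<close> as
  product it is the free superalgebra, with a finite type as basis it is a model given by structure
  constants. The set \<open>X\<close> serves to restrict words to the admissible letters.\<close>

definition pm_superalgebra ::
    "'b set \<Rightarrow> ('b \<Rightarrow> bit) \<Rightarrow> ('b \<Rightarrow> 'b \<Rightarrow> ('b \<Rightarrow>\<^sub>0 'k)) \<Rightarrow> ('k::field, 'b \<Rightarrow>\<^sub>0 'k) superalgebra" where
  "pm_superalgebra X p T =
     \<lparr>carrier = {a. Poly_Mapping.keys a \<subseteq> X}, mult = bil T, one = 0, zero = 0, add = (+), smult = scale,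
      homog = (\<lambda>q. {a. \<forall>w \<in> Poly_Mapping.keys a. w \<in> X \<and> p w = q})\<rparr>"

lemma pm_superalgebra_simps [simp]:
  "carrier (pm_superalgebra X p T) = {a. Poly_Mapping.keys a \<subseteq> X}"
  "mult (pm_superalgebra X p T) = bil T"
  "zero (pm_superalgebra X p T) = 0"
  "add (pm_superalgebra X p T) = (+)"
  "smult (pm_superalgebra X p T) = scale"
  "homog (pm_superalgebra X p T) q = {a. \<forall>w \<in> Poly_Mapping.keys a. w \<in> X \<and> p w = q}"
  by (simp_all add: pm_superalgebra_def)

lemma free_superalgebra_eq:
  "free_superalgebra X par =
     pm_superalgebra {w. set_nword w \<subseteq> X} (word_parity par) (\<lambda>u v. Poly_Mapping.single (Brk u v) 1)"
  unfolding free_superalgebra_def pm_superalgebra_def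
  by (auto simp: bil_eq_sum scale_def[symmetric] fun_eq_iff)

lemma pm_vectorspace:
  fixes T :: "'b \<Rightarrow> 'b \<Rightarrow> ('b \<Rightarrow>\<^sub>0 'k::field)"
  shows "vectorspace class_ring (pm_superalgebra X p T)"
proof -
  let ?G = "pm_superalgebra X p T"
  have ab: "abelian_group ?G"
  proof (rule abelian_groupI)
    show "\<exists>y\<in>carrier ?G. y \<oplus>\<^bsub>?G\<^esub> x = \<zero>\<^bsub>?G\<^esub>" if "x \<in> carrier ?G" for x
      using that by (intro bexI[of _ "- x"]) (auto simp: in_keys_iff)
  qed (auto simp: add.assoc add.commute dest!: subsetD[OF keys_add])
  have "module class_ring ?G"
    by (rule moduleI[OF class_cring.cring_axioms ab])
      (auto simp: class_ring_simps pm.scale_left_distrib pm.scale_right_distrib dest!: subsetD[OF keys_scale])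
  then show ?thesis
    by (rule vectorspace.intro) (rule class_field.field_axioms)
qed

lemma pm_bilinear_superalgebra:
  assumes "\<And>u v. u \<in> X \<Longrightarrow> v \<in> X \<Longrightarrow> Poly_Mapping.keys (T u v) \<subseteq> X"
  shows "bilinear_superalgebra (pm_superalgebra X p T)"
proof (rule bilinear_superalgebra.intro[OF pm_vectorspace])
  have "Poly_Mapping.keys (bil T a b) \<subseteq> X" if "Poly_Mapping.keys a \<subseteq> X" "Poly_Mapping.keys b \<subseteq> X" for a b
    using that assms by (intro order.trans[OF keys_bil] UN_least) blast
  then show "a \<otimes>\<^bsub>pm_superalgebra X p T\<^esub> b \<in> carrier (pm_superalgebra X p T)"
    if "a \<in> carrier (pm_superalgebra X p T)" "b \<in> carrier (pm_superalgebra X p T)" for a b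
    using that by simp
qed simp_all

lemma pm_minus:
  assumes "a \<in> carrier (pm_superalgebra X p T)" "b \<in> carrier (pm_superalgebra X p T)"
  shows "a \<ominus>\<^bsub>pm_superalgebra X p T\<^esub> b = a - b" "\<ominus>\<^bsub>pm_superalgebra X p T\<^esub> b = - b"
proof -
  interpret vectorspace class_ring "pm_superalgebra X p T" by (rule pm_vectorspace)
  have "- b \<in> carrier (pm_superalgebra X p T)" using assms(2) by (simp add: in_keys_iff subset_iff)
  then show m: "\<ominus>\<^bsub>pm_superalgebra X p T\<^esub> b = - b"
    using M.minus_equality[of "- b" b] assms(2) by simp
  show "a \<ominus>\<^bsub>pm_superalgebra X p T\<^esub> b = a - b"
    unfolding a_minus_def m by simp
qed

lemma pm_alg_idealI:
  assumes "I \<subseteq> carrier (pm_superalgebra X p T)" "0 \<in> I" "\<And>a b. a \<in> I \<Longrightarrow> b \<in> I \<Longrightarrow> a + b \<in> I"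
    and "\<And>c a. a \<in> I \<Longrightarrow> scale c a \<in> I"
    and "\<And>x a. Poly_Mapping.keys x \<subseteq> X \<Longrightarrow> a \<in> I \<Longrightarrow> bil T x a \<in> I"
    and "\<And>x a. Poly_Mapping.keys x \<subseteq> X \<Longrightarrow> a \<in> I \<Longrightarrow> bil T a x \<in> I"
  shows "alg_ideal (pm_superalgebra X p T) I"
  using assms pm_vectorspace[of X p T] unfolding alg_ideal_def subspace_def submodule_def
  by (auto simp: vectorspace_def class_ring_simps)

lemma pm_alg_idealD:
  assumes "alg_ideal (pm_superalgebra X p T) I"
  shows "a \<in> I \<Longrightarrow> Poly_Mapping.keys a \<subseteq> X" "0 \<in> I" "a \<in> I \<Longrightarrow> b \<in> I \<Longrightarrow> a + b \<in> I"
    "a \<in> I \<Longrightarrow> scale c a \<in> I" "Poly_Mapping.keys x \<subseteq> X \<Longrightarrow> a \<in> I \<Longrightarrow> bil T x a \<in> I"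
    "Poly_Mapping.keys x \<subseteq> X \<Longrightarrow> a \<in> I \<Longrightarrow> bil T a x \<in> I"
  using assms unfolding alg_ideal_def subspace_def submodule_def
  by (auto simp: class_ring_simps)

definition pm_filter :: "('b \<Rightarrow> bool) \<Rightarrow> ('b \<Rightarrow>\<^sub>0 'k::field) \<Rightarrow> ('b \<Rightarrow>\<^sub>0 'k)" where
  "pm_filter P = lext (\<lambda>k. if P k then Poly_Mapping.single k 1 else 0)"

lemma lookup_pm_filter [simp]:
  "Poly_Mapping.lookup (pm_filter P a) k = (if P k then Poly_Mapping.lookup a k else 0)"
proof -
  have "Poly_Mapping.lookup (pm_filter P a) k =
      (\<Sum>x\<in>Poly_Mapping.keys a. if x = k then (if P k then Poly_Mapping.lookup a k else 0) else 0)"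
    unfolding pm_filter_def lext_def lookup_sum
    by (intro sum.cong) (auto simp: lookup_single when_def)
  then show ?thesis by (auto simp: in_keys_iff)
qed

lemma keys_pm_filter: "Poly_Mapping.keys (pm_filter P a) = {k \<in> Poly_Mapping.keys a. P k}"
  by (auto simp: in_keys_iff split: if_splits)

lemma pm_filter_eqI: "(\<And>k. k \<in> Poly_Mapping.keys a \<Longrightarrow> P k) \<Longrightarrow> pm_filter P a = a"
  by (rule poly_mapping_eqI) (auto simp: in_keys_iff)

text \<open>Used twice for the evaluation map: with parity it gives surjectivity on the even and the
  odd part, with degree it shows that the kernel is graded.\<close>

lemma lext_pm_filter:
  assumes "\<And>k b. k \<in> Poly_Mapping.keys a \<Longrightarrow> b \<in> Poly_Mapping.keys (f k) \<Longrightarrow> Q b = P k"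
  shows "lext f (pm_filter P a) = pm_filter Q (lext f a)"
proof (rule poly_mapping_eqI)
  fix b
  have "lext f (pm_filter P a) =
      (\<Sum>k\<in>Poly_Mapping.keys a. scale (Poly_Mapping.lookup (pm_filter P a) k) (f k))"
    by (rule lext_eq_sum) (auto simp: keys_pm_filter)
  moreover have "(if P k then Poly_Mapping.lookup a k else 0) * Poly_Mapping.lookup (f k) b =
      (if Q b then Poly_Mapping.lookup a k * Poly_Mapping.lookup (f k) b else 0)"
    if "k \<in> Poly_Mapping.keys a" for k
    using assms[OF that, of b] by (auto simp: in_keys_iff)
  ultimately show "Poly_Mapping.lookup (lext f (pm_filter P a)) b = Poly_Mapping.lookup (pm_filter Q (lext f a)) b"
    by (simp add: lext_def lookup_sum)
qed

lemma pm_sum_filter: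
  assumes "finite Q" "f ` Poly_Mapping.keys a \<subseteq> Q"
  shows "a = (\<Sum>q\<in>Q. pm_filter (\<lambda>k. f k = q) a)"
proof (rule poly_mapping_eqI)
  fix k
  have "f k \<in> Q" if "Poly_Mapping.lookup a k \<noteq> 0"
    using assms(2) that by (auto simp: in_keys_iff)
  then show "Poly_Mapping.lookup a k = Poly_Mapping.lookup (\<Sum>q\<in>Q. pm_filter (\<lambda>k. f k = q) a) k"
    using assms(1) by (auto simp: lookup_sum)
qed

lemma fin_dim_image:
  fixes T :: "'b \<Rightarrow> 'b \<Rightarrow> ('b \<Rightarrow>\<^sub>0 'k::field)"
  assumes "finite (UNIV :: 'b set)" and \<psi>: "superalgebra_epi \<psi> (pm_superalgebra UNIV p T) G"
  shows "vectorspace.fin_dim class_ring G"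
proof -
  interpret M: bilinear_superalgebra "pm_superalgebra UNIV p T" by (rule pm_bilinear_superalgebra) simp
  interpret G: bilinear_superalgebra G by (rule M.epi_bilinear[OF \<psi>])
  note e = superalgebra_epiD[OF \<psi>, simplified]
  let ?A = "range (\<lambda>b. \<psi> (Poly_Mapping.single b 1))"
  have A: "?A \<subseteq> carrier G" using e(7) by blast
  have span: "submodule class_ring (G.V.span ?A) G" by (rule G.V.span_is_submodule[OF A])
  have "\<psi> (\<Sum>k\<in>F. scale (Poly_Mapping.lookup a k) (Poly_Mapping.single k 1)) \<in> G.V.span ?A" for a F
  proof (induction F rule: infinite_finite_induct)
    case (insert k F)
    have "\<psi> (Poly_Mapping.single k 1) \<in> G.V.span ?A" using G.V.in_own_span[OF A] by blast
    then have "\<psi> (scale (Poly_Mapping.lookup a k) (Poly_Mapping.single k 1)) \<in> G.V.span ?A"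
      unfolding e(5) by (intro submodule.smult_closed[OF span]) simp_all
    then show ?case unfolding sum.insert[OF insert.hyps] e(3) by (rule submodule.m_closed[OF span _ insert.IH])
  qed (use e(2) submodule.zero_closed[OF span] in simp_all)
  then have "\<psi> (lext (\<lambda>k. Poly_Mapping.single k 1) a) \<in> G.V.span ?A" for a
    unfolding lext_def .
  then have "\<psi> a \<in> G.V.span ?A" for a
    unfolding lext_id .
  then have "carrier G \<subseteq> G.V.span ?A" unfolding e(1)[symmetric] by (rule image_subsetI)
  then have "G.V.gen_set ?A" using G.V.span_is_subset2[OF A] by blast
  then show ?thesis unfolding G.V.fin_dim_def using A assms(1) by blast
qed

section \<open>Reduction of words in a contragredient superalgebra\<close>

abbreviation brk :: "('k::field, 'h) free_elem \<Rightarrow> ('k, 'h) free_elem \<Rightarrow> ('k, 'h) free_elem" where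
  "brk \<equiv> bil (\<lambda>u v. Poly_Mapping.single (Brk u v) 1)"

inductive_set right_normed :: "(nat \<Rightarrow> 'h generator) \<Rightarrow> nat \<Rightarrow> 'h generator nword set"
  for X :: "nat \<Rightarrow> 'h generator" and n :: nat where
  letter: "i < n \<Longrightarrow> Letter (X i) \<in> right_normed X n"
| brk: "i < n \<Longrightarrow> w \<in> right_normed X n \<Longrightarrow> Brk (Letter (X i)) w \<in> right_normed X n"

lemma set_right_normed: "w \<in> right_normed X n \<Longrightarrow> set_nword w \<subseteq> X ` {..<n}"
  by (induction rule: right_normed.induct) auto

section \<open>The ideal of relations in the free superalgebra\<close>

locale contragredient_data =
  fixes A :: "int mat" and par :: "nat \<Rightarrow> bit" and R :: "('k::field, 'h) realization"
  assumes cartan_vectorspace: "vectorspace class_ring (cartan_space R)"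
    and coroot_closed: "i < dim_row A \<Longrightarrow> coroot R i \<in> carrier (cartan_space R)"
begin

abbreviation n where "n \<equiv> dim_row A"
abbreviation h where "h \<equiv> cartan_space R"
abbreviation gens where "gens \<equiv> generators n R"
abbreviation words where "words \<equiv> {w. set_nword w \<subseteq> gens}"
abbreviation L where "L \<equiv> free_contragredient A par R"
abbreviation J where "J \<equiv> tilde_ideal A par R"
abbreviation wp where "wp \<equiv> word_parity (gen_parity par :: 'h generator \<Rightarrow> bit)"
abbreviation cl :: "'h generator nword \<Rightarrow> ('k, 'h) free_elem" where "cl w \<equiv> Poly_Mapping.single w 1"

sublocale h: vectorspace class_ring h by (rule cartan_vectorspace)

lemma L_eq: "L = pm_superalgebra words wp (\<lambda>u v. cl (Brk u v))"
  by (simp add: free_contragredient_def free_superalgebra_eq)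

sublocale L: bilinear_superalgebra L
  unfolding L_eq by (rule pm_bilinear_superalgebra) simp

lemma L_simps:
  "carrier L = {a. Poly_Mapping.keys a \<subseteq> words}" "mult L = brk" "zero L = 0" "add L = (+)" "smult L = scale"
  "homog L q = {a. \<forall>w \<in> Poly_Mapping.keys a. w \<in> words \<and> wp w = q}"
  by (simp_all add: L_eq)

lemma L_minus: "a \<in> carrier L \<Longrightarrow> b \<in> carrier L \<Longrightarrow> a \<ominus>\<^bsub>L\<^esub> b = a - b"
  unfolding L_eq by (rule pm_minus)

lemma homog_L_subset: "homog L q \<subseteq> carrier L"
  by (auto simp: L_simps)

lemma generators_iff [simp]:
  "GenH x \<in> gens \<longleftrightarrow> x \<in> carrier h" "GenE i \<in> gens \<longleftrightarrow> i < n" "GenF i \<in> gens \<longleftrightarrow> i < n"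
  by (auto simp: generators_def)

lemma lie_relators_L_subset: "lie_relators L \<subseteq> carrier L"
proof -
  have k: "koszul_sign p q \<odot>\<^bsub>L\<^esub> y \<in> carrier L" if "y \<in> carrier L" for p q y
    using L.V.smult_closed[of "koszul_sign p q" y] that by (simp add: class_ring_simps)
  show ?thesis
    unfolding lie_relators_def
    by (intro Un_least subsetI; clarify; (drule subsetD[OF homog_L_subset])+;
      (assumption | rule L.V.M.add.m_closed L.V.M.minus_closed L.mult_closed k)+)
qed

lemma contragredient_relators_subset: "contragredient_relators A par R \<subseteq> carrier L"
proof -
  have d: "a - b \<in> carrier L" "a + b \<in> carrier L" if "a \<in> carrier L" "b \<in> carrier L" for a b
    using that keys_diff_subset[of a b] keys_add[of a b] by (auto simp: L_simps)
  have s: "scale c a \<in> carrier L" if "a \<in> carrier L" for a c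
    using that keys_scale[of c a] by (auto simp: L_simps)
  have l: "cl (Letter x) \<in> carrier L" if "x \<in> gens" for x using that by (simp add: L_simps)
  have b: "brk a b \<in> carrier L" if "a \<in> carrier L" "b \<in> carrier L" for a b
    using that L.mult_closed by (simp add: L_simps(2))
  have e: "(if i = j then cl (Letter (GenH (coroot R i))) else 0) \<in> carrier L" if "i < n" for i j
    using coroot_closed[OF that] by (auto simp: L_simps)
  have hc: "x \<oplus>\<^bsub>h\<^esub> y \<in> carrier h" "c \<odot>\<^bsub>h\<^esub> x \<in> carrier h" if "x \<in> carrier h" "y \<in> carrier h" for x y c
    using that h.smult_closed[of c x] by (simp_all add: class_ring_simps)
  show ?thesis
    unfolding contragredient_relators_def Let_def L_simps(2,4,5)
    by (intro Un_least subsetI; clarify; intro d s b l e; simp add: hc)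
qed

lemma J_alg_ideal: "alg_ideal L J"
  and J_superset: "lie_relators L \<union> contragredient_relators A par R \<subseteq> J"
  and J_least: "alg_ideal L I \<Longrightarrow> lie_relators L \<union> contragredient_relators A par R \<subseteq> I \<Longrightarrow> J \<subseteq> I"
proof -
  let ?S = "lie_relators L \<union> contragredient_relators A par R"
  have J: "J = \<Inter> {I. alg_ideal L I \<and> ?S \<subseteq> I}"
    by (simp add: tilde_ideal_def ideal_generated_def Let_def)
  have S: "?S \<subseteq> carrier L" using lie_relators_L_subset contragredient_relators_subset by blast
  \<comment> \<open>At least one ideal contains \<open>?S\<close>, so the intersection is not over
    the empty family and stays inside the carrier.\<close>
  have top: "alg_ideal L (carrier L)"
    unfolding L_eq using L.mult_closed[unfolded L_simps]
    by (intro pm_alg_idealI) (auto dest!: subsetD[OF keys_add] subsetD[OF keys_scale] subsetD[OF keys_bil])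
  show "?S \<subseteq> J" "alg_ideal L I \<Longrightarrow> ?S \<subseteq> I \<Longrightarrow> J \<subseteq> I" unfolding J by blast+
  have JL: "J \<subseteq> carrier L" unfolding J using top S by blast
  note D = pm_alg_idealD[where X = words and p = wp and T = "\<lambda>u v. cl (Brk u v)", folded L_eq]
  show "alg_ideal L J"
    unfolding L_eq
  proof (rule pm_alg_idealI)
    show "J \<subseteq> carrier (pm_superalgebra words wp (\<lambda>u v. cl (Brk u v)))" using JL L_eq by simp
  qed (auto simp: J intro: D)
qed

lemmas J_rules = pm_alg_idealD[OF J_alg_ideal[unfolded L_eq]]

lemma J_closed:
  "0 \<in> J" "a \<in> J \<Longrightarrow> b \<in> J \<Longrightarrow> a + b \<in> J" "a \<in> J \<Longrightarrow> scale c a \<in> J" "a \<in> J \<Longrightarrow> - a \<in> J"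
  "a \<in> J \<Longrightarrow> b \<in> J \<Longrightarrow> a - b \<in> J"
  using J_rules pm.scale_minus_left[of 1] pm.scale_one by (metis diff_conv_add_uminus)+

lemma J_mult: "x \<in> carrier L \<Longrightarrow> a \<in> J \<Longrightarrow> brk x a \<in> J" "x \<in> carrier L \<Longrightarrow> a \<in> J \<Longrightarrow> brk a x \<in> J"
  using J_rules(5,6) by (auto simp: L_simps)

lemma J_subset: "J \<subseteq> carrier L" using J_rules(1) by (auto simp: L_simps)

lemma cl_homog: "w \<in> words \<Longrightarrow> cl w \<in> homog L (wp w)"
  by (simp add: L_simps)

lemma J_skew:
  assumes "u \<in> words" "v \<in> words"
  shows "cl (Brk u v) + scale (koszul_sign (wp u) (wp v)) (cl (Brk v u)) \<in> J"
proof -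
  have "(cl u \<otimes>\<^bsub>L\<^esub> cl v) \<oplus>\<^bsub>L\<^esub> (koszul_sign (wp u) (wp v) \<odot>\<^bsub>L\<^esub> (cl v \<otimes>\<^bsub>L\<^esub> cl u)) \<in> lie_relators L"
    unfolding lie_relators_def using cl_homog assms by blast
  then show ?thesis using J_superset by (auto simp: L_simps)
qed

lemma J_jacobi:
  assumes "u \<in> words" "v \<in> words" "w \<in> words"
  shows "cl (Brk u (Brk v w)) - (cl (Brk (Brk u v) w) +
    scale (koszul_sign (wp u) (wp v)) (cl (Brk v (Brk u w)))) \<in> J"
proof -
  have "(cl u \<otimes>\<^bsub>L\<^esub> (cl v \<otimes>\<^bsub>L\<^esub> cl w)) \<ominus>\<^bsub>L\<^esub> (((cl u \<otimes>\<^bsub>L\<^esub> cl v) \<otimes>\<^bsub>L\<^esub> cl w) \<oplus>\<^bsub>L\<^esub>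
      (koszul_sign (wp u) (wp v) \<odot>\<^bsub>L\<^esub> (cl v \<otimes>\<^bsub>L\<^esub> (cl u \<otimes>\<^bsub>L\<^esub> cl w)))) \<in> lie_relators L"
    unfolding lie_relators_def using cl_homog assms by blast
  then show ?thesis using J_superset assms
    by (subst (asm) L_minus) (auto simp: L_simps dest!: subsetD[OF keys_add] split: if_splits)
qed

lemma J_relations:
  "x \<in> carrier h \<Longrightarrow> y \<in> carrier h \<Longrightarrow>
     cl (Letter (GenH (x \<oplus>\<^bsub>h\<^esub> y))) - (cl (Letter (GenH x)) + cl (Letter (GenH y))) \<in> J"
  "x \<in> carrier h \<Longrightarrow> cl (Letter (GenH (c \<odot>\<^bsub>h\<^esub> x))) - scale c (cl (Letter (GenH x))) \<in> J"
  "i < n \<Longrightarrow> j < n \<Longrightarrow> i \<noteq> j \<Longrightarrow> cl (Brk (Letter (GenE i)) (Letter (GenF j))) \<in> J"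
  "i < n \<Longrightarrow> cl (Brk (Letter (GenE i)) (Letter (GenF i))) - cl (Letter (GenH (coroot R i))) \<in> J"
  "x \<in> carrier h \<Longrightarrow> j < n \<Longrightarrow>
     cl (Brk (Letter (GenH x)) (Letter (GenE j))) - scale (simple_root R j x) (cl (Letter (GenE j))) \<in> J"
  "x \<in> carrier h \<Longrightarrow> j < n \<Longrightarrow>
     cl (Brk (Letter (GenH x)) (Letter (GenF j))) + scale (simple_root R j x) (cl (Letter (GenF j))) \<in> J"
  "x \<in> carrier h \<Longrightarrow> y \<in> carrier h \<Longrightarrow> cl (Brk (Letter (GenH x)) (Letter (GenH y))) \<in> J"
proof -
  let ?C = "contragredient_relators A par R"
  have C: "?C \<subseteq> J" using J_superset by blast
  note rel = contragredient_relators_def[of A par R, unfolded Let_def L_simps]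
  show "cl (Letter (GenH (x \<oplus>\<^bsub>h\<^esub> y))) - (cl (Letter (GenH x)) + cl (Letter (GenH y))) \<in> J"
    if "x \<in> carrier h" "y \<in> carrier h" by (rule subsetD[OF C]) (use that in \<open>unfold rel, blast\<close>)
  show "cl (Letter (GenH (c \<odot>\<^bsub>h\<^esub> x))) - scale c (cl (Letter (GenH x))) \<in> J"
    if "x \<in> carrier h" by (rule subsetD[OF C]) (use that in \<open>unfold rel, blast\<close>)
  show "cl (Brk (Letter (GenE i)) (Letter (GenF j))) \<in> J" if "i < n" "j < n" "i \<noteq> j"
  proof -
    have "brk (cl (Letter (GenE i))) (cl (Letter (GenF j))) - (if i = j then cl (Letter (GenH (coroot R i))) else 0) \<in> ?C"
      using that(1,2) unfolding rel by blast
    then show ?thesis using C that by auto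
  qed
  show "cl (Brk (Letter (GenE i)) (Letter (GenF i))) - cl (Letter (GenH (coroot R i))) \<in> J" if "i < n"
  proof -
    have "brk (cl (Letter (GenE i))) (cl (Letter (GenF i))) - (if i = i then cl (Letter (GenH (coroot R i))) else 0) \<in> ?C"
      using that unfolding rel by blast
    then show ?thesis using C by auto
  qed
  show "cl (Brk (Letter (GenH x)) (Letter (GenE j))) - scale (simple_root R j x) (cl (Letter (GenE j))) \<in> J"
    if "x \<in> carrier h" "j < n"
  proof -
    have "brk (cl (Letter (GenH x))) (cl (Letter (GenE j))) - scale (simple_root R j x) (cl (Letter (GenE j))) \<in> ?C"
      using that unfolding rel by blast
    then show ?thesis using C by auto
  qed
  show "cl (Brk (Letter (GenH x)) (Letter (GenF j))) + scale (simple_root R j x) (cl (Letter (GenF j))) \<in> J"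
    if "x \<in> carrier h" "j < n"
  proof -
    have "brk (cl (Letter (GenH x))) (cl (Letter (GenF j))) + scale (simple_root R j x) (cl (Letter (GenF j))) \<in> ?C"
      using that unfolding rel by blast
    then show ?thesis using C by auto
  qed
  show "cl (Brk (Letter (GenH x)) (Letter (GenH y))) \<in> J" if "x \<in> carrier h" "y \<in> carrier h"
  proof -
    have "brk (cl (Letter (GenH x))) (cl (Letter (GenH y))) \<in> ?C"
      using that unfolding rel by blast
    then show ?thesis using C by auto
  qed
qed

end

section \<open>Triangular decomposition modulo the relations\<close>

context contragredient_data begin

text \<open>A spanning statement modulo \<open>J\<close>: independence of the words in
  \<open>S\<close> is not claimed. It suffices because the relations only have to be followed down
  to the Cartan letters in degree 0, where the model decides injectivity.\<close>

definition red :: "'h generator nword set \<Rightarrow> ('k, 'h) free_elem set" where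
  "red S = {a \<in> carrier L. \<exists>b. Poly_Mapping.keys b \<subseteq> S \<inter> words \<and> a - b \<in> J}"

lemma red_add: "a \<in> red S \<Longrightarrow> b \<in> red S \<Longrightarrow> a + b \<in> red S"
proof -
  assume "a \<in> red S" "b \<in> red S"
  then obtain a' b' where a: "a \<in> carrier L" "Poly_Mapping.keys a' \<subseteq> S \<inter> words" "a - a' \<in> J"
    and b: "b \<in> carrier L" "Poly_Mapping.keys b' \<subseteq> S \<inter> words" "b - b' \<in> J"
    unfolding red_def by blast
  have "(a + b) - (a' + b') \<in> J" using J_closed(2)[OF a(3) b(3)] by (simp add: algebra_simps)
  moreover have "Poly_Mapping.keys (a' + b') \<subseteq> S \<inter> words" using a(2) b(2) keys_add[of a' b'] by blast
  moreover have "a + b \<in> carrier L" using a(1) b(1) keys_add[of a b] by (auto simp: L_simps)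
  ultimately show ?thesis unfolding red_def by blast
qed

lemma red_scale: "a \<in> red S \<Longrightarrow> scale c a \<in> red S"
proof -
  assume "a \<in> red S"
  then obtain a' where a: "a \<in> carrier L" "Poly_Mapping.keys a' \<subseteq> S \<inter> words" "a - a' \<in> J"
    unfolding red_def by blast
  have "scale c a - scale c a' \<in> J" using J_closed(3)[OF a(3), of c] by (simp add: pm.scale_right_diff_distrib)
  moreover have "Poly_Mapping.keys (scale c a') \<subseteq> S \<inter> words" using a(2) keys_scale[of c a'] by blast
  moreover have "scale c a \<in> carrier L" using a(1) keys_scale[of c a] by (auto simp: L_simps)
  ultimately show ?thesis unfolding red_def by blast
qed

lemma red_uminus: "a \<in> red S \<Longrightarrow> - a \<in> red S"
  using red_scale[of a S "- 1"] by simp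

lemma red_diff: "a \<in> red S \<Longrightarrow> b \<in> red S \<Longrightarrow> a - b \<in> red S"
  using red_add[of a S "- b"] red_uminus[of b S] by simp

lemma red_J: "a \<in> J \<Longrightarrow> a \<in> red S"
  using J_subset unfolding red_def by (auto intro!: exI[of _ 0])

lemma red_cong: "b \<in> red S \<Longrightarrow> a - b \<in> J \<Longrightarrow> a \<in> red S"
  using red_add[of "a - b" S b] red_J[of "a - b" S] by simp

lemma red_word: "w \<in> S \<Longrightarrow> w \<in> words \<Longrightarrow> cl w \<in> red S"
  unfolding red_def by (auto simp: L_simps J_closed(1) intro!: exI[of _ "cl w"])

lemma red_sum: "(\<And>i. i \<in> I \<Longrightarrow> f i \<in> red S) \<Longrightarrow> sum f I \<in> red S"
  by (induction I rule: infinite_finite_induct) (simp_all add: red_add red_J J_closed(1))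

text \<open>Since \<open>f\<close> maps \<open>J\<close> into itself, it may be evaluated on the
  representative supported in \<open>S\<close>.\<close>

lemma red_linear:
  assumes "pm_linear f" "a \<in> red S" "\<And>w. w \<in> S \<Longrightarrow> w \<in> words \<Longrightarrow> f (cl w) \<in> red S'"
    and "\<And>j. j \<in> J \<Longrightarrow> f j \<in> J"
  shows "f a \<in> red S'"
proof -
  obtain b where b: "Poly_Mapping.keys b \<subseteq> S \<inter> words" "a - b \<in> J"
    using assms(2) unfolding red_def by blast
  have "f b = (\<Sum>w\<in>Poly_Mapping.keys b. scale (Poly_Mapping.lookup b w) (f (cl w)))"
    by (subst lext_of_linear[OF assms(1)]) (simp add: lext_def)
  then have "f b \<in> red S'"
    using b(1) assms(3) by (simp add: red_sum red_scale subset_iff)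
  moreover have "f a - f b \<in> J"
    using assms(4)[OF b(2)] pm_linear_simps(6)[OF assms(1)] by simp
  ultimately show ?thesis by (rule red_cong)
qed

lemma red_mult:
  assumes "x \<in> carrier L" "a \<in> red S" "\<And>w. w \<in> S \<Longrightarrow> w \<in> words \<Longrightarrow> brk x (cl w) \<in> red S'"
  shows "brk x a \<in> red S'"
  by (rule red_linear[OF linear_bil_right assms(2,3)]) (use J_mult(1)[OF assms(1)] in auto)

lemma red_mono: "S \<subseteq> S' \<Longrightarrow> a \<in> red S \<Longrightarrow> a \<in> red S'"
  unfolding red_def by blast

lemma cl_L: "w \<in> words \<Longrightarrow> cl w \<in> carrier L"
  by (simp add: L_simps)

lemma red_jacobi:
  assumes "u \<in> words" "v \<in> words" "w \<in> words" "cl (Brk (Brk u v) w) \<in> red S" "cl (Brk v (Brk u w)) \<in> red S"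
  shows "cl (Brk u (Brk v w)) \<in> red S"
  by (rule red_cong[OF _ J_jacobi[OF assms(1-3)]])
    (intro red_add red_scale assms)

lemma red_jacobi':
  assumes "u \<in> words" "v \<in> words" "w \<in> words" "cl (Brk u (Brk v w)) \<in> red S" "cl (Brk v (Brk u w)) \<in> red S"
  shows "cl (Brk (Brk u v) w) \<in> red S"
proof (rule red_cong)
  show "cl (Brk u (Brk v w)) - scale (koszul_sign (wp u) (wp v)) (cl (Brk v (Brk u w))) \<in> red S"
    by (intro red_diff red_scale assms)
  show "cl (Brk (Brk u v) w) -
      (cl (Brk u (Brk v w)) - scale (koszul_sign (wp u) (wp v)) (cl (Brk v (Brk u w)))) \<in> J"
    using J_closed(4)[OF J_jacobi[OF assms(1-3)]] by (simp add: algebra_simps)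
qed

lemma red_skew:
  assumes "u \<in> words" "v \<in> words" "cl (Brk v u) \<in> red S"
  shows "cl (Brk u v) \<in> red S"
  using red_diff[OF red_J[OF J_skew[OF assms(1,2)]] red_scale[OF assms(3), of "koszul_sign (wp u) (wp v)"]] by simp

definition cartan_words :: "(nat \<Rightarrow>\<^sub>0 int) \<Rightarrow> 'h generator nword set" where
  "cartan_words q = (if q = 0 then (\<lambda>x. Letter (GenH x)) ` carrier h else {})"

definition rn_words :: "(nat \<Rightarrow> 'h generator) \<Rightarrow> (nat \<Rightarrow>\<^sub>0 int) \<Rightarrow> 'h generator nword set" where
  "rn_words X q = {w \<in> right_normed X n. word_degree w = q}"

text \<open>Modulo \<open>J\<close>, bracketing with a Cartan letter is an even derivation that has
  the letters \<open>X i\<close> as eigenvectors, so the eigenvalues add up along the word.\<close>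

lemma cartan_right_normed:
  assumes X: "\<And>i. i < n \<Longrightarrow> X i \<in> gens"
    and HX: "\<And>x i. x \<in> carrier h \<Longrightarrow> i < n \<Longrightarrow> \<exists>c. cl (Brk (Letter (GenH x)) (Letter (X i))) - scale c (cl (Letter (X i))) \<in> J"
    and w: "w \<in> right_normed X n" and x: "x \<in> carrier h"
  shows "\<exists>c. cl (Brk (Letter (GenH x)) w) - scale c (cl w) \<in> J"
  using w
proof (induction rule: right_normed.induct)
  case (letter i)
  then show ?case using HX[OF x] by blast
next
  case (brk i w)
  have trans: "a - scale (s + t) z \<in> J" if "a - (b + c) \<in> J" "b - scale s z \<in> J" "c - scale t z \<in> J"
    for a b c z :: "('k, 'h) free_elem" and s t
    using J_closed(2)[OF that(1) J_closed(2)[OF that(2,3)]] by (simp add: pm.scale_left_distrib algebra_simps)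
  let ?H = "Letter (GenH x)" and ?X = "Letter (X i)"
  have W: "?H \<in> words" "?X \<in> words" "w \<in> words"
    using x X[OF brk.hyps(1)] set_right_normed[OF brk.hyps(2)] X by auto
  obtain c where c: "cl (Brk ?H ?X) - scale c (cl ?X) \<in> J" using HX[OF x brk.hyps(1)] by blast
  obtain d where d: "cl (Brk ?H w) - scale d (cl w) \<in> J" using brk.IH by blast
  have jac: "cl (Brk ?H (Brk ?X w)) - (cl (Brk (Brk ?H ?X) w) + cl (Brk ?X (Brk ?H w))) \<in> J"
    using J_jacobi[OF W] by (simp add: koszul_sign_def)
  have 1: "cl (Brk (Brk ?H ?X) w) - scale c (cl (Brk ?X w)) \<in> J"
    using J_mult(2)[OF cl_L[OF W(3)] c] by simp
  have 2: "cl (Brk ?X (Brk ?H w)) - scale d (cl (Brk ?X w)) \<in> J"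
    using J_mult(1)[OF cl_L[OF W(2)] d] by simp
  have "cl (Brk ?H (Brk ?X w)) - scale (c + d) (cl (Brk ?X w)) \<in> J"
    by (rule trans[OF jac 1 2])
  then show ?case by blast
qed

text \<open>The Jacobi identity moves \<open>Y j\<close> inwards: in \<open>[Y j, [X i, w]] =
  [[Y j, X i], w] \<plusminus> [X i, [Y j, w]]\<close> the first term vanishes or is a Cartan
  element acting on \<open>w\<close> by a scalar, and the second is handled by induction.
  \<open>X\<close> and \<open>Y\<close> stay abstract so that one argument covers
  \<open>GenF\<close> acting on words in \<open>GenE\<close> and the reverse.\<close>

lemma opposite_right_normed:
  assumes X: "\<And>i. i < n \<Longrightarrow> X i \<in> gens" and Y: "\<And>i. i < n \<Longrightarrow> Y i \<in> gens"
    and HX: "\<And>x i. x \<in> carrier h \<Longrightarrow> i < n \<Longrightarrow> \<exists>c. cl (Brk (Letter (GenH x)) (Letter (X i))) - scale c (cl (Letter (X i))) \<in> J"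
    and YX: "\<And>i j. i < n \<Longrightarrow> j < n \<Longrightarrow> i \<noteq> j \<Longrightarrow> cl (Brk (Letter (Y j)) (Letter (X i))) \<in> J"
    and YXi: "\<And>i. i < n \<Longrightarrow> \<exists>c. cl (Brk (Letter (Y i)) (Letter (X i))) - scale c (cl (Letter (GenH (coroot R i)))) \<in> J"
    and deg: "\<And>i. word_degree (Letter (Y i)) + word_degree (Letter (X i)) = 0"
    and w: "w \<in> right_normed X n" and j: "j < n"
  shows "cl (Brk (Letter (Y j)) w) \<in>
    red (rn_words X (word_degree w + word_degree (Letter (Y j))) \<union> cartan_words (word_degree w + word_degree (Letter (Y j))))"
  using w
proof (induction rule: right_normed.induct)
  case (letter i)
  have deg': "word_degree (Letter (X i)) + word_degree (Letter (Y i)) = 0"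
    by (subst add.commute) (rule deg)
  show ?case
  proof (cases "i = j")
    case True
    obtain c where c: "cl (Brk (Letter (Y i)) (Letter (X i))) - scale c (cl (Letter (GenH (coroot R i)))) \<in> J"
      using YXi[OF letter] by blast
    have "cl (Letter (GenH (coroot R i))) \<in> red (cartan_words 0)"
      by (rule red_word) (use coroot_closed[OF letter] in \<open>auto simp: cartan_words_def\<close>)
    then have "cl (Letter (GenH (coroot R i))) \<in> red (rn_words X 0 \<union> cartan_words 0)"
      by (rule red_mono[rotated]) blast
    then have "cl (Brk (Letter (Y i)) (Letter (X i))) \<in> red (rn_words X 0 \<union> cartan_words 0)"
      by (rule red_cong[OF red_scale c])
    then show ?thesis using deg' unfolding True by (simp only:)
  next
    case False
    then show ?thesis using YX[OF letter j] by (intro red_J)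
  qed
next
  case (brk i w)
  let ?Y = "Letter (Y j)" and ?X = "Letter (X i)"
  let ?q = "word_degree w + word_degree ?Y"
  let ?r = "word_degree (Brk ?X w) + word_degree ?Y"
  have W: "?Y \<in> words" "?X \<in> words" "w \<in> words"
    using Y[OF j] X[OF brk.hyps(1)] set_right_normed[OF brk.hyps(2)] X by auto
  have 1: "cl (Brk (Brk ?Y ?X) w) \<in> red (rn_words X ?r \<union> cartan_words ?r)"
  proof (cases "i = j")
    case True
    obtain c where c: "cl (Brk ?Y ?X) - scale c (cl (Letter (GenH (coroot R i)))) \<in> J"
      using YXi[OF brk.hyps(1)] True by blast
    obtain d where d: "cl (Brk (Letter (GenH (coroot R i))) w) - scale d (cl w) \<in> J"
      using cartan_right_normed[OF X HX brk.hyps(2) coroot_closed[OF brk.hyps(1)]] by blast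
    have e: "cl (Brk (Brk ?Y ?X) w) - scale c (cl (Brk (Letter (GenH (coroot R i))) w)) \<in> J"
      using J_mult(2)[OF cl_L[OF W(3)] c] by simp
    \<comment> \<open>The degrees of \<open>Y i\<close> and \<open>X i\<close> cancel, so the target
      degree \<open>?r\<close> is that of \<open>w\<close>.\<close>
    have "a + b + c = b" if "c + a = 0" for a b c :: "nat \<Rightarrow>\<^sub>0 int"
    proof -
      have "a + b + c = b + (c + a)" by (simp add: add_ac)
      then show ?thesis using that by simp
    qed
    from this[OF deg[of i]] have r: "?r = word_degree w" using True by simp
    have "w \<in> rn_words X ?r" unfolding r rn_words_def using brk.hyps(2) by simp
    then have "cl w \<in> red (rn_words X ?r \<union> cartan_words ?r)"
      by (rule red_word[OF UnI1 W(3)])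
    then have "cl (Brk (Letter (GenH (coroot R i))) w) \<in> red (rn_words X ?r \<union> cartan_words ?r)"
      by (rule red_cong[OF red_scale d])
    then show ?thesis by (rule red_cong[OF red_scale e])
  next
    case False
    then show ?thesis
      using J_mult(2)[OF cl_L[OF W(3)] YX[OF brk.hyps(1) j]] by (intro red_J) simp
  qed
  have "brk (cl ?X) (cl (Brk ?Y w)) \<in> red (rn_words X ?r \<union> cartan_words ?r)"
  proof (rule red_mult[OF cl_L[OF W(2)] brk.IH])
    fix v assume v: "v \<in> rn_words X ?q \<union> cartan_words ?q" "v \<in> words"
    show "brk (cl ?X) (cl v) \<in> red (rn_words X ?r \<union> cartan_words ?r)"
    proof (cases "v \<in> rn_words X ?q")
      case True
      then have "Brk ?X v \<in> rn_words X ?r"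
        using brk.hyps(1) by (auto simp: rn_words_def add.assoc intro: right_normed.brk)
      then show ?thesis using red_word[of "Brk ?X v"] W(2) v(2) by simp
    next
      \<comment> \<open>A Cartan term can be present only if \<open>?q = 0\<close>; its bracket with
        \<open>X i\<close> is, up to skew-symmetry, a multiple of the letter \<open>X i\<close>
        itself.\<close>
      case False
      then obtain x where x: "?q = 0" "x \<in> carrier h" "v = Letter (GenH x)"
        using v(1) by (auto simp: cartan_words_def split: if_splits)
      obtain c where c: "cl (Brk v ?X) - scale c (cl ?X) \<in> J" using HX[OF x(2) brk.hyps(1)] x(3) by blast
      have r: "?r = word_degree ?X" using x(1) by (simp add: add.assoc)
      have "?X \<in> rn_words X ?r" unfolding r rn_words_def using brk.hyps(1) by (simp add: right_normed.letter)
      then have "cl ?X \<in> red (rn_words X ?r \<union> cartan_words ?r)"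
        by (rule red_word[OF UnI1 W(2)])
      then have "cl (Brk v ?X) \<in> red (rn_words X ?r \<union> cartan_words ?r)"
        by (rule red_cong[OF red_scale c])
      then show ?thesis using red_skew[OF W(2) v(2)] by simp
    qed
  qed
  then have "cl (Brk ?X (Brk ?Y w)) \<in> red (rn_words X ?r \<union> cartan_words ?r)"
    by (simp only: bil_single pm.scale_one mult_1_left)
  then show ?case by (rule red_jacobi[OF W 1])
qed

lemma HE: "x \<in> carrier h \<Longrightarrow> i < n \<Longrightarrow> \<exists>c. cl (Brk (Letter (GenH x)) (Letter (GenE i))) - scale c (cl (Letter (GenE i))) \<in> J"
  using J_relations(5) by blast

lemma HF: "x \<in> carrier h \<Longrightarrow> i < n \<Longrightarrow> \<exists>c. cl (Brk (Letter (GenH x)) (Letter (GenF i))) - scale c (cl (Letter (GenF i))) \<in> J"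
  using J_relations(6)[of x i] by (intro exI[of _ "- simple_root R i x"]) (simp add: single_uminus)

lemma FE: "i < n \<Longrightarrow> j < n \<Longrightarrow> i \<noteq> j \<Longrightarrow> cl (Brk (Letter (GenF j)) (Letter (GenE i))) \<in> J"
proof -
  assume a: "i < n" "j < n" "i \<noteq> j"
  let ?s = "koszul_sign (par j) (par i) :: 'k"
  have "cl (Brk (Letter (GenF j)) (Letter (GenE i))) + scale ?s (cl (Brk (Letter (GenE i)) (Letter (GenF j)))) \<in> J"
    using J_skew[of "Letter (GenF j)" "Letter (GenE i)"] a by simp
  from J_closed(5)[OF this J_closed(3)[OF J_relations(3)[OF a], of ?s]] show ?thesis by simp
qed

lemma FEi: "i < n \<Longrightarrow> \<exists>c. cl (Brk (Letter (GenF i)) (Letter (GenE i))) - scale c (cl (Letter (GenH (coroot R i)))) \<in> J"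
proof -
  assume a: "i < n"
  let ?s = "koszul_sign (par i) (par i) :: 'k"
  have 1: "cl (Brk (Letter (GenF i)) (Letter (GenE i))) + scale ?s (cl (Brk (Letter (GenE i)) (Letter (GenF i)))) \<in> J"
    using J_skew[of "Letter (GenF i)" "Letter (GenE i)"] a by simp
  have "cl (Brk (Letter (GenF i)) (Letter (GenE i))) - scale (- ?s) (cl (Letter (GenH (coroot R i)))) \<in> J"
    using J_closed(5)[OF 1 J_closed(3)[OF J_relations(4)[OF a], of ?s]]
    by (simp add: pm.scale_right_diff_distrib single_uminus)
  then show ?thesis by blast
qed

text \<open>The degree \<open>q\<close> part of a spanning set for the triangular decomposition into
  raising part, lowering part and Cartan subalgebra.\<close>

definition nf_words :: "(nat \<Rightarrow>\<^sub>0 int) \<Rightarrow> 'h generator nword set" where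
  "nf_words q = rn_words GenE q \<union> rn_words GenF q \<union> cartan_words q"

lemma letter_nf:
  assumes g: "g \<in> gens" and w: "w \<in> nf_words q" "w \<in> words"
  shows "cl (Brk (Letter g) w) \<in> red (nf_words (word_degree (Letter g) + q))"
proof -
  let ?r = "word_degree (Letter g) + q"
  have gw: "Letter g \<in> words" using g by simp
  have mono: "a \<in> red (rn_words X ?r \<union> cartan_words ?r) \<Longrightarrow> X = GenE \<or> X = GenF \<Longrightarrow> a \<in> red (nf_words ?r)" for a X
    by (rule red_mono[rotated]) (auto simp: nf_words_def)
  have E: "\<And>i. i < n \<Longrightarrow> GenE i \<in> gens" and F: "\<And>i. i < n \<Longrightarrow> GenF i \<in> gens" by simp_all
  consider (cartan) x where "q = 0" "x \<in> carrier h" "w = Letter (GenH x)"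
    | (E) "w \<in> right_normed GenE n" "word_degree w = q" | (F) "w \<in> right_normed GenF n" "word_degree w = q"
    using w(1) by (auto simp: nf_words_def rn_words_def cartan_words_def split: if_splits)
  then show ?thesis
  proof cases
    case cartan
    show ?thesis
    proof (cases g)
      case (GenH y)
      then show ?thesis using J_relations(7)[of y x] g cartan by (intro red_J) simp
    next
      case (GenE i)
      then have i: "i < n" using g by simp
      have "cl (Letter g) \<in> red (nf_words ?r)"
        using GenE i cartan by (intro red_word) (auto simp: nf_words_def rn_words_def intro: right_normed.letter)
      then have "cl (Brk w (Letter g)) \<in> red (nf_words ?r)"
        using red_cong[OF red_scale] HE[OF cartan(2) i] GenE cartan(3) by blast
      then show ?thesis by (rule red_skew[OF gw w(2)])
    next
      case (GenF i)
      then have i: "i < n" using g by simp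
      have "cl (Letter g) \<in> red (nf_words ?r)"
        using GenF i cartan by (intro red_word) (auto simp: nf_words_def rn_words_def intro: right_normed.letter)
      then have "cl (Brk w (Letter g)) \<in> red (nf_words ?r)"
        using red_cong[OF red_scale] HF[OF cartan(2) i] GenF cartan(3) by blast
      then show ?thesis by (rule red_skew[OF gw w(2)])
    qed
  next
    case E
    show ?thesis
    proof (cases g)
      case (GenH y)
      obtain c where "cl (Brk (Letter g) w) - scale c (cl w) \<in> J"
        using cartan_right_normed[OF _ HE E(1), of y] g GenH by auto
      moreover have "cl w \<in> red (nf_words ?r)" using w GenH by (intro red_word) auto
      ultimately show ?thesis using red_cong[OF red_scale] by blast
    next
      case (GenE i)
      then have "Brk (Letter g) w \<in> nf_words ?r"
        using E g by (auto simp: nf_words_def rn_words_def intro: right_normed.brk)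
      then show ?thesis using gw w(2) by (intro red_word) auto
    next
      case (GenF i)
      then have "cl (Brk (Letter g) w) \<in> red (rn_words GenE ?r \<union> cartan_words ?r)"
        using opposite_right_normed[OF _ _ HE FE FEi _ E(1), of i] g E(2) by (simp add: add.commute)
      then show ?thesis by (rule mono) simp
    qed
  next
    case F
    show ?thesis
    proof (cases g)
      case (GenH y)
      obtain c where "cl (Brk (Letter g) w) - scale c (cl w) \<in> J"
        using cartan_right_normed[OF _ HF F(1), of y] g GenH by auto
      moreover have "cl w \<in> red (nf_words ?r)" using w GenH by (intro red_word) auto
      ultimately show ?thesis using red_cong[OF red_scale] by blast
    next
      case (GenF i)
      then have "Brk (Letter g) w \<in> nf_words ?r"
        using F g by (auto simp: nf_words_def rn_words_def intro: right_normed.brk)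
      then show ?thesis using gw w(2) by (intro red_word) auto
    next
      case (GenE i)
      have EFi: "\<exists>c. cl (Brk (Letter (GenE i)) (Letter (GenF i))) - scale c (cl (Letter (GenH (coroot R i)))) \<in> J"
        if "i < n" for i using J_relations(4)[OF that] by (intro exI[of _ 1]) simp
      have EF: "cl (Brk (Letter (GenE j)) (Letter (GenF i))) \<in> J" if "i < n" "j < n" "i \<noteq> j" for i j
        using J_relations(3)[of j i] that by simp
      have "cl (Brk (Letter g) w) \<in> red (rn_words GenF ?r \<union> cartan_words ?r)"
        using opposite_right_normed[OF _ _ HF EF EFi _ F(1), of i] GenE g F(2) by (simp add: add.commute)
      then show ?thesis by (rule mono) simp
    qed
  qed
qed

text \<open>Bracketing with \<open>[u, v]\<close> is the supercommutator of the bracketings with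
  \<open>u\<close> and \<open>v\<close>, so stability under letters extends to all words. The
  auxiliary \<open>x\<close>, \<open>y\<close> treat both orders of \<open>u\<close> and
  \<open>v\<close> at once.\<close>

lemma word_nf:
  assumes "u \<in> words" "w \<in> nf_words q" "w \<in> words"
  shows "cl (Brk u w) \<in> red (nf_words (word_degree u + q))"
  using assms
proof (induction u arbitrary: w q)
  case (Letter g)
  then show ?case using letter_nf by simp
next
  case (Brk u v)
  have W: "u \<in> words" "v \<in> words" using Brk.prems(1) by auto
  have step: "cl (Brk x (Brk y w)) \<in> red (nf_words (word_degree u + word_degree v + q))"
    if xy: "x = u \<and> y = v \<or> x = v \<and> y = u" for x y
  proof -
    have IHx: "cl (Brk x w) \<in> red (nf_words (word_degree x + q))" if "w \<in> nf_words q" "w \<in> words" for w q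
      using Brk.IH that xy W by metis
    have IHy: "cl (Brk y w) \<in> red (nf_words (word_degree y + q))"
      using Brk.IH Brk.prems(2,3) xy W by metis
    have "brk (cl x) (cl (Brk y w)) \<in> red (nf_words (word_degree x + (word_degree y + q)))"
      by (rule red_mult[OF _ IHy]) (use IHx xy W cl_L in auto)
    moreover have "word_degree x + (word_degree y + q) = word_degree u + word_degree v + q"
      using xy by (auto simp: add_ac)
    ultimately show ?thesis by simp
  qed
  show ?case
    using red_jacobi'[OF W Brk.prems(3) step step] by simp
qed

lemma word_red: "w \<in> words \<Longrightarrow> cl w \<in> red (nf_words (word_degree w))"
proof (induction w)
  case (Letter g)
  then show ?case
    by (intro red_word; cases g)
      (auto simp: nf_words_def rn_words_def cartan_words_def intro: right_normed.letter)
next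
  case (Brk u v)
  then have W: "u \<in> words" "v \<in> words" by auto
  have "brk (cl u) (cl v) \<in> red (nf_words (word_degree u + word_degree v))"
    by (rule red_mult[OF cl_L[OF W(1)] Brk.IH(2)[OF W(2)]]) (use word_nf[OF W(1)] in simp)
  then show ?case by simp
qed

text \<open>The height of the degree separates the three families: it is positive on right-normed
  words in \<open>GenE\<close>, negative on those in \<open>GenF\<close>, and 0 in degree 0.\<close>

lemma nf_words_0: "nf_words 0 = (\<lambda>x. Letter (GenH x)) ` carrier h"
proof -
  define ht :: "(nat \<Rightarrow>\<^sub>0 int) \<Rightarrow> int" where "ht q = (\<Sum>i<n. Poly_Mapping.lookup q i)" for q
  have add: "ht (p + q) = ht p + ht q" for p q by (simp add: ht_def lookup_add sum.distrib)
  have one: "ht (Poly_Mapping.single i 1) = 1" if "i < n" for i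
    using that by (simp add: ht_def lookup_single when_def)
  have neg: "ht (- q) = - ht q" for q by (simp add: ht_def sum_negf)
  have diff: "ht (p - q) = ht p - ht q" for p q by (simp add: ht_def lookup_minus sum_subtractf)
  have "ht (word_degree w) > 0" if "w \<in> right_normed GenE n" for w :: "'h generator nword"
    using that by (induction rule: right_normed.induct) (auto simp: add one)
  moreover have "ht (word_degree w) < 0" if "w \<in> right_normed GenF n" for w :: "'h generator nword"
    using that by (induction rule: right_normed.induct) (auto simp: add diff one neg)
  moreover have "ht 0 = 0" by (simp add: ht_def)
  ultimately show ?thesis
    unfolding nf_words_def rn_words_def cartan_words_def by force
qed

text \<open>After reduction only Cartan letters are left, and a combination of them collapses to a
  single one because \<open>GenH\<close> is linear modulo \<open>J\<close>.\<close>

lemma degree_zero_reduces_to_cartan: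
  assumes a: "a \<in> carrier L" "\<And>w. w \<in> Poly_Mapping.keys a \<Longrightarrow> word_degree w = 0"
  shows "\<exists>x\<in>carrier h. a - cl (Letter (GenH x)) \<in> J"
proof -
  have "cl w \<in> red (nf_words 0)" if "w \<in> Poly_Mapping.keys a" for w
    using word_red[of w] a(2)[OF that] a(1) that by (auto simp: L_simps)
  then have "lext cl a \<in> red (nf_words 0)"
    unfolding lext_def by (intro red_sum red_scale)
  then obtain b where b: "Poly_Mapping.keys b \<subseteq> (\<lambda>x. Letter (GenH x)) ` carrier h" "a - b \<in> J"
    unfolding red_def nf_words_0 by (auto simp: lext_id)
  have "\<exists>x\<in>carrier h. (\<Sum>w\<in>F. scale (Poly_Mapping.lookup b w) (cl w)) - cl (Letter (GenH x)) \<in> J"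
    if "finite F" "F \<subseteq> (\<lambda>x. Letter (GenH x)) ` carrier h" for F
    using that
  proof (induction rule: finite_induct)
    case empty
    \<comment> \<open>The empty sum also needs a Cartan letter congruent to it; the homogeneity
      relation with scalar 0 supplies one.\<close>
    have "- (cl (Letter (GenH (0 \<odot>\<^bsub>h\<^esub> \<zero>\<^bsub>h\<^esub>))) - scale 0 (cl (Letter (GenH \<zero>\<^bsub>h\<^esub>)))) \<in> J"
      by (rule J_closed(4)[OF J_relations(2)]) simp
    then show ?case using h.smult_closed[of 0 "\<zero>\<^bsub>h\<^esub>"] by (intro bexI[of _ "0 \<odot>\<^bsub>h\<^esub> \<zero>\<^bsub>h\<^esub>"]) (auto simp: class_ring_simps)
  next
    case (insert w F)
    then obtain x y where x: "x \<in> carrier h" "(\<Sum>w\<in>F. scale (Poly_Mapping.lookup b w) (cl w)) - cl (Letter (GenH x)) \<in> J"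
      and y: "y \<in> carrier h" "w = Letter (GenH y)" by auto
    let ?c = "Poly_Mapping.lookup b w"
    have cy: "?c \<odot>\<^bsub>h\<^esub> y \<in> carrier h" using h.smult_closed[of ?c y] y(1) by (simp add: class_ring_simps)
    have "((\<Sum>w\<in>F. scale (Poly_Mapping.lookup b w) (cl w)) - cl (Letter (GenH x)))
       - (cl (Letter (GenH (?c \<odot>\<^bsub>h\<^esub> y))) - scale ?c (cl (Letter (GenH y))))
       - (cl (Letter (GenH (x \<oplus>\<^bsub>h\<^esub> (?c \<odot>\<^bsub>h\<^esub> y)))) - (cl (Letter (GenH x)) + cl (Letter (GenH (?c \<odot>\<^bsub>h\<^esub> y))))) \<in> J"
      by (intro J_closed(5) x(2) J_relations(1,2) x(1) y(1) cy)
    then have "(\<Sum>w\<in>insert w F. scale (Poly_Mapping.lookup b w) (cl w)) - cl (Letter (GenH (x \<oplus>\<^bsub>h\<^esub> (?c \<odot>\<^bsub>h\<^esub> y)))) \<in> J"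
      using insert.hyps y(2) by (simp add: algebra_simps)
    then show ?case using h.M.add.m_closed[OF x(1) cy] by blast
  qed
  from this[OF finite_keys b(1)] obtain x where x: "x \<in> carrier h" "lext cl b - cl (Letter (GenH x)) \<in> J"
    unfolding lext_def by blast
  then have "b - cl (Letter (GenH x)) \<in> J" by (simp add: lext_id)
  then have "a - cl (Letter (GenH x)) \<in> J" using J_closed(2)[OF b(2)] by (metis diff_add_cancel add_diff_eq)
  then show ?thesis using x(1) by blast
qed

end

section \<open>Recognizing a contragredient superalgebra\<close>

primrec word_eval :: "('b \<Rightarrow> 'b \<Rightarrow> ('b \<Rightarrow>\<^sub>0 'k)) \<Rightarrow> ('x \<Rightarrow> ('b \<Rightarrow>\<^sub>0 'k::field)) \<Rightarrow> 'x nword \<Rightarrow> ('b \<Rightarrow>\<^sub>0 'k)" where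
  "word_eval T \<gamma> (Letter x) = \<gamma> x"
| "word_eval T \<gamma> (Brk u v) = bil T (word_eval T \<gamma> u) (word_eval T \<gamma> v)"

text \<open>What identifies an algebra as the contragredient one: the defining relations hold
  (\<open>lie\<close> and \<open>\<gamma>_add\<close> to \<open>\<gamma>_HH\<close>), the Cartan
  space embeds (\<open>\<gamma>_inj\<close>), the images of the generators generate, and
  \<open>transitive\<close> forces every graded ideal avoiding the Cartan subalgebra into the kernel
  of evaluation. The measure \<open>rank\<close> makes the descent to degree 0 terminate; in the
  application it is the absolute value of the height.\<close>

locale contragredient_model = contragredient_data A par R
  for A :: "int mat" and par :: "nat \<Rightarrow> bit" and R :: "('k::field, 'h) realization" +
  fixes p :: "'b \<Rightarrow> bit" and T :: "'b \<Rightarrow> 'b \<Rightarrow> ('b \<Rightarrow>\<^sub>0 'k)" and dg :: "'b \<Rightarrow> (nat \<Rightarrow>\<^sub>0 int)"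
    and \<gamma> :: "'h generator \<Rightarrow> ('b \<Rightarrow>\<^sub>0 'k)" and rank :: "(nat \<Rightarrow>\<^sub>0 int) \<Rightarrow> nat"
  assumes T_parity: "b \<in> Poly_Mapping.keys (T u v) \<Longrightarrow> p b = p u + p v"
    and T_degree: "b \<in> Poly_Mapping.keys (T u v) \<Longrightarrow> dg b = dg u + dg v"
    and lie: "lie_relators (pm_superalgebra UNIV p T) \<subseteq> {0}"
    and \<gamma>_parity: "z \<in> generators (dim_row A) R \<Longrightarrow> b \<in> Poly_Mapping.keys (\<gamma> z) \<Longrightarrow> p b = gen_parity par z"
    and \<gamma>_degree: "z \<in> generators (dim_row A) R \<Longrightarrow> b \<in> Poly_Mapping.keys (\<gamma> z) \<Longrightarrow> dg b = word_degree (Letter z)"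
    and \<gamma>_add: "x \<in> carrier (cartan_space R) \<Longrightarrow> y \<in> carrier (cartan_space R) \<Longrightarrow>
      \<gamma> (GenH (x \<oplus>\<^bsub>cartan_space R\<^esub> y)) = \<gamma> (GenH x) + \<gamma> (GenH y)"
    and \<gamma>_smult: "x \<in> carrier (cartan_space R) \<Longrightarrow> \<gamma> (GenH (c \<odot>\<^bsub>cartan_space R\<^esub> x)) = scale c (\<gamma> (GenH x))"
    and \<gamma>_EF: "i < dim_row A \<Longrightarrow> j < dim_row A \<Longrightarrow>
      bil T (\<gamma> (GenE i)) (\<gamma> (GenF j)) = (if i = j then \<gamma> (GenH (coroot R i)) else 0)"
    and \<gamma>_HE: "x \<in> carrier (cartan_space R) \<Longrightarrow> j < dim_row A \<Longrightarrow>
      bil T (\<gamma> (GenH x)) (\<gamma> (GenE j)) = scale (simple_root R j x) (\<gamma> (GenE j))"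
    and \<gamma>_HF: "x \<in> carrier (cartan_space R) \<Longrightarrow> j < dim_row A \<Longrightarrow>
      bil T (\<gamma> (GenH x)) (\<gamma> (GenF j)) = - scale (simple_root R j x) (\<gamma> (GenF j))"
    and \<gamma>_HH: "x \<in> carrier (cartan_space R) \<Longrightarrow> y \<in> carrier (cartan_space R) \<Longrightarrow>
      bil T (\<gamma> (GenH x)) (\<gamma> (GenH y)) = 0"
    and \<gamma>_inj: "x \<in> carrier (cartan_space R) \<Longrightarrow> \<gamma> (GenH x) = 0 \<Longrightarrow> x = \<zero>\<^bsub>cartan_space R\<^esub>"
    and generated: "\<And>U. (\<And>a b. a \<in> U \<Longrightarrow> b \<in> U \<Longrightarrow> a + b \<in> U) \<Longrightarrow> (\<And>c a. a \<in> U \<Longrightarrow> scale c a \<in> U) \<Longrightarrow>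
      (\<And>a b. a \<in> U \<Longrightarrow> b \<in> U \<Longrightarrow> bil T a b \<in> U) \<Longrightarrow> (\<And>x. x \<in> generators (dim_row A) R \<Longrightarrow> \<gamma> x \<in> U) \<Longrightarrow>
      Poly_Mapping.single b 1 \<in> U"
    and transitive: "g \<noteq> 0 \<Longrightarrow> (\<And>b. b \<in> Poly_Mapping.keys g \<Longrightarrow> dg b = q) \<Longrightarrow> q \<noteq> 0 \<Longrightarrow>
      \<exists>y\<in>generators (dim_row A) R. bil T (\<gamma> y) g \<noteq> 0 \<and> rank (word_degree (Letter y) + q) < rank q"
begin

abbreviation M where "M \<equiv> pm_superalgebra UNIV p T"

definition ev where "ev = lext (word_eval T \<gamma>)"

lemma linear_ev: "pm_linear ev"
  unfolding ev_def by (rule pm_linear_lext)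

lemmas ev_simps = pm_linear_simps[OF linear_ev]

lemma ev_cl: "ev (cl w) = word_eval T \<gamma> w"
  by (simp add: ev_def)

lemma ev_brk: "ev (brk a b) = bil T (ev a) (ev b)"
proof (rule bilinear_eqI[where F = "\<lambda>a b. ev (brk a b)" and G = "\<lambda>a b. bil T (ev a) (ev b)"])
  show "pm_linear (\<lambda>a. ev (brk a b))" "pm_linear (\<lambda>a. bil T (ev a) (ev b))" for b
    by (rule pm_linearI; simp add: ev_simps)+
  show "pm_linear (\<lambda>b. ev (brk a b))" "pm_linear (\<lambda>b. bil T (ev a) (ev b))" for a
    by (rule pm_linearI; simp add: ev_simps)+
qed (simp add: ev_cl)

lemma word_eval_parity: "w \<in> words \<Longrightarrow> b \<in> Poly_Mapping.keys (word_eval T \<gamma> w) \<Longrightarrow> p b = wp w"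
proof (induction w arbitrary: b)
  case (Letter x)
  then show ?case using \<gamma>_parity by simp
next
  case (Brk u v)
  from Brk.prems(2) have "b \<in> Poly_Mapping.keys (bil T (word_eval T \<gamma> u) (word_eval T \<gamma> v))" by simp
  from subsetD[OF keys_bil this]
  obtain x y where xy: "x \<in> Poly_Mapping.keys (word_eval T \<gamma> u)" "y \<in> Poly_Mapping.keys (word_eval T \<gamma> v)"
    "b \<in> Poly_Mapping.keys (T x y)" by blast
  have "u \<in> words" "v \<in> words" using Brk.prems(1) by auto
  from Brk.IH(1)[OF this(1) xy(1)] Brk.IH(2)[OF this(2) xy(2)] T_parity[OF xy(3)] show ?case
    by simp
qed

lemma word_eval_degree: "w \<in> words \<Longrightarrow> b \<in> Poly_Mapping.keys (word_eval T \<gamma> w) \<Longrightarrow> dg b = word_degree w"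
proof (induction w arbitrary: b)
  case (Letter x)
  then show ?case using \<gamma>_degree by simp
next
  case (Brk u v)
  from Brk.prems(2) have "b \<in> Poly_Mapping.keys (bil T (word_eval T \<gamma> u) (word_eval T \<gamma> v))" by simp
  from subsetD[OF keys_bil this]
  obtain x y where xy: "x \<in> Poly_Mapping.keys (word_eval T \<gamma> u)" "y \<in> Poly_Mapping.keys (word_eval T \<gamma> v)"
    "b \<in> Poly_Mapping.keys (T x y)" by blast
  have "u \<in> words" "v \<in> words" using Brk.prems(1) by auto
  from Brk.IH(1)[OF this(1) xy(1)] Brk.IH(2)[OF this(2) xy(2)] T_degree[OF xy(3)] show ?case
    by simp
qed

lemma ev_parity_filter:
  "a \<in> carrier L \<Longrightarrow> ev (pm_filter (\<lambda>w. wp w = q) a) = pm_filter (\<lambda>b. p b = q) (ev a)"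
  unfolding ev_def by (rule lext_pm_filter) (use word_eval_parity in \<open>auto simp: L_simps\<close>)

lemma ev_degree_filter:
  "a \<in> carrier L \<Longrightarrow> ev (pm_filter (\<lambda>w. word_degree w = q) a) = pm_filter (\<lambda>b. dg b = q) (ev a)"
  unfolding ev_def by (rule lext_pm_filter) (use word_eval_degree in \<open>auto simp: L_simps\<close>)

lemma ev_surj: "\<exists>a\<in>carrier L. ev a = g"
proof -
  let ?U = "ev ` carrier L"
  have add: "a + b \<in> ?U" if ab: "a \<in> ?U" "b \<in> ?U" for a b
  proof -
    obtain x where x: "a = ev x" "x \<in> carrier L" using ab(1) by (rule imageE)
    obtain y where y: "b = ev y" "y \<in> carrier L" using ab(2) by (rule imageE)
    note xy = x(2) y(2) x(1) y(1)
    have "x + y \<in> carrier L" using L.V.M.add.m_closed[OF xy(1,2)] unfolding L_simps(4) .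
    then show ?thesis unfolding xy(3,4) ev_simps(1)[symmetric] by (rule imageI)
  qed
  have scl: "scale c a \<in> ?U" if a: "a \<in> ?U" for c a
  proof -
    obtain x where x: "a = ev x" "x \<in> carrier L" using a by (rule imageE)
    then have "scale c x \<in> carrier L" using keys_scale[of c x] unfolding L_simps(1) by blast
    then show ?thesis unfolding x(1) ev_simps(2)[symmetric] by (rule imageI)
  qed
  have bl: "bil T a b \<in> ?U" if ab: "a \<in> ?U" "b \<in> ?U" for a b
  proof -
    obtain x where x: "a = ev x" "x \<in> carrier L" using ab(1) by (rule imageE)
    obtain y where y: "b = ev y" "y \<in> carrier L" using ab(2) by (rule imageE)
    note xy = x(2) y(2) x(1) y(1)
    have "brk x y \<in> carrier L" using L.mult_closed[OF xy(1,2)] unfolding L_simps(2) .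
    then show ?thesis unfolding xy(3,4) ev_brk[symmetric] by (rule imageI)
  qed
  have gen: "\<gamma> x \<in> ?U" if "x \<in> gens" for x
  proof -
    have "cl (Letter x) \<in> carrier L" using that by (intro cl_L) simp
    from imageI[OF this, of ev] show ?thesis by (simp add: ev_cl)
  qed
  have single: "Poly_Mapping.single b 1 \<in> ?U" for b
    by (rule generated[where U = ?U, OF add scl bl gen])
  have zero: "0 \<in> ?U" using scl[OF single, of 0] by simp
  have "(\<Sum>k\<in>F. scale (Poly_Mapping.lookup g k) (Poly_Mapping.single k 1)) \<in> ?U" for F
  proof (induction F rule: infinite_finite_induct)
    case (insert k F)
    show ?case unfolding sum.insert[OF insert.hyps] by (rule add[OF scl[OF single] insert.IH])
  qed (use zero in simp_all)
  from this[of "Poly_Mapping.keys g"] have "g \<in> ?U" unfolding lext_def[symmetric] lext_id .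
  then show ?thesis by blast
qed

lemma ev_epi: "superalgebra_epi ev L M"
  unfolding superalgebra_epi_def
proof (intro conjI ballI allI)
  show "ev ` carrier L = carrier M" proof -
    have "ev ` carrier L = UNIV" using ev_surj by (metis UNIV_eq_I imageI)
    then show ?thesis by simp
  qed
  show "ev ` homog L q = homog M q" for q
  proof (intro equalityI subsetI)
    fix g assume "g \<in> ev ` homog L q"
    then obtain a where a: "a \<in> homog L q" "g = ev a" by blast
    then have "a \<in> carrier L" using homog_L_subset by blast
    from ev_parity_filter[OF this, of q] a have "pm_filter (\<lambda>b. p b = q) g = g"
      using pm_filter_eqI[of a "\<lambda>w. wp w = q"] by (simp add: L_simps)
    then show "g \<in> homog M q" using keys_pm_filter[of "\<lambda>b. p b = q" g] by auto
  next
    fix g assume g: "g \<in> homog M q"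
    obtain a where a: "a \<in> carrier L" "ev a = g" using ev_surj by blast
    \<comment> \<open>An arbitrary preimage is replaced by its component of parity \<open>q\<close>,
      which has the same image because \<open>g\<close> is homogeneous.\<close>
    have "ev (pm_filter (\<lambda>w. wp w = q) a) = g"
      using ev_parity_filter[OF a(1), of q] a(2) g pm_filter_eqI[of g "\<lambda>b. p b = q"] by simp
    moreover have "pm_filter (\<lambda>w. wp w = q) a \<in> homog L q"
      using a(1) by (auto simp: L_simps keys_pm_filter)
    ultimately show "g \<in> ev ` homog L q" by blast
  qed
qed (simp_all add: L_simps ev_simps ev_brk)

section \<open>The kernel of evaluation as the maximal graded ideal\<close>

definition ev_kernel where "ev_kernel = {a \<in> carrier L. ev a = 0}"

lemma ev_kernel_ideal: "alg_ideal L ev_kernel"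
  unfolding L_eq
proof (rule pm_alg_idealI)
  show "ev_kernel \<subseteq> carrier (pm_superalgebra words wp (\<lambda>u v. cl (Brk u v)))"
    unfolding ev_kernel_def L_eq by blast
  show "0 \<in> ev_kernel" by (simp add: ev_kernel_def ev_simps L_simps)
  show "a + b \<in> ev_kernel" if "a \<in> ev_kernel" "b \<in> ev_kernel" for a b
    using that L.V.M.add.m_closed[of a b] by (simp add: ev_kernel_def ev_simps L_simps)
  show "scale c a \<in> ev_kernel" if "a \<in> ev_kernel" for c a
    using that keys_scale[of c a] by (auto simp: ev_kernel_def ev_simps L_simps)
  show "brk x a \<in> ev_kernel" "brk a x \<in> ev_kernel" if "Poly_Mapping.keys x \<subseteq> words" "a \<in> ev_kernel" for x a
    using that L.mult_closed[of a x] L.mult_closed[of x a]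
    by (auto simp: ev_kernel_def ev_brk L_simps(1,2))
qed

text \<open>Lie relators evaluate to Lie relators of the model, contragredient relators to the
  identities assumed for \<open>\<gamma>\<close>. Both are 0, and \<open>J\<close> is the least
  ideal containing them.\<close>

lemma J_subset_ev_kernel: "J \<subseteq> ev_kernel"
proof (rule J_least[OF ev_kernel_ideal], rule subsetI)
  fix a assume a: "a \<in> lie_relators L \<union> contragredient_relators A par R"
  then have "a \<in> carrier L" using lie_relators_L_subset contragredient_relators_subset by blast
  moreover have "ev a = 0"
    using a
  proof
    assume "a \<in> contragredient_relators A par R"
    then show "ev a = 0"
      unfolding contragredient_relators_def Let_def L_simps
      by (elim UnE CollectE exE conjE)
        (simp_all add: ev_simps ev_cl ev_brk \<gamma>_add \<gamma>_smult \<gamma>_EF \<gamma>_HE \<gamma>_HF \<gamma>_HH del: bil_single scale_single)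
  next
    assume "a \<in> lie_relators L"
    moreover have ev_homog: "ev x \<in> homog M q" if "x \<in> homog L q" for x q
      using superalgebra_epiD(6)[OF ev_epi, of q] that by blast
    have sub: "a \<ominus>\<^bsub>L\<^esub> b = a - b" if "a \<in> carrier L" "b \<in> carrier L" for a b
      using that by (rule L_minus)
    have L_cl: "brk x y \<in> carrier L" "x + y \<in> carrier L" if "x \<in> carrier L" "y \<in> carrier L" for x y
      using L.mult_closed[OF that] L.V.M.add.m_closed[OF that] unfolding L_simps(2,4) .
    have L_scale: "scale c x \<in> carrier L" if "x \<in> carrier L" for x c
      using that keys_scale[of c x] unfolding L_simps(1) by blast
    have M_sub: "x \<ominus>\<^bsub>M\<^esub> y = x - y" for x y by (rule pm_minus) simp_all
    have jac: "ev ((x \<otimes>\<^bsub>L\<^esub> (y \<otimes>\<^bsub>L\<^esub> z)) \<ominus>\<^bsub>L\<^esub> (((x \<otimes>\<^bsub>L\<^esub> y) \<otimes>\<^bsub>L\<^esub> z) \<oplus>\<^bsub>L\<^esub> (koszul_sign r q \<odot>\<^bsub>L\<^esub> (y \<otimes>\<^bsub>L\<^esub> (x \<otimes>\<^bsub>L\<^esub> z)))))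
        = (ev x \<otimes>\<^bsub>M\<^esub> (ev y \<otimes>\<^bsub>M\<^esub> ev z)) \<ominus>\<^bsub>M\<^esub> (((ev x \<otimes>\<^bsub>M\<^esub> ev y) \<otimes>\<^bsub>M\<^esub> ev z) \<oplus>\<^bsub>M\<^esub> (koszul_sign r q \<odot>\<^bsub>M\<^esub> (ev y \<otimes>\<^bsub>M\<^esub> (ev x \<otimes>\<^bsub>M\<^esub> ev z))))"
      if "x \<in> carrier L" "y \<in> carrier L" "z \<in> carrier L" for x y z r q
      unfolding L_simps(2,4,5) M_sub
      by (subst sub; (intro L_cl L_scale that)?) (simp add: ev_simps ev_brk)
    consider (skew) x y r q where "x \<in> homog L r" "y \<in> homog L q" "a = (x \<otimes>\<^bsub>L\<^esub> y) \<oplus>\<^bsub>L\<^esub> (koszul_sign r q \<odot>\<^bsub>L\<^esub> (y \<otimes>\<^bsub>L\<^esub> x))"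
      | (jacobi) x y z r q s where "x \<in> homog L r" "y \<in> homog L q" "z \<in> homog L s"
          "a = (x \<otimes>\<^bsub>L\<^esub> (y \<otimes>\<^bsub>L\<^esub> z)) \<ominus>\<^bsub>L\<^esub> (((x \<otimes>\<^bsub>L\<^esub> y) \<otimes>\<^bsub>L\<^esub> z) \<oplus>\<^bsub>L\<^esub> (koszul_sign r q \<odot>\<^bsub>L\<^esub> (y \<otimes>\<^bsub>L\<^esub> (x \<otimes>\<^bsub>L\<^esub> z))))"
      | (cube) x where "x \<in> homog L 1" "a = x \<otimes>\<^bsub>L\<^esub> (x \<otimes>\<^bsub>L\<^esub> x)"
      using \<open>a \<in> lie_relators L\<close> unfolding lie_relators_def by blast
    then have "ev a \<in> lie_relators M"
    proof cases
      case skew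
      have "ev a = (ev x \<otimes>\<^bsub>M\<^esub> ev y) \<oplus>\<^bsub>M\<^esub> (koszul_sign r q \<odot>\<^bsub>M\<^esub> (ev y \<otimes>\<^bsub>M\<^esub> ev x))"
        unfolding skew(3) L_simps by (simp add: ev_simps ev_brk)
      then show ?thesis unfolding lie_relators_def using ev_homog[OF skew(1)] ev_homog[OF skew(2)] by blast
    next
      case jacobi
      have "ev a = (ev x \<otimes>\<^bsub>M\<^esub> (ev y \<otimes>\<^bsub>M\<^esub> ev z)) \<ominus>\<^bsub>M\<^esub> (((ev x \<otimes>\<^bsub>M\<^esub> ev y) \<otimes>\<^bsub>M\<^esub> ev z) \<oplus>\<^bsub>M\<^esub> (koszul_sign r q \<odot>\<^bsub>M\<^esub> (ev y \<otimes>\<^bsub>M\<^esub> (ev x \<otimes>\<^bsub>M\<^esub> ev z))))"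
        unfolding jacobi(4) by (rule jac) (use jacobi homog_L_subset in blast)+
      then show ?thesis
        unfolding lie_relators_def using ev_homog[OF jacobi(1)] ev_homog[OF jacobi(2)] ev_homog[OF jacobi(3)] by blast
    next
      case cube
      have "ev a = ev x \<otimes>\<^bsub>M\<^esub> (ev x \<otimes>\<^bsub>M\<^esub> ev x)"
        unfolding cube(2) L_simps by (simp add: ev_brk)
      then show ?thesis unfolding lie_relators_def using ev_homog[OF cube(1)] by blast
    qed
    then show "ev a = 0" using lie by blast
  qed
  ultimately show "a \<in> ev_kernel" by (simp add: ev_kernel_def)
qed

abbreviation G where "G \<equiv> tilde_contragredient A par R"

lemma tilde_epi: "superalgebra_epi (tilde_class A par R) L G"
  unfolding tilde_contragredient_def tilde_class_def by (rule L.quotient_epi[OF J_alg_ideal])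

lemmas tilde_epiD = superalgebra_epiD[OF tilde_epi]

sublocale G: bilinear_superalgebra G
  by (rule L.epi_bilinear[OF tilde_epi])

lemma tilde_class_eq_iff:
  assumes "a \<in> carrier L" "b \<in> carrier L"
  shows "tilde_class A par R a = tilde_class A par R b \<longleftrightarrow> a - b \<in> J"
  unfolding tilde_class_def L.coset_eq_iff[OF J_alg_ideal assms] L_minus[OF assms] ..

abbreviation kernel_image where "kernel_image \<equiv> tilde_class A par R ` ev_kernel"

lemma ev_kernel_subset: "ev_kernel \<subseteq> carrier L"
  by (auto simp: ev_kernel_def)

lemma ev_eq_of_J:
  assumes "a - b \<in> J" shows "ev a = ev b"
  using subsetD[OF J_subset_ev_kernel assms] by (simp add: ev_kernel_def ev_simps)

lemma kernel_image_ideal: "alg_ideal G kernel_image"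
  by (rule L.epi_image_ideal[OF tilde_epi ev_kernel_ideal])

lemma cartan_class_zero:
  "tilde_class A par R (cl (Letter (GenH \<zero>\<^bsub>h\<^esub>))) = \<zero>\<^bsub>G\<^esub>"
proof -
  have l: "cl (Letter (GenH \<zero>\<^bsub>h\<^esub>)) \<in> carrier L" by (intro cl_L) simp
  have "0 \<odot>\<^bsub>h\<^esub> \<zero>\<^bsub>h\<^esub> = \<zero>\<^bsub>h\<^esub>"
    using h.lmult_0[of "\<zero>\<^bsub>h\<^esub>"] by (simp add: class_ring_simps)
  then have "cl (Letter (GenH \<zero>\<^bsub>h\<^esub>)) - 0 \<in> J"
    using J_relations(2)[of "\<zero>\<^bsub>h\<^esub>" 0] by simp
  then have "tilde_class A par R (cl (Letter (GenH \<zero>\<^bsub>h\<^esub>))) = tilde_class A par R 0"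
    using tilde_class_eq_iff[OF l] L.V.M.zero_closed by (simp add: L_simps(3))
  then show ?thesis using tilde_epiD(2) by (simp add: L_simps(3))
qed

text \<open>The components of a kernel element evaluate to the components of 0, so the kernel is
  graded. If it contains the class of a Cartan letter, then \<open>\<gamma> (GenH x) = 0\<close>,
  hence \<open>x\<close> is zero by \<open>\<gamma>_inj\<close>.\<close>

lemma kernel_image_graded: "graded_ideal_avoiding_cartan A par R kernel_image"
  unfolding graded_ideal_avoiding_cartan_def Let_def
proof (intro conjI)
  show ideal: "alg_ideal G kernel_image" by (rule kernel_image_ideal)
  then have sub: "submodule class_ring kernel_image G"
    unfolding alg_ideal_def subspace_def by blast
  let ?S = "\<Union>q. kernel_image \<inter> tilde_component A par R q"
  have S: "?S \<subseteq> carrier G"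
    using ev_kernel_subset tilde_epiD(7) by blast
  have span: "submodule class_ring (G.V.span ?S) G" by (rule G.V.span_is_submodule[OF S])
  show "kernel_image = G.V.span ?S"
  proof
    show "G.V.span ?S \<subseteq> kernel_image"
      by (rule G.V.span_is_subset[OF _ sub]) blast
    show "kernel_image \<subseteq> G.V.span ?S"
    proof
      fix X assume "X \<in> kernel_image"
      then obtain a where a: "a \<in> carrier L" "ev a = 0" "X = tilde_class A par R a"
        by (auto simp: ev_kernel_def)
      let ?f = "\<lambda>q. pm_filter (\<lambda>w. word_degree w = q) a"
      have f: "?f q \<in> carrier L" for q
        using a(1) unfolding L_simps(1) by (auto simp: keys_pm_filter)
      have "ev (?f q) = 0" for q
        using ev_degree_filter[OF a(1)] a(2) by (simp add: pm_filter_def)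
      then have "?f q \<in> ev_kernel" for q
        using f by (simp add: ev_kernel_def)
      moreover have "?f q \<in> {a \<in> carrier L. \<forall>w\<in>Poly_Mapping.keys a. word_degree w = q}" for q
        using f by (simp add: keys_pm_filter)
      ultimately have "tilde_class A par R (?f q) \<in> ?S" for q
        unfolding tilde_component_def by blast
      then have fS: "tilde_class A par R (?f q) \<in> G.V.span ?S" for q
        using G.V.in_own_span[OF S] by blast
      have "(\<Sum>q\<in>Q. ?f q) \<in> carrier L \<and> tilde_class A par R (\<Sum>q\<in>Q. ?f q) \<in> G.V.span ?S" if "finite Q" for Q
        using that
      proof (induction Q rule: finite_induct)
        case empty
        show ?case using L.V.M.zero_closed tilde_epiD(2) submodule.zero_closed[OF span] by (simp add: L_simps(3))
      next
        case (insert q Q)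
        then have IH: "(\<Sum>q\<in>Q. ?f q) \<in> carrier L" "tilde_class A par R (\<Sum>q\<in>Q. ?f q) \<in> G.V.span ?S" by blast+
        show ?case
          unfolding sum.insert[OF insert.hyps]
          using L.V.M.add.m_closed[OF f IH(1)] tilde_epiD(3)[OF f IH(1)] submodule.m_closed[OF span fS IH(2)]
          unfolding L_simps(4) by metis
      qed
      from conjunct2[OF this[of "word_degree ` Poly_Mapping.keys a"]] show "X \<in> G.V.span ?S"
        using pm_sum_filter[of "word_degree ` Poly_Mapping.keys a" word_degree a] a(3) by simp
    qed
  qed
  show "kernel_image \<inter> (\<lambda>x. tilde_class A par R (cl (Letter (GenH x)))) ` carrier h = {\<zero>\<^bsub>G\<^esub>}" (is "?I = _")
  proof
    show "?I \<subseteq> {\<zero>\<^bsub>G\<^esub>}"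
    proof
      fix X assume "X \<in> ?I"
      then obtain a x where a: "a \<in> ev_kernel" "X = tilde_class A par R a"
        and x: "x \<in> carrier h" "X = tilde_class A par R (cl (Letter (GenH x)))" by blast
      have l: "cl (Letter (GenH x)) \<in> carrier L" using x(1) by (intro cl_L) simp
      have "cl (Letter (GenH x)) - a \<in> J"
        using tilde_class_eq_iff[OF l subsetD[OF ev_kernel_subset a(1)]] a(2) x(2) by simp
      from ev_eq_of_J[OF this] have "\<gamma> (GenH x) = 0" using a(1) by (simp add: ev_cl ev_kernel_def)
      then show "X \<in> {\<zero>\<^bsub>G\<^esub>}" using \<gamma>_inj[OF x(1)] x(2) cartan_class_zero by simp
    qed
    show "{\<zero>\<^bsub>G\<^esub>} \<subseteq> ?I"
      using submodule.zero_closed[OF sub] cartan_class_zero h.M.zero_closed by blast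
  qed
qed

text \<open>By transitivity, generators carry a homogeneous element with nonzero image into degree \<open>0\<close>
  without leaving \<open>I\<close> and without killing the image; but a degree \<open>0\<close> element of \<open>I\<close> is a Cartan
  element modulo \<open>J\<close>, hence zero.\<close>

lemma homogeneous_class_in_kernel:
  assumes I: "graded_ideal_avoiding_cartan A par R I"
    and a: "a \<in> carrier L" "\<And>w. w \<in> Poly_Mapping.keys a \<Longrightarrow> word_degree w = q" "tilde_class A par R a \<in> I"
  shows "ev a = 0"
  using a
proof (induction "rank q" arbitrary: a q rule: less_induct)
  case less
  have ideal: "alg_ideal G I"
    and cartan: "I \<inter> (\<lambda>x. tilde_class A par R (cl (Letter (GenH x)))) ` carrier h = {\<zero>\<^bsub>G\<^esub>}"
    using I unfolding graded_ideal_avoiding_cartan_def Let_def by blast+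
  show ?case
  proof (cases "q = 0")
    case True
    have "word_degree w = 0" if "w \<in> Poly_Mapping.keys a" for w
      using less.prems(2)[OF that] True by simp
    from degree_zero_reduces_to_cartan[OF less.prems(1) this]
    obtain x where x: "x \<in> carrier h" "a - cl (Letter (GenH x)) \<in> J" by blast
    have l: "cl (Letter (GenH x)) \<in> carrier L" using x(1) by (intro cl_L) simp
    have "tilde_class A par R a = tilde_class A par R (cl (Letter (GenH x)))"
      using tilde_class_eq_iff[OF less.prems(1) l] x(2) by blast
    then have "tilde_class A par R a = \<zero>\<^bsub>G\<^esub>" using cartan x(1) less.prems(3) by blast
    then have "tilde_class A par R a = tilde_class A par R 0"
      using tilde_epiD(2) by (simp add: L_simps(3))
    then have "a - 0 \<in> J"
      using tilde_class_eq_iff[OF less.prems(1), of 0] L.V.M.zero_closed by (simp add: L_simps(3))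
    from ev_eq_of_J[OF this] show ?thesis by (simp add: ev_simps)
  next
    case False
    show ?thesis
    proof (rule ccontr)
      assume nz: "ev a \<noteq> 0"
      have "pm_filter (\<lambda>b. dg b = q) (ev a) = ev a"
        using ev_degree_filter[OF less.prems(1), of q] pm_filter_eqI[of a "\<lambda>w. word_degree w = q"] less.prems(2) by simp
      then have "dg b = q" if "b \<in> Poly_Mapping.keys (ev a)" for b
        using that keys_pm_filter[of "\<lambda>b. dg b = q" "ev a"] by auto
      from transitive[OF nz this False] obtain y where y: "y \<in> gens" "bil T (\<gamma> y) (ev a) \<noteq> 0"
        "rank (word_degree (Letter y) + q) < rank q" by blast
      have ly: "cl (Letter y) \<in> carrier L" using y(1) by (intro cl_L) simp
      let ?b = "brk (cl (Letter y)) a"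
      have "?b \<in> carrier L" using L.mult_closed[OF ly less.prems(1)] unfolding L_simps(2) .
      moreover have "word_degree w = word_degree (Letter y) + q" if "w \<in> Poly_Mapping.keys ?b" for w
        using subsetD[OF keys_bil that] less.prems(2) by (auto split: if_splits)
      moreover have "tilde_class A par R ?b \<in> I"
      proof -
        have "tilde_class A par R (cl (Letter y)) \<otimes>\<^bsub>G\<^esub> tilde_class A par R a \<in> I"
          using ideal tilde_epiD(7)[OF ly] less.prems(3) unfolding alg_ideal_def by blast
        then show ?thesis using tilde_epiD(4)[OF ly less.prems(1)] unfolding L_simps(2) by simp
      qed
      ultimately have "ev ?b = 0" by (rule less.hyps[OF y(3)])
      then show False using y(2) by (simp add: ev_brk ev_cl)
    qed
  qed
qed

text \<open>A graded ideal is spanned by its homogeneous elements, and each of them has a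
  homogeneous representative in the free superalgebra, to which
  \<open>homogeneous_class_in_kernel\<close> applies. So the kernel contains every competitor and is
  itself one.\<close>

lemma max_ideal_eq: "max_ideal A par R = kernel_image"
  unfolding max_ideal_def
proof (rule Greatest_equality[where P = "graded_ideal_avoiding_cartan A par R", OF kernel_image_graded])
  fix I assume I: "graded_ideal_avoiding_cartan A par R I"
  have sub: "submodule class_ring kernel_image G"
    using kernel_image_ideal unfolding alg_ideal_def subspace_def by blast
  have "I = G.V.span (\<Union>q. I \<inter> tilde_component A par R q)"
    using I unfolding graded_ideal_avoiding_cartan_def Let_def by blast
  moreover have "(\<Union>q. I \<inter> tilde_component A par R q) \<subseteq> kernel_image"
  proof
    fix X assume "X \<in> (\<Union>q. I \<inter> tilde_component A par R q)"
    then obtain q a where a: "a \<in> carrier L" "\<forall>w\<in>Poly_Mapping.keys a. word_degree w = q"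
      "X = tilde_class A par R a" "X \<in> I"
      unfolding tilde_component_def by blast
    then have "ev a = 0" using homogeneous_class_in_kernel[OF I a(1)] by blast
    then show "X \<in> kernel_image" using a(1,3) by (auto simp: ev_kernel_def)
  qed
  then have "G.V.span (\<Union>q. I \<inter> tilde_component A par R q) \<subseteq> kernel_image"
    by (rule G.V.span_is_subset[OF _ sub])
  ultimately show "I \<le> kernel_image" by simp
qed

text \<open>Once the maximal ideal is the image of the kernel of \<open>ev\<close>, the composite of
  the two quotient maps has the same fibres as \<open>ev\<close>. The images of the generators are
  recorded because the derivation of br3 is given by the class of \<open>GenE 0\<close>.\<close>

theorem contragredient_iso:
  obtains \<psi> where "superalgebra_iso \<psi> M (contragredient A par R)"
    "\<And>x. x \<in> gens \<Longrightarrow> \<psi> (\<gamma> x) = contragredient_gen A par R x"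
proof -
  let ?\<pi> = "(+>\<^bsub>G\<^esub>) (max_ideal A par R) \<circ> tilde_class A par R"
  have ideal: "alg_ideal G (max_ideal A par R)"
    unfolding max_ideal_eq by (rule kernel_image_ideal)
  have \<pi>: "superalgebra_epi ?\<pi> L (contragredient A par R)"
    unfolding contragredient_def by (rule superalgebra_epi_comp[OF tilde_epi G.quotient_epi[OF ideal]])
  have ker: "?\<pi> x = ?\<pi> y \<longleftrightarrow> ev x = ev y" if xy: "x \<in> carrier L" "y \<in> carrier L" for x y
  proof -
    have ny: "- y \<in> carrier L" "scale (- 1) y = - y" using xy(2) by (auto simp: L_simps(1) in_keys_iff)
    have xy': "x - y \<in> carrier L"
      using L.V.M.add.m_closed[OF xy(1) ny(1)] unfolding L_simps(4) by simp
    have "tilde_class A par R x \<ominus>\<^bsub>G\<^esub> tilde_class A par R y = tilde_class A par R x \<oplus>\<^bsub>G\<^esub> tilde_class A par R (- y)"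
      unfolding a_minus_def G.a_inv_smult[OF tilde_epiD(7)[OF xy(2)]] tilde_epiD(5)[OF xy(2), symmetric]
      unfolding L_simps(5) ny(2) ..
    also have "\<dots> = tilde_class A par R (x - y)"
      using tilde_epiD(3)[OF xy(1) ny(1)] unfolding L_simps(4) by simp
    finally have "?\<pi> x = ?\<pi> y \<longleftrightarrow> tilde_class A par R (x - y) \<in> kernel_image"
      using G.coset_eq_iff[OF ideal tilde_epiD(7)[OF xy(1)] tilde_epiD(7)[OF xy(2)]] max_ideal_eq by simp
    also have "\<dots> \<longleftrightarrow> ev (x - y) = 0"
    proof
      assume "tilde_class A par R (x - y) \<in> kernel_image"
      then obtain a where a: "a \<in> ev_kernel" "tilde_class A par R (x - y) = tilde_class A par R a" by blast
      then have "(x - y) - a \<in> J"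
        using tilde_class_eq_iff[OF xy' subsetD[OF ev_kernel_subset a(1)]] by simp
      from ev_eq_of_J[OF this] show "ev (x - y) = 0" using a(1) by (simp add: ev_kernel_def)
    next
      assume "ev (x - y) = 0"
      then show "tilde_class A par R (x - y) \<in> kernel_image" using xy' by (auto simp: ev_kernel_def)
    qed
    finally show ?thesis by (simp add: ev_simps)
  qed
  obtain \<psi> where \<psi>: "superalgebra_iso \<psi> M (contragredient A par R)" "\<And>x. x \<in> carrier L \<Longrightarrow> \<psi> (ev x) = ?\<pi> x"
    by (rule superalgebra_epi_factor[OF L.bilinear_superalgebra_axioms homog_L_subset ev_epi \<pi> ker[symmetric]]) auto
  have "\<psi> (\<gamma> x) = contragredient_gen A par R x" if "x \<in> gens" for x
    using \<psi>(2)[OF cl_L[of "Letter x"]] that by (simp add: contragredient_gen_def ev_cl)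
  then show ?thesis using that \<psi>(1) by blast
qed

end

section \<open>Semisimplification in terms of a projection\<close>

text \<open>\<open>\<kappa> w i j\<close> is the coefficient of \<open>D\<^sup>j (X i)\<close> in \<open>w\<close>.\<close>

locale jordan_frame =
  fixes D :: "('b \<Rightarrow>\<^sub>0 'k::field) \<Rightarrow> ('b \<Rightarrow>\<^sub>0 'k)" and n1 n2 n3 :: nat and X :: "nat \<Rightarrow> ('b \<Rightarrow>\<^sub>0 'k)"
    and \<kappa> :: "('b \<Rightarrow>\<^sub>0 'k) \<Rightarrow> nat \<Rightarrow> nat \<Rightarrow> 'k"
  assumes linear_D: "pm_linear D"
    and X_nilpotent: "i < n1 + n2 + n3 \<Longrightarrow> (D ^^ block_size n1 n2 i) (X i) = 0"
    and repr: "w = (\<Sum>i<n1 + n2 + n3. \<Sum>j<block_size n1 n2 i. scale (\<kappa> w i j) ((D ^^ j) (X i)))"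
    and repr_unique: "(\<Sum>i<n1 + n2 + n3. \<Sum>j<block_size n1 n2 i. scale (c i j) ((D ^^ j) (X i))) = w \<Longrightarrow>
      i < n1 + n2 + n3 \<Longrightarrow> j < block_size n1 n2 i \<Longrightarrow> \<kappa> w i j = c i j"
begin

abbreviation N where "N \<equiv> n1 + n2 + n3"
abbreviation bs where "bs \<equiv> block_size n1 n2"

lemmas D_simps = pm_linear_simps[OF linear_D]

lemma bs_simps: "i < n1 \<Longrightarrow> bs i = 1" "\<not> i < n1 \<Longrightarrow> i < n1 + n2 \<Longrightarrow> bs i = 2" "\<not> i < n1 + n2 \<Longrightarrow> bs i = 3"
  "0 < bs i"
  by (auto simp: block_size_def)

lemma \<kappa>_add:
  assumes "i < N" "j < bs i" shows "\<kappa> (v + w) i j = \<kappa> v i j + \<kappa> w i j"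
proof (rule repr_unique[OF _ assms])
  show "(\<Sum>i<N. \<Sum>j<bs i. scale (\<kappa> v i j + \<kappa> w i j) ((D ^^ j) (X i))) = v + w"
    unfolding pm.scale_left_distrib sum.distrib repr[of v, symmetric] repr[of w, symmetric] ..
qed

lemma \<kappa>_scale:
  assumes "i < N" "j < bs i" shows "\<kappa> (scale c w) i j = c * \<kappa> w i j"
proof (rule repr_unique[OF _ assms])
  show "(\<Sum>i<N. \<Sum>j<bs i. scale (c * \<kappa> w i j) ((D ^^ j) (X i))) = scale c w"
    unfolding pm.scale_scale[symmetric] pm.scale_sum_right[symmetric] repr[of w, symmetric] ..
qed

lemma \<kappa>_zero: assumes "i < N" "j < bs i" shows "\<kappa> 0 i j = 0"
  using \<kappa>_scale[OF assms, of 0 0] by simp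

lemma \<kappa>_sum: assumes "i < N" "j < bs i" shows "\<kappa> (sum f I) i j = (\<Sum>k\<in>I. \<kappa> (f k) i j)"
  by (induction I rule: infinite_finite_induct) (simp_all add: \<kappa>_zero[OF assms] \<kappa>_add[OF assms])

lemma \<kappa>_X: assumes "i < N" "k < N" shows "\<kappa> (X k) i 0 = (if i = k then 1 else 0)"
proof -
  let ?c = "\<lambda>i j. if j = (0::nat) then if i = k then 1 else 0 else 0 :: 'k"
  have *: "(\<Sum>j<bs i. scale (?c i j) ((D ^^ j) (X i))) = (if i = k then X k else 0)" for i
  proof -
    have "(\<Sum>j<bs i. scale (?c i j) ((D ^^ j) (X i))) = (\<Sum>j<bs i. if j = 0 then (if i = k then X k else 0) else 0)"
      by (intro sum.cong) auto
    then show ?thesis using bs_simps(4)[of i] by simp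
  qed
  have "(\<Sum>i<N. \<Sum>j<bs i. scale (?c i j) ((D ^^ j) (X i))) = X k"
    unfolding * using assms(2) by simp
  from repr_unique[OF this assms(1) bs_simps(4)] show ?thesis by simp
qed

text \<open>\<open>D\<close> moves each vector of a block one place down and sends the last one to
  0. In particular an image under \<open>D\<close> has coefficient 0 at every head
  \<open>X i\<close>.\<close>

lemma \<kappa>_D: assumes "i < N" "j < bs i" shows "\<kappa> (D w) i j = (if j = 0 then 0 else \<kappa> w i (j - 1))"
proof (rule repr_unique[OF _ assms])
  have "D w = (\<Sum>i<N. \<Sum>j<bs i. scale (\<kappa> w i j) ((D ^^ Suc j) (X i)))"
    by (subst repr[of w]) (simp add: D_simps)
  also have "\<dots> = (\<Sum>i<N. \<Sum>j<bs i. scale (if j = 0 then 0 else \<kappa> w i (j - 1)) ((D ^^ j) (X i)))"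
  proof (rule sum.cong[OF refl])
    fix i assume "i \<in> {..<N}"
    then have z: "(D ^^ bs i) (X i) = 0" using X_nilpotent by simp
    obtain m where m: "bs i = Suc m" using bs_simps(4)[of i] by (cases "bs i") auto
    have "(\<Sum>j<bs i. scale (\<kappa> w i j) ((D ^^ Suc j) (X i))) = (\<Sum>j<m. scale (\<kappa> w i j) ((D ^^ Suc j) (X i)))"
      unfolding m sum.lessThan_Suc using z unfolding m by simp
    also have "\<dots> = (\<Sum>j<bs i. scale (if j = 0 then 0 else \<kappa> w i (j - 1)) ((D ^^ j) (X i)))"
      unfolding m sum.lessThan_Suc_shift by simp
    finally show "(\<Sum>j<bs i. scale (\<kappa> w i j) ((D ^^ Suc j) (X i))) =
      (\<Sum>j<bs i. scale (if j = 0 then 0 else \<kappa> w i (j - 1)) ((D ^^ j) (X i)))" .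
  qed
  finally show "(\<Sum>i<N. \<Sum>j<bs i. scale (if j = 0 then 0 else \<kappa> w i (j - 1)) ((D ^^ j) (X i))) = D w" ..
qed

text \<open>In a block of length at least 2 the coefficient of the head reappears in
  \<open>D w\<close> one place further down.\<close>

lemma \<kappa>_kernel:
  assumes "D w = 0" "\<not> i < n1" "i < N" shows "\<kappa> w i 0 = 0"
proof -
  have "1 < bs i" using assms(2) by (simp add: block_size_def)
  from \<kappa>_D[OF assms(3) this, of w] show ?thesis using assms(1) \<kappa>_zero[OF assms(3) \<open>1 < bs i\<close>] by simp
qed

lemma \<kappa>_kernel2:
  assumes "D (D w) = 0" "\<not> i < n1 + n2" "i < N" shows "\<kappa> w i 0 = 0"
proof -
  have b: "2 < bs i" "1 < bs i" using assms(2) by (simp_all add: block_size_def)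
  have "\<kappa> (D (D w)) i 2 = \<kappa> w i 0"
    using \<kappa>_D[OF assms(3) b(1), of "D w"] \<kappa>_D[OF assms(3) b(2), of w] by simp
  then show ?thesis using assms(1) \<kappa>_zero[OF assms(3) b(1)] by simp
qed

text \<open>All basis vectors other than the heads of the blocks are images under
  \<open>D\<close>.\<close>

lemma linear_killing_image:
  assumes "pm_linear P" "\<And>v. P (D v) = 0"
  shows "P w = (\<Sum>i<N. scale (\<kappa> w i 0) (P (X i)))"
proof -
  note P = pm_linear_simps[OF assms(1)]
  have "P w = (\<Sum>i<N. \<Sum>j<bs i. scale (\<kappa> w i j) (P ((D ^^ j) (X i))))"
    by (subst repr[of w]) (simp add: P)
  also have "\<dots> = (\<Sum>i<N. scale (\<kappa> w i 0) (P (X i)))"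
  proof (rule sum.cong[OF refl])
    fix i
    obtain m where m: "bs i = Suc m" using bs_simps(4)[of i] by (cases "bs i") auto
    show "(\<Sum>j<bs i. scale (\<kappa> w i j) (P ((D ^^ j) (X i)))) = scale (\<kappa> w i 0) (P (X i))"
      unfolding m sum.lessThan_Suc_shift by (simp add: assms(2))
  qed
  finally show ?thesis .
qed

lemma X_kernel: "i < n1 \<Longrightarrow> D (X i) = 0"
  using X_nilpotent[of i] bs_simps(1) by simp

lemma X_kernel2: "i < n1 + n2 \<Longrightarrow> D (D (X i)) = 0"
  using X_nilpotent[of i] X_kernel[of i] bs_simps(2)[of i] by (cases "i < n1") (auto simp: D_simps eval_nat_numeral)

lemma sum_split: "(\<Sum>i<N. f i) = (\<Sum>i<n1. f i) + (\<Sum>i\<in>{n1..<n1+n2}. f i) + (\<Sum>i\<in>{n1+n2..<N}. f i)"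
  for f :: "nat \<Rightarrow> 'z::comm_monoid_add"
proof -
  have "sum f {0..<n1} + sum f {n1..<n1+n2} = sum f {0..<n1+n2}"
    by (rule sum.atLeastLessThan_concat) simp_all
  moreover have "sum f {0..<n1+n2} + sum f {n1+n2..<N} = sum f {0..<N}"
    by (rule sum.atLeastLessThan_concat) simp_all
  ultimately show ?thesis by (simp add: atLeast0LessThan)
qed

lemma even_projection:
  assumes "pm_linear P" "\<And>v. P (D v) = 0" "D w = 0"
  shows "P w = (\<Sum>i<n1. scale (\<kappa> w i 0) (P (X i)))"
  using linear_killing_image[OF assms(1,2), of w] \<kappa>_kernel[OF assms(3)] by (simp add: sum_split)

text \<open>The heads of the blocks of size 1 lie in the kernel of \<open>D\<close>, which
  \<open>P\<close> kills, and the heads of the blocks of size 3 do not occur in a vector killed by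
  \<open>D\<close> twice. Only the blocks of size 2 remain.\<close>

lemma odd_projection:
  assumes "pm_linear P" "\<And>v. P (D v) = 0" "\<And>v. D v = 0 \<Longrightarrow> P v = 0" "D (D w) = 0"
  shows "P w = (\<Sum>i\<in>{n1..<n1+n2}. scale (\<kappa> w i 0) (P (X i)))"
  using linear_killing_image[OF assms(1,2), of w] \<kappa>_kernel2[OF assms(4)] assms(3)[OF X_kernel]
  by (simp add: sum_split)

end

text \<open>Carries a Jordan decomposition of the abstract algebra to the model by
  \<open>\<phi>\<close> and turns the definite description inside \<open>coefficient\<close> into
  functionals \<open>\<kappa>\<close> with usable laws.\<close>

lemma jordan_decomposition_frame:
  fixes G :: "('k::field, 'v) superalgebra"
  assumes G: "bilinear_superalgebra G" and \<phi>: "superalgebra_iso \<phi> G (pm_superalgebra UNIV p (T :: 'b \<Rightarrow> 'b \<Rightarrow> ('b \<Rightarrow>\<^sub>0 'k)))"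
    and D: "pm_linear D" and d: "\<And>v. v \<in> carrier G \<Longrightarrow> d v \<in> carrier G" "\<And>v. v \<in> carrier G \<Longrightarrow> \<phi> (d v) = D (\<phi> v)"
    and jd: "jordan_decomposition G d n1 n2 n3 x"
  obtains \<kappa> where "jordan_frame D n1 n2 n3 (\<phi> \<circ> x) \<kappa>"
    "\<And>i v. i < n1 + n2 + n3 \<Longrightarrow> v \<in> carrier G \<Longrightarrow> coefficient G (jordan_basis d n1 n2 n3 x) (x i) v = \<kappa> (\<phi> v) i 0"
    "\<And>i. i < n1 + n2 + n3 \<Longrightarrow> x i \<in> carrier G"
proof -
  interpret G: bilinear_superalgebra G by (rule G)
  let ?N = "n1 + n2 + n3" and ?bs = "block_size n1 n2"
  let ?B = "jordan_basis d n1 n2 n3 x" and ?I = "SIGMA i:{..<?N}. {..<?bs i}"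
  let ?b = "\<lambda>(i, k). (d ^^ k) (x i)"
  from jd have nil: "\<And>i. i < ?N \<Longrightarrow> (d ^^ ?bs i) (x i) = \<zero>\<^bsub>G\<^esub>" and inj: "inj_on ?b ?I" and basis: "G.V.basis ?B"
    unfolding jordan_decomposition_def by blast+
  have B: "?B = ?b ` ?I" unfolding jordan_basis_def by force
  have fin: "finite ?B" unfolding B by simp
  have BG: "?B \<subseteq> carrier G" using basis unfolding G.V.basis_def by blast
  have epi: "superalgebra_epi \<phi> G (pm_superalgebra UNIV p T)" and \<phi>_inj: "inj_on \<phi> (carrier G)"
    using \<phi> unfolding superalgebra_iso_def by blast+
  note e = superalgebra_epiD[OF epi]
  have x: "x i \<in> carrier G" if "i < ?N" for i
  proof -
    have "(i, 0) \<in> ?I" using that by (simp add: block_size_def)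
    then have "?b (i, 0) \<in> ?B" unfolding B by (rule imageI)
    then show ?thesis using BG by auto
  qed
  have \<phi>_pow: "(d ^^ k) (x i) \<in> carrier G \<and> \<phi> ((d ^^ k) (x i)) = (D ^^ k) (\<phi> (x i))" if "i < ?N" for i k
    by (induction k) (use x[OF that] d in auto)
  have lin: "G.V.lincomb c F \<in> carrier G \<and> \<phi> (G.V.lincomb c F) = (\<Sum>b\<in>F. scale (c b) (\<phi> b))"
    if "finite F" "F \<subseteq> carrier G" for c F
    using that
  proof (induction F rule: finite_induct)
    case empty
    then show ?case using e(2) by (simp add: G.V.lincomb_def)
  next
    case (insert b F)
    have sm: "c u \<odot>\<^bsub>G\<^esub> u \<in> carrier G" if "u \<in> carrier G" for u
      using G.V.smult_closed[of "c u" u] that by (simp add: class_ring_simps)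
    have "G.V.lincomb c (insert b F) = (c b \<odot>\<^bsub>G\<^esub> b) \<oplus>\<^bsub>G\<^esub> G.V.lincomb c F"
      unfolding G.V.lincomb_def using insert.hyps insert.prems sm by (intro G.V.M.finsum_insert) auto
    then show ?case using insert sm e(3,5) by simp
  qed
  have sum_B: "(\<Sum>b\<in>?B. scale (c b) (\<phi> b)) = (\<Sum>i<?N. \<Sum>j<?bs i. scale (c ((d ^^ j) (x i))) ((D ^^ j) (\<phi> (x i))))" for c
  proof -
    have "(\<Sum>b\<in>?B. scale (c b) (\<phi> b)) = (\<Sum>z\<in>?I. scale (c (?b z)) (\<phi> (?b z)))"
      unfolding B by (rule sum.reindex_cong[OF inj refl refl])
    also have "\<dots> = (\<Sum>i<?N. \<Sum>j<?bs i. scale (c ((d ^^ j) (x i))) (\<phi> ((d ^^ j) (x i))))"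
      by (subst sum.Sigma) (auto simp: split_def)
    also have "\<dots> = (\<Sum>i<?N. \<Sum>j<?bs i. scale (c ((d ^^ j) (x i))) ((D ^^ j) (\<phi> (x i))))"
      using \<phi>_pow by (intro sum.cong) auto
    finally show ?thesis .
  qed
  have uniq: "\<exists>!c. c \<in> extensional ?B \<and> G.V.lincomb c ?B = v" if "v \<in> carrier G" for v
    using basis that unfolding G.V.basis_criterion[OF fin BG]
    by (simp add: PiE_def class_ring_simps)
  define cf where "cf v = (THE c. c \<in> extensional ?B \<and> G.V.lincomb c ?B = v)" for v
  have cf: "cf v \<in> extensional ?B" "G.V.lincomb (cf v) ?B = v" if "v \<in> carrier G" for v
    using theI'[OF uniq[OF that]] unfolding cf_def by blast+
  define \<psi> where "\<psi> = inv_into (carrier G) \<phi>"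
  have \<psi>: "\<psi> w \<in> carrier G" "\<phi> (\<psi> w) = w" for w
    using e(1) unfolding \<psi>_def by (simp_all add: inv_into_into f_inv_into_f)
  have \<psi>\<phi>: "\<psi> (\<phi> v) = v" if "v \<in> carrier G" for v
    using that \<phi>_inj unfolding \<psi>_def by simp
  define \<kappa> where "\<kappa> w i j = cf (\<psi> w) ((d ^^ j) (x i))" for w i j
  have "jordan_frame D n1 n2 n3 (\<phi> \<circ> x) \<kappa>"
  proof (rule jordan_frame.intro)
    show "Vector_Spaces.linear scale scale D" by (rule D)
    show "(D ^^ ?bs i) ((\<phi> \<circ> x) i) = 0" if "i < ?N" for i
      using \<phi>_pow[OF that, of "?bs i"] nil[OF that] e(2) by simp
    show "w = (\<Sum>i<?N. \<Sum>j<?bs i. scale (\<kappa> w i j) ((D ^^ j) ((\<phi> \<circ> x) i)))" for w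
      using lin[OF fin BG, of "cf (\<psi> w)"] unfolding cf(2)[OF \<psi>(1)] \<psi>(2) sum_B \<kappa>_def by simp
    show "\<kappa> w i j = c i j" if s: "(\<Sum>i<?N. \<Sum>j<?bs i. scale (c i j) ((D ^^ j) ((\<phi> \<circ> x) i))) = w"
      and ij: "i < ?N" "j < ?bs i" for c w i j
    proof -
      \<comment> \<open>Coefficients indexed by pairs become coefficients on basis vectors, which is
        possible since the indexing is injective. The restriction to \<open>?B\<close> makes the
        function \<open>extensional\<close>, as the uniqueness of coefficients requires.\<close>
      define c' where "c' = restrict (\<lambda>b. (\<lambda>(i, j). c i j) (inv_into ?I ?b b)) ?B"
      have c': "c' ((d ^^ j) (x i)) = c i j" if "i < ?N" "j < ?bs i" for i j
      proof -
        have m: "(i, j) \<in> ?I" using that by simp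
        then have "(d ^^ j) (x i) \<in> ?B" unfolding B by (force intro: image_eqI[of _ _ "(i, j)"])
        moreover have "inv_into ?I ?b ((d ^^ j) (x i)) = (i, j)"
          using inv_into_f_f[OF inj m] by simp
        ultimately show ?thesis unfolding c'_def by simp
      qed
      have "\<phi> (G.V.lincomb c' ?B) = (\<Sum>i<?N. \<Sum>j<?bs i. scale (c' ((d ^^ j) (x i))) ((D ^^ j) (\<phi> (x i))))"
        using lin[OF fin BG, of c'] sum_B[of c'] by simp
      also have "\<dots> = w" unfolding s[symmetric] using c' by (intro sum.cong) auto
      finally have "\<phi> (G.V.lincomb c' ?B) = w" .
      then have "G.V.lincomb c' ?B = \<psi> w"
        using \<psi>\<phi> lin[OF fin BG, of c'] by metis
      moreover have "c' \<in> extensional ?B" unfolding c'_def by simp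
      ultimately have "cf (\<psi> w) = c'" using uniq[OF \<psi>(1)[of w]] cf[OF \<psi>(1)[of w]] by blast
      then show ?thesis unfolding \<kappa>_def using c'[OF ij] by simp
    qed
  qed
  moreover have "coefficient G ?B (x i) v = \<kappa> (\<phi> v) i 0" if "i < ?N" "v \<in> carrier G" for i v
    using \<psi>\<phi>[OF that(2)] unfolding coefficient_def \<kappa>_def cf_def by simp
  ultimately show ?thesis using that x by blast
qed

text \<open>\<open>P0\<close> identifies the kernel of \<open>D\<close>, modulo images lying in it,
  with the even part of the target, and \<open>P1\<close> identifies the kernel of
  \<open>D \<circ> D\<close>, modulo the kernel of \<open>D\<close> and images, with the odd part.
  For every Jordan decomposition these quotients have the heads of the blocks of size 1 and of size
  2 as bases, so sending \<open>y_i\<close> to the projection of its head is an isomorphism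
  independent of how the blocks were chosen.\<close>

lemma semisimplification_isomorphic:
  fixes G :: "('k::field, 'v) superalgebra" and T :: "'b \<Rightarrow> 'b \<Rightarrow> ('b \<Rightarrow>\<^sub>0 'k)" and T' :: "'c \<Rightarrow> 'c \<Rightarrow> ('c \<Rightarrow>\<^sub>0 'k)"
  assumes G: "bilinear_superalgebra G" and \<phi>: "superalgebra_iso \<phi> G (pm_superalgebra UNIV p T)"
    and D: "pm_linear D" and deriv: "\<And>a b. D (bil T a b) = bil T (D a) b + bil T a (D b)"
    and d: "\<And>v. v \<in> carrier G \<Longrightarrow> d v \<in> carrier G" "\<And>v. v \<in> carrier G \<Longrightarrow> \<phi> (d v) = D (\<phi> v)"
    and jd: "jordan_decomposition G d n1 n2 n3 x"
    and P: "pm_linear P0" "pm_linear P1"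
    and P_D: "\<And>v. P0 (D v) = 0" "\<And>v. P1 (D v) = 0" "\<And>v. D v = 0 \<Longrightarrow> P1 v = 0"
    and P_mult: "\<And>a b. D a = 0 \<Longrightarrow> D b = 0 \<Longrightarrow> P0 (bil T a b) = bil T' (P0 a) (P0 b)"
      "\<And>a b. D a = 0 \<Longrightarrow> D (D b) = 0 \<Longrightarrow> P1 (bil T a b) = bil T' (P0 a) (P1 b)"
      "\<And>a b. D (D a) = 0 \<Longrightarrow> D b = 0 \<Longrightarrow> P1 (bil T a b) = bil T' (P1 a) (P0 b)"
      "\<And>a b. D (D a) = 0 \<Longrightarrow> D (D b) = 0 \<Longrightarrow> P0 (- bil T a (D b) + bil T (D a) b) = bil T' (P1 a) (P1 b)"
    and P_parity: "\<And>v b. b \<in> Poly_Mapping.keys (P0 v) \<Longrightarrow> p' b = 0" "\<And>v b. b \<in> Poly_Mapping.keys (P1 v) \<Longrightarrow> p' b = 1"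
    and P_surj: "\<And>g. (\<And>b. b \<in> Poly_Mapping.keys g \<Longrightarrow> p' b = 0) \<Longrightarrow> \<exists>a. D a = 0 \<and> P0 a = g"
      "\<And>g. (\<And>b. b \<in> Poly_Mapping.keys g \<Longrightarrow> p' b = 1) \<Longrightarrow> \<exists>a. D (D a) = 0 \<and> P1 a = g"
    and P_inj: "\<And>a. D a = 0 \<Longrightarrow> P0 a = 0 \<Longrightarrow> \<exists>w. a = D w"
      "\<And>a. D (D a) = 0 \<Longrightarrow> P1 a = 0 \<Longrightarrow> \<exists>b w. D b = 0 \<and> a = b + D w"
  shows "isomorphic_superalgebras (semisimplification G d n1 n2 n3 x) (pm_superalgebra UNIV p' T')"
proof -
  interpret G: bilinear_superalgebra G by (rule G)
  obtain \<kappa> where frame: "jordan_frame D n1 n2 n3 (\<phi> \<circ> x) \<kappa>"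
    and coeff: "\<And>i v. i < n1 + n2 + n3 \<Longrightarrow> v \<in> carrier G \<Longrightarrow>
      coefficient G (jordan_basis d n1 n2 n3 x) (x i) v = \<kappa> (\<phi> v) i 0"
    and x: "\<And>i. i < n1 + n2 + n3 \<Longrightarrow> x i \<in> carrier G"
    by (rule jordan_decomposition_frame[OF G \<phi> D d jd]) auto
  define X where "X = \<phi> \<circ> x"
  interpret F: jordan_frame D n1 n2 n3 X \<kappa> using frame unfolding X_def .
  have epi: "superalgebra_epi \<phi> G (pm_superalgebra UNIV p T)"
    using \<phi> unfolding superalgebra_iso_def by blast
  note e = superalgebra_epiD[OF epi, simplified]
  note D_simps = pm_linear_simps[OF D] and P0 = pm_linear_simps[OF P(1)] and P1 = pm_linear_simps[OF P(2)]
  let ?m = "n1 + n2"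
  define Z where "Z i = (if i < n1 then P0 (X i) else P1 (X i))" for i
  define cf where "cf = semisimp_coeff G d n1 n2 n3 x"
  have neg: "\<phi> (\<ominus>\<^bsub>G\<^esub> v) = - \<phi> v" "\<ominus>\<^bsub>G\<^esub> v \<in> carrier G" if "v \<in> carrier G" for v
    using e(5)[OF that, of "- 1"] G.a_inv_smult[OF that] G.V.M.a_inv_closed[OF that] by simp_all
  have split: "(\<Sum>k<?m. f k) = (\<Sum>k<n1. f k) + (\<Sum>k\<in>{n1..<?m}. f k)" for f :: "nat \<Rightarrow> ('c \<Rightarrow>\<^sub>0 'k)"
  proof -
    have "sum f {0..<n1} + sum f {n1..<?m} = sum f {0..<?m}"
      by (rule sum.atLeastLessThan_concat) simp_all
    then show ?thesis by (simp add: atLeast0LessThan)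
  qed
  \<comment> \<open>In each case the relevant bracket lies in the kernel of \<open>D\<close> or of
    \<open>D \<circ> D\<close>, so its projection is determined by exactly those head coefficients
    that enter the structure constants.\<close>
  have key: "(\<Sum>k<?m. scale (cf i j k) (Z k)) = bil T' (Z i) (Z j)" if i: "i < ?m" and j: "j < ?m" for i j
  proof -
    have xi: "x i \<in> carrier G" "x j \<in> carrier G" using x i j by simp_all
    have Dij: "D (D (X i)) = 0" "D (D (X j)) = 0" using F.X_kernel2 i j by blast+
    have m1: "\<phi> (x i \<otimes>\<^bsub>G\<^esub> x j) = bil T (X i) (X j)" "x i \<otimes>\<^bsub>G\<^esub> x j \<in> carrier G"
      using e(4)[OF xi] G.mult_closed[OF xi] by (simp_all add: X_def)
    let ?v = "(\<ominus>\<^bsub>G\<^esub> (x i \<otimes>\<^bsub>G\<^esub> d (x j))) \<oplus>\<^bsub>G\<^esub> (d (x i) \<otimes>\<^bsub>G\<^esub> x j)"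
    have m2: "\<phi> ?v = - bil T (X i) (D (X j)) + bil T (D (X i)) (X j)" "?v \<in> carrier G"
      using xi d neg e(3,4) by (simp_all add: X_def)
    have DD: "D (bil T (X i) (X j)) = bil T (D (X i)) (X j) + bil T (X i) (D (X j))" by (rule deriv)
    consider "i < n1" "j < n1" | "i < n1" "\<not> j < n1" | "\<not> i < n1" "j < n1" | "\<not> i < n1" "\<not> j < n1" by blast
    then show ?thesis
    proof cases
      case 1
      have k: "D (X i) = 0" "D (X j) = 0" using F.X_kernel 1 by blast+
      have "cf i j k = (if k < n1 then \<kappa> (bil T (X i) (X j)) k 0 else 0)" if "k < ?m" for k
        using 1 that coeff[OF _ m1(2), of k] m1(1) by (simp add: cf_def semisimp_coeff_def semisimp_parity_def Let_def)
      then have "(\<Sum>k<?m. scale (cf i j k) (Z k)) = (\<Sum>k<n1. scale (\<kappa> (bil T (X i) (X j)) k 0) (P0 (X k)))"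
        unfolding split by (simp add: Z_def)
      also have "\<dots> = P0 (bil T (X i) (X j))"
        by (rule F.even_projection[OF P(1) P_D(1), symmetric]) (simp add: DD k)
      also have "\<dots> = bil T' (Z i) (Z j)" using P_mult(1)[OF k] 1 by (simp add: Z_def)
      finally show ?thesis .
    next
      case 2
      have k: "D (X i) = 0" using F.X_kernel 2 by blast
      have "cf i j k = (if k < n1 then 0 else \<kappa> (bil T (X i) (X j)) k 0)" if "k < ?m" for k
        using 2 that coeff[OF _ m1(2), of k] m1(1) by (simp add: cf_def semisimp_coeff_def semisimp_parity_def Let_def)
      then have "(\<Sum>k<?m. scale (cf i j k) (Z k)) = (\<Sum>k\<in>{n1..<?m}. scale (\<kappa> (bil T (X i) (X j)) k 0) (P1 (X k)))"
        unfolding split by (simp add: Z_def)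
      \<comment> \<open>By the Leibniz rule, as \<open>X i\<close> is killed by \<open>D\<close>,
        applying \<open>D\<close> twice to the bracket gives
        \<open>[X i, D (D (X j))] = 0\<close>.\<close>
      also have "\<dots> = P1 (bil T (X i) (X j))"
        by (rule F.odd_projection[OF P(2) P_D(2,3), symmetric]) (simp_all add: DD k D_simps deriv Dij)
      also have "\<dots> = bil T' (Z i) (Z j)" using P_mult(2)[OF k Dij(2)] 2 by (simp add: Z_def)
      finally show ?thesis .
    next
      case 3
      have k: "D (X j) = 0" using F.X_kernel 3 by blast
      have "cf i j k = (if k < n1 then 0 else \<kappa> (bil T (X i) (X j)) k 0)" if "k < ?m" for k
        using 3 that coeff[OF _ m1(2), of k] m1(1) by (simp add: cf_def semisimp_coeff_def semisimp_parity_def Let_def)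
      then have "(\<Sum>k<?m. scale (cf i j k) (Z k)) = (\<Sum>k\<in>{n1..<?m}. scale (\<kappa> (bil T (X i) (X j)) k 0) (P1 (X k)))"
        unfolding split by (simp add: Z_def)
      also have "\<dots> = P1 (bil T (X i) (X j))"
        by (rule F.odd_projection[OF P(2) P_D(2,3), symmetric]) (simp_all add: DD k D_simps deriv Dij)
      also have "\<dots> = bil T' (Z i) (Z j)" using P_mult(3)[OF Dij(1) k] 3 by (simp add: Z_def)
      finally show ?thesis .
    next
      case 4
      let ?w = "- bil T (X i) (D (X j)) + bil T (D (X i)) (X j)"
      have "cf i j k = (if k < n1 then \<kappa> ?w k 0 else 0)" if "k < ?m" for k
        using 4 that coeff[OF _ m2(2), of k] m2(1) by (simp add: cf_def semisimp_coeff_def semisimp_parity_def Let_def)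
      then have "(\<Sum>k<?m. scale (cf i j k) (Z k)) = (\<Sum>k<n1. scale (\<kappa> ?w k 0) (P0 (X k)))"
        unfolding split by (simp add: Z_def)
      \<comment> \<open>The signs in \<open>?w\<close> make the two copies of
        \<open>[D (X i), D (X j)]\<close> cancel in \<open>D ?w\<close>, and the other terms contain
        \<open>D (D (X i))\<close> or \<open>D (D (X j))\<close>.\<close>
      also have "\<dots> = P0 ?w"
        by (rule F.even_projection[OF P(1) P_D(1), symmetric]) (simp add: D_simps deriv Dij)
      also have "\<dots> = bil T' (Z i) (Z j)" using P_mult(4)[OF Dij] 4 by (simp add: Z_def)
      finally show ?thesis .
    qed
  qed
  \<comment> \<open>A linear relation splits by parity. Its even part lifts to an image under
    \<open>D\<close> and its odd part to a kernel element plus an image; neither has coefficients at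
    the heads in question.\<close>
  have Z_kernel: "c i = 0" if c: "(\<Sum>i<?m. scale (c i) (Z i)) = 0" and i: "i < ?m" for c i
  proof -
    let ?a0 = "\<Sum>i<n1. scale (c i) (X i)" and ?a1 = "\<Sum>i\<in>{n1..<?m}. scale (c i) (X i)"
    have "(\<Sum>i<?m. scale (c i) (Z i)) = P0 ?a0 + P1 ?a1" unfolding split by (simp add: Z_def P0 P1)
    then have sum: "P0 ?a0 = - P1 ?a1" using c by (simp add: eq_neg_iff_add_eq_0)
    have "Poly_Mapping.lookup (P0 ?a0) b = 0" for b
    proof (rule ccontr)
      assume "Poly_Mapping.lookup (P0 ?a0) b \<noteq> 0"
      then have "b \<in> Poly_Mapping.keys (P0 ?a0)" "b \<in> Poly_Mapping.keys (P1 ?a1)"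
        unfolding in_keys_iff sum by simp_all
      then show False using P_parity by fastforce
    qed
    then have z0: "P0 ?a0 = 0" by (intro poly_mapping_eqI) simp
    then have z1: "P1 ?a1 = 0" using sum by simp
    have \<kappa>: "\<kappa> (\<Sum>i\<in>K. scale (c i) (X i)) i 0 = (if i \<in> K then c i else 0)" if "K \<subseteq> {..<?m}" for K
    proof -
      have fin: "finite K" using that finite_subset by blast
      have "\<kappa> (\<Sum>i\<in>K. scale (c i) (X i)) i 0 = (\<Sum>k\<in>K. c k * \<kappa> (X k) i 0)"
        using i F.bs_simps(4) by (simp add: F.\<kappa>_sum F.\<kappa>_scale)
      also have "\<dots> = (\<Sum>k\<in>K. if k = i then c i else 0)"
        using that i by (intro sum.cong) (auto simp: F.\<kappa>_X subset_iff)
      finally show ?thesis using fin by simp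
    qed
    show "c i = 0"
    proof (cases "i < n1")
      case True
      have "D ?a0 = 0" using F.X_kernel by (simp add: D_simps)
      from P_inj(1)[OF this z0] obtain w where "?a0 = D w" by blast
      then have "\<kappa> ?a0 i 0 = 0" using F.\<kappa>_D[of i 0 w] i F.bs_simps(4) by simp
      then show ?thesis using \<kappa>[of "{..<n1}"] True by simp
    next
      case False
      have "D (D ?a1) = 0" using F.X_kernel2 by (simp add: D_simps)
      from P_inj(2)[OF this z1] obtain b w where bw: "D b = 0" "?a1 = b + D w" by blast
      have "\<kappa> ?a1 i 0 = 0"
        unfolding bw(2) using F.\<kappa>_add[of i 0 b "D w"] F.\<kappa>_D[of i 0 w] F.\<kappa>_kernel[OF bw(1) False] i F.bs_simps(4) by simp
      moreover have "{n1..<?m} \<subseteq> {..<?m}" by auto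
      ultimately show ?thesis using \<kappa>[of "{n1..<?m}"] False i by simp
    qed
  qed
  let ?S = "semisimplification G d n1 n2 n3 x" and ?H = "pm_superalgebra UNIV p' T'"
  define \<theta> where "\<theta> a = (\<Sum>i<?m. scale (a $ i) (Z i))" for a :: "'k vec"
  have S: "carrier ?S = carrier_vec ?m" "add ?S = (+)" "smult ?S = (\<cdot>\<^sub>v)"
    "mult ?S = (\<lambda>a b. vec ?m (\<lambda>k. \<Sum>i<?m. \<Sum>j<?m. a $ i * b $ j * cf i j k))"
    "homog ?S q = {a \<in> carrier_vec ?m. \<forall>i<?m. a $ i \<noteq> 0 \<longrightarrow> semisimp_parity n1 i = q}" for q
    by (simp_all add: semisimplification_def Let_def cf_def)
  \<comment> \<open>The coordinates of a preimage are the head coefficients of any \<open>w\<close>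
    in the kernel of \<open>D\<close> with \<open>P0 w = g\<close>; the odd case is
    analogous.\<close>
  have even: "\<exists>a\<in>homog ?S 0. \<theta> a = g" if g: "g \<in> homog ?H 0" for g
  proof -
    obtain w where w: "D w = 0" "P0 w = g" using P_surj(1)[of g] g by auto
    let ?a = "vec ?m (\<lambda>i. if i < n1 then \<kappa> w i 0 else 0)"
    have "\<theta> ?a = (\<Sum>i<n1. scale (\<kappa> w i 0) (P0 (X i)))"
      unfolding \<theta>_def split by (simp add: Z_def)
    also have "\<dots> = g" using F.even_projection[OF P(1) P_D(1) w(1)] w(2) by simp
    finally show ?thesis by (intro bexI[of _ ?a]) (auto simp: S semisimp_parity_def)
  qed
  have odd: "\<exists>a\<in>homog ?S 1. \<theta> a = g" if g: "g \<in> homog ?H 1" for g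
  proof -
    obtain w where w: "D (D w) = 0" "P1 w = g" using P_surj(2)[of g] g by auto
    let ?a = "vec ?m (\<lambda>i. if i < n1 then 0 else \<kappa> w i 0)"
    have "\<theta> ?a = (\<Sum>i\<in>{n1..<?m}. scale (\<kappa> w i 0) (P1 (X i)))"
      unfolding \<theta>_def split by (simp add: Z_def)
    also have "\<dots> = g" using F.odd_projection[OF P(2) P_D(2,3) w(1)] w(2) by simp
    finally show ?thesis by (intro bexI[of _ ?a]) (auto simp: S semisimp_parity_def)
  qed
  have add: "\<theta> (a + b) = \<theta> a + \<theta> b" if "a \<in> carrier_vec ?m" "b \<in> carrier_vec ?m" for a b
    using that by (simp add: \<theta>_def pm.scale_left_distrib sum.distrib)
  have smult: "\<theta> (c \<cdot>\<^sub>v a) = scale c (\<theta> a)" if "a \<in> carrier_vec ?m" for a c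
    using that by (simp add: \<theta>_def pm.scale_sum_right)
  have homog: "\<theta> ` homog ?S q = homog ?H q" for q
  proof
    show "homog ?H q \<subseteq> \<theta> ` homog ?S q"
    proof (cases "q = 0")
      case True
      then show ?thesis using even by blast
    next
      case False
      then have "q = 1" by (cases q) auto
      then show ?thesis using odd by blast
    qed
    show "\<theta> ` homog ?S q \<subseteq> homog ?H q"
    proof (rule image_subsetI)
      fix a assume a: "a \<in> homog ?S q"
      have "Poly_Mapping.keys (\<theta> a) \<subseteq> {b. p' b = q}"
        unfolding \<theta>_def
      proof (rule keys_sum_subset)
        fix i assume "i \<in> {..<?m}"
        then have "a $ i \<noteq> 0 \<longrightarrow> semisimp_parity n1 i = q" using a by (simp add: S)
        moreover have "Poly_Mapping.keys (Z i) \<subseteq> {b. p' b = semisimp_parity n1 i}"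
          using P_parity unfolding Z_def semisimp_parity_def by auto
        ultimately show "Poly_Mapping.keys (scale (a $ i) (Z i)) \<subseteq> {b. p' b = q}"
          using keys_scale[of "a $ i" "Z i"] by (cases "a $ i = 0") auto
      qed
      then show "\<theta> a \<in> homog ?H q" by auto
    qed
  qed
  have surj: "\<theta> ` carrier ?S = carrier ?H"
  proof
    show "\<theta> ` carrier ?S \<subseteq> carrier ?H" by simp
    show "carrier ?H \<subseteq> \<theta> ` carrier ?S"
    proof
      fix g assume "g \<in> carrier ?H"
      have g: "g = pm_filter (\<lambda>b. p' b = 0) g + pm_filter (\<lambda>b. p' b = 1) g"
        by (rule poly_mapping_eqI) (simp add: lookup_add)
      obtain a where a: "a \<in> homog ?S 0" "\<theta> a = pm_filter (\<lambda>b. p' b = 0) g"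
        using even[of "pm_filter (\<lambda>b. p' b = 0) g"] by (auto simp: keys_pm_filter)
      obtain b where b: "b \<in> homog ?S 1" "\<theta> b = pm_filter (\<lambda>b. p' b = 1) g"
        using odd[of "pm_filter (\<lambda>b. p' b = 1) g"] by (auto simp: keys_pm_filter)
      have ab: "a \<in> carrier_vec ?m" "b \<in> carrier_vec ?m" using a(1) b(1) by (simp_all add: S)
      have "\<theta> (a + b) = g" using add[OF ab] a(2) b(2) g by simp
      then show "g \<in> \<theta> ` carrier ?S" unfolding S using ab by (intro image_eqI[of _ _ "a + b"]) auto
    qed
  qed
  have inj: "inj_on \<theta> (carrier ?S)"
  proof (rule inj_onI)
    fix a b assume ab: "a \<in> carrier ?S" "b \<in> carrier ?S" "\<theta> a = \<theta> b"
    then have "(\<Sum>i<?m. scale (a $ i - b $ i) (Z i)) = 0"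
      by (simp add: \<theta>_def pm.scale_left_diff_distrib sum_subtractf)
    from Z_kernel[OF this] show "a = b" using ab(1,2) by (intro eq_vecI) (auto simp: S)
  qed
  have mult: "\<theta> (a \<otimes>\<^bsub>?S\<^esub> b) = bil T' (\<theta> a) (\<theta> b)" if "a \<in> carrier ?S" "b \<in> carrier ?S" for a b
  proof -
    have "\<theta> (a \<otimes>\<^bsub>?S\<^esub> b) = (\<Sum>k<?m. \<Sum>i<?m. \<Sum>j<?m. scale (a $ i * b $ j * cf i j k) (Z k))"
      by (simp add: \<theta>_def S pm.scale_sum_left)
    also have "\<dots> = (\<Sum>i<?m. \<Sum>k<?m. \<Sum>j<?m. scale (a $ i * b $ j * cf i j k) (Z k))"
      by (rule sum.swap)
    also have "\<dots> = (\<Sum>i<?m. \<Sum>j<?m. \<Sum>k<?m. scale (a $ i * b $ j * cf i j k) (Z k))"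
      by (intro sum.cong refl sum.swap)
    also have "\<dots> = (\<Sum>i<?m. \<Sum>j<?m. scale (a $ i * b $ j) (bil T' (Z i) (Z j)))"
      by (intro sum.cong refl) (simp add: key[symmetric] pm.scale_sum_right)
    also have "\<dots> = bil T' (\<theta> a) (\<theta> b)"
      by (simp add: \<theta>_def pm.scale_sum_right) (subst sum.swap, simp add: mult.commute)
    finally show ?thesis .
  qed
  have "\<theta> \<in> LinearCombinations.module_hom class_ring ?S ?H"
    by (simp add: LinearCombinations.module_hom_def S add smult)
  then show ?thesis
    unfolding isomorphic_superalgebras_def bij_betw_def using surj inj mult homog
    by (intro exI[of _ \<theta>]) simp
qed

section \<open>Lie superalgebras given by tables of integers modulo 3\<close>

text \<open>Lists of integer coefficients let identities between structure constants be decided by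
  rewriting, independently of the field. Repeated keys are allowed and are added up here.\<close>

definition lin :: "('b \<times> int) list \<Rightarrow> ('b \<Rightarrow>\<^sub>0 'k::field)" where
  "lin xs = sum_list (map (\<lambda>(k, c). Poly_Mapping.single k (of_int c)) xs)"

definition tscale :: "int \<Rightarrow> ('b \<times> int) list \<Rightarrow> ('b \<times> int) list" where
  "tscale s = map (\<lambda>(k, c). (k, s * c))"

definition tmult :: "('b \<Rightarrow> 'b \<Rightarrow> ('c \<times> int) list) \<Rightarrow> ('b \<times> int) list \<Rightarrow> ('b \<times> int) list \<Rightarrow> ('c \<times> int) list" where
  "tmult tb xs ys = concat (map (\<lambda>(i, a). concat (map (\<lambda>(j, b). tscale (a * b) (tb i j)) ys)) xs)"

text \<open>Coefficients of equal keys are collected before divisibility by 3 is tested, since the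
  lists produced by \<open>tmult\<close> are not normalized.\<close>

function vanishing :: "('b \<times> int) list \<Rightarrow> bool" where
  "vanishing [] = True"
| "vanishing ((k, c) # xs) = (3 dvd (c + sum_list (map snd (filter (\<lambda>y. fst y = k) xs))) \<and>
     vanishing (filter (\<lambda>y. fst y \<noteq> k) xs))"
  by pat_completeness auto
termination by (relation "Wellfounded.measure length") (auto simp: le_imp_less_Suc)

abbreviation tconst :: "('b \<Rightarrow> 'b \<Rightarrow> ('c \<times> int) list) \<Rightarrow> 'b \<Rightarrow> 'b \<Rightarrow> ('c \<Rightarrow>\<^sub>0 'k::field)" where
  "tconst tb \<equiv> (\<lambda>i j. lin (tb i j))"

lemma lin_simps [simp]:
  "lin [] = 0" "lin ((k, c) # xs) = Poly_Mapping.single k (of_int c) + lin xs" "lin (xs @ ys) = lin xs + lin ys"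
  by (simp_all add: lin_def)

lemma lin_tscale [simp]: "lin (tscale s xs) = scale (of_int s) (lin xs)"
  by (induction xs) (auto simp: tscale_def pm.scale_right_distrib)

lemma lin_tmult [simp]: "lin (tmult tb xs ys) = bil (tconst tb) (lin xs) (lin ys)"
proof (induction xs)
  case (Cons x xs)
  obtain i a where x: "x = (i, a)" by force
  have "lin (concat (map (\<lambda>(j, b). tscale (a * b) (tb i j)) ys)) =
      bil (tconst tb) (Poly_Mapping.single i (of_int a)) (lin ys :: _ \<Rightarrow>\<^sub>0 'b)"
    by (induction ys) auto
  then show ?case using Cons by (simp add: tmult_def x)
qed (simp add: tmult_def)

lemma keys_lin: "Poly_Mapping.keys (lin xs) \<subseteq> fst ` set xs"
proof (induction xs)
  case (Cons x xs)
  then show ?case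
    using keys_add[of "Poly_Mapping.single (fst x) (of_int (snd x))" "lin xs"]
    by (cases x) (auto split: if_splits)
qed simp

lemma lin_filter: "lin xs = Poly_Mapping.single k (of_int (sum_list (map snd (filter (\<lambda>y. fst y = k) xs))))
    + lin (filter (\<lambda>y. fst y \<noteq> k) xs)"
  by (induction xs) (auto simp: single_add algebra_simps)

lemma vanishing_lin:
  assumes "CHAR('k::field) = 3"
  shows "vanishing xs \<Longrightarrow> lin xs = (0 :: 'b \<Rightarrow>\<^sub>0 'k)"
proof (induction xs rule: vanishing.induct)
  case (2 k c xs)
  then have "of_int (c + sum_list (map snd (filter (\<lambda>y. fst y = k) xs))) = (0::'k)"
    using assms by (subst of_int_eq_0_iff_char_dvd) simp
  then have "Poly_Mapping.single k (of_int c) +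
      Poly_Mapping.single k (of_int (sum_list (map snd (filter (\<lambda>y. fst y = k) xs)))) = (0 :: 'b \<Rightarrow>\<^sub>0 'k)"
    by (simp add: single_add[symmetric])
  then show ?case using 2 by (simp add: lin_filter[of xs k] add.assoc[symmetric])
qed simp

lemma lin_nonzero:
  assumes "CHAR('k::field) = 3" "\<not> 3 dvd c" "k \<notin> fst ` set xs"
  shows "lin ((k, c) # xs) \<noteq> (0 :: 'b \<Rightarrow>\<^sub>0 'k)"
proof
  assume "lin ((k, c) # xs) = (0 :: 'b \<Rightarrow>\<^sub>0 'k)"
  then have "Poly_Mapping.lookup (lin ((k, c) # xs)) k = (0 :: 'k)" by simp
  moreover have "Poly_Mapping.lookup (lin xs) k = (0 :: 'k)"
    using keys_lin[of xs] assms(3) by (auto simp: in_keys_iff)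
  ultimately have "of_int c = (0::'k)" by (simp add: lookup_add)
  then show False using assms(1,2) by (simp add: of_int_eq_0_iff_char_dvd)
qed

text \<open>A triple \<open>(x, y, b)\<close> is a step obtaining the basis vector \<open>b\<close> as \<open>\<plusminus> [x, y]\<close>. Spelling out the
  steps certifies generation and confines the check of the Jacobi identity to generators, since
  \<open>jac\<close> is inherited by brackets.\<close>

primrec reached :: "('b \<Rightarrow> 'b \<Rightarrow> ('b \<times> int) list) \<Rightarrow> 'b list \<Rightarrow> ('b \<times> 'b \<times> 'b) list \<Rightarrow> bool" where
  "reached tb known [] = (\<forall>b. b \<in> set known)"
| "reached tb known (s # st) = (case s of (x, y, b) \<Rightarrow> x \<in> set known \<and> y \<in> set known \<and>
     (tb x y = [(b, 1)] \<or> tb x y = [(b, - 1)]) \<and> reached tb (b # known) st)"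

lemma reached_induct:
  assumes "reached tb known st" "\<And>b. b \<in> set known \<Longrightarrow> P b"
    and "\<And>x y b c. P x \<Longrightarrow> P y \<Longrightarrow> c = 1 \<or> c = - 1 \<Longrightarrow> tb x y = [(b, c)] \<Longrightarrow> P b"
  shows "P b"
  using assms(1,2)
proof (induction st arbitrary: known)
  case Nil
  then show ?case by simp
next
  case (Cons s st)
  obtain x y b' where s: "s = (x, y, b')" using prod_cases3 by blast
  show ?case
  proof (rule Cons.IH)
    show "reached tb (b' # known) st" using Cons.prems(1) by (simp add: s)
    have "P b'" using Cons.prems assms(3)[of x y _ b'] by (auto simp: s)
    then show "P z" if "z \<in> set (b' # known)" for z using that Cons.prems(2) by auto
  qed
qed

definition tsign :: "bit \<Rightarrow> bit \<Rightarrow> int" where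
  "tsign q r = (if q = 1 \<and> r = 1 then - 1 else 1)"

lemma of_int_tsign [simp]: "of_int (tsign q r) = koszul_sign q r"
  by (simp add: tsign_def koszul_sign_def)

definition table_skew where
  "table_skew p tb i j = vanishing (tb i j @ tscale (tsign (p i) (p j)) (tb j i))"

definition table_jacobi where
  "table_jacobi p tb i j k = vanishing (tmult tb [(i, 1)] (tb j k) @ tscale (- 1) (tmult tb (tb i j) [(k, 1)]) @
     tscale (- tsign (p i) (p j)) (tmult tb [(j, 1)] (tb i k)))"

definition table_cube where
  "table_cube tb i = vanishing (tmult tb [(i, 1)] (tb i i))"

text \<open>Finitely many conditions on basis vectors. Bilinearity, the certificate of generation
  and, for the cube, polarization extend them to all homogeneous elements.\<close>

locale table_superalgebra =
  fixes p :: "'b \<Rightarrow> bit" and tb :: "'b \<Rightarrow> 'b \<Rightarrow> ('b \<times> int) list" and gs :: "'b list" and st :: "('b \<times> 'b \<times> 'b) list"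
    and T :: "'b \<Rightarrow> 'b \<Rightarrow> ('b \<Rightarrow>\<^sub>0 'k::field)"
  assumes char3: "CHAR('k) = 3"
    and T_def: "T = tconst tb"
    and tb_parity: "k \<in> set (tb i j) \<Longrightarrow> p (fst k) = p i + p j"
    and tb_skew: "table_skew p tb i j"
    and tb_jacobi: "i \<in> set gs \<Longrightarrow> table_jacobi p tb i j k'"
    and tb_cube: "p i = 1 \<Longrightarrow> table_cube tb i"
    and tb_reached: "reached tb gs st"
begin

abbreviation alg where "alg \<equiv> pm_superalgebra UNIV p T"
abbreviation v :: "'b \<Rightarrow> ('b \<Rightarrow>\<^sub>0 'k)" where "v i \<equiv> Poly_Mapping.single i 1"
abbreviation br where "br \<equiv> bil T"

lemma T_parity: "b \<in> Poly_Mapping.keys (T i j) \<Longrightarrow> p b = p i + p j"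
  using keys_lin[of "tb i j"] tb_parity by (fastforce simp: T_def)

section \<open>From basis vectors to homogeneous elements\<close>

definition pure :: "bit \<Rightarrow> ('b \<Rightarrow>\<^sub>0 'k) set" where
  "pure q = {a. \<forall>b\<in>Poly_Mapping.keys a. p b = q}"

lemma pure_simps:
  "v i \<in> pure (p i)" "x \<in> pure q \<Longrightarrow> y \<in> pure q \<Longrightarrow> x + y \<in> pure q" "x \<in> pure q \<Longrightarrow> scale c x \<in> pure q" "0 \<in> pure q"
  by (auto simp: pure_def dest!: subsetD[OF keys_add] subsetD[OF keys_scale])

lemma pure_br: "x \<in> pure q \<Longrightarrow> y \<in> pure r \<Longrightarrow> br x y \<in> pure (q + r)"
  by (auto simp: pure_def T_parity dest!: subsetD[OF keys_bil])

lemma skew: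
  assumes "x \<in> pure q" "y \<in> pure r"
  shows "br x y = - scale (koszul_sign q r) (br y x)"
proof (rule bilinear_eqI[where F = br and G = "\<lambda>x y. - scale (koszul_sign q r) (br y x)"])
  fix i j assume ij: "i \<in> Poly_Mapping.keys x" "j \<in> Poly_Mapping.keys y"
  then have "p i = q" "p j = r" using assms by (auto simp: pure_def)
  then have "T i j + scale (koszul_sign q r) (T j i) = 0"
    using vanishing_lin[OF char3, of "tb i j @ tscale (tsign (p i) (p j)) (tb j i)"] tb_skew[of i j]
    by (simp add: table_skew_def T_def)
  then show "br (v i) (v j) = - scale (koszul_sign q r) (br (v j) (v i))"
    by (simp add: eq_neg_iff_add_eq_0)
qed (auto intro!: pm_linearI simp: pm.scale_right_distrib mult.commute)

definition jac :: "'b \<Rightarrow> bool" where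
  "jac i \<longleftrightarrow> (\<forall>j k. br (v i) (T j k) = br (T i j) (v k) + scale (koszul_sign (p i) (p j)) (br (v j) (T i k)))"

lemma jac_gs: "i \<in> set gs \<Longrightarrow> jac i"
  unfolding jac_def
proof (intro allI)
  fix j k assume "i \<in> set gs"
  from tb_jacobi[OF this, of j k] have "br (v i) (T j k) + (- br (T i j) (v k) -
      scale (koszul_sign (p i) (p j)) (br (v j) (T i k))) = 0"
    using vanishing_lin[OF char3, of "tmult tb [(i, 1)] (tb j k) @ tscale (- 1) (tmult tb (tb i j) [(k, 1)]) @
      tscale (- tsign (p i) (p j)) (tmult tb [(j, 1)] (tb i k))"]
    by (simp add: table_jacobi_def T_def)
  then have "br (v i) (T j k) - (br (T i j) (v k) + scale (koszul_sign (p i) (p j)) (br (v j) (T i k))) = 0"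
    by (simp only: diff_conv_add_uminus minus_add_distrib)
  then show "br (v i) (T j k) = br (T i j) (v k) + scale (koszul_sign (p i) (p j)) (br (v j) (T i k))"
    by (simp only: right_minus_eq)
qed

lemma jac_pure:
  assumes "jac i" "x \<in> pure q"
  shows "br (v i) (br x y) = br (br (v i) x) y + scale (koszul_sign (p i) q) (br x (br (v i) y))"
proof (rule bilinear_eqI[where F = "\<lambda>x y. br (v i) (br x y)" and
      G = "\<lambda>x y. br (br (v i) x) y + scale (koszul_sign (p i) q) (br x (br (v i) y))"])
  fix j k assume "j \<in> Poly_Mapping.keys x" "k \<in> Poly_Mapping.keys y"
  then have "p j = q" using assms(2) by (auto simp: pure_def)
  then show "br (v i) (br (v j) (v k)) = br (br (v i) (v j)) (v k) + scale (koszul_sign (p i) q) (br (v j) (br (v i) (v k)))"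
    using assms(1) by (simp add: jac_def)
qed (auto intro!: pm_linearI simp: pm.scale_right_distrib mult.commute)

text \<open>Bracketing with \<open>[v i, v j]\<close> is the supercommutator of two superderivations
  and hence again one. As \<open>c\<close> is 1 or -1, it can be divided out, and the property
  passes to \<open>v b\<close>.\<close>

lemma jac_bracket:
  assumes i: "jac i" and j: "jac j" and b: "tb i j = [(b, c)]" "c = 1 \<or> c = - 1"
  shows "jac b"
proof -
  have T: "T i j = scale (of_int c) (v b)" by (simp add: T_def b)
  have cc: "(of_int c * of_int c :: 'k) = 1" using b(2) by auto
  have vb: "v b = scale (of_int c) (br (v i) (v j))" using cc by (simp add: T)
  have pb: "p b = p i + p j" using tb_parity[of "(b, c)" i j] b(1) by simp
  have main: "br (br (v i) (v j)) (br (v k) (v l)) = br (br (br (v i) (v j)) (v k)) (v l) +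
      scale (koszul_sign (p i + p j) (p k)) (br (v k) (br (br (v i) (v j)) (v l)))" for k l
  proof -
    note P = pure_simps(1)
    define x y z w where "x = v i" and "y = v j" and "z = v k" and "w = v l"
    have x: "x \<in> pure (p i)" and y: "y \<in> pure (p j)" and z: "z \<in> pure (p k)"
      using P by (simp_all add: x_def y_def z_def)
    have jx: "br x (br a a') = br (br x a) a' + scale (koszul_sign (p i) q) (br a (br x a'))" if "a \<in> pure q" for a a' q
      using jac_pure[OF i that] by (simp add: x_def)
    have jy: "br y (br a a') = br (br y a) a' + scale (koszul_sign (p j) q) (br a (br y a'))" if "a \<in> pure q" for a a' q
      using jac_pure[OF j that] by (simp add: y_def)
    have xy: "br (br x y) a = br x (br y a) - scale (koszul_sign (p i) (p j)) (br y (br x a))" for a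
      using jx[OF y] by simp
    \<comment> \<open>Both orders of applying the two derivations are expanded completely. In the
      signed difference the terms where each factor is hit once cancel, which the case distinction
      over the three parities confirms.\<close>
    have 1: "br x (br y (br z w)) = br (br x (br y z)) w + scale (koszul_sign (p i) (p j + p k)) (br (br y z) (br x w))
        + scale (koszul_sign (p j) (p k)) (br (br x z) (br y w) + scale (koszul_sign (p i) (p k)) (br z (br x (br y w))))"
      unfolding jy[OF z, of w] using jx[OF pure_br[OF y z], of w] jx[OF z, of "br y w"] by simp
    have 2: "br y (br x (br z w)) = br (br y (br x z)) w + scale (koszul_sign (p j) (p i + p k)) (br (br x z) (br y w))
        + scale (koszul_sign (p i) (p k)) (br (br y z) (br x w) + scale (koszul_sign (p j) (p k)) (br z (br y (br x w))))"
      unfolding jx[OF z, of w] using jy[OF pure_br[OF x z], of w] jy[OF z, of "br x w"] by simp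
    have "br (br x y) (br z w) = br (br (br x y) z) w +
      scale (koszul_sign (p i + p j) (p k)) (br z (br (br x y) w))"
      unfolding xy 1 2
      by (cases "p i"; cases "p j"; cases "p k") (simp_all add: koszul_sign_def algebra_simps)
    then show ?thesis by (simp add: x_def y_def z_def w_def)
  qed
  have "br (v b) (br (v k) (v l)) = br (br (v b) (v k)) (v l) +
      scale (koszul_sign (p b) (p k)) (br (v k) (br (v b) (v l)))" for k l
    unfolding vb pb
    using arg_cong[OF main[of k l], of "scale (of_int c)"] by (simp add: pm.scale_right_distrib mult.commute)
  then show ?thesis by (simp add: jac_def)
qed

lemma jac_all: "jac i"
  by (rule reached_induct[OF tb_reached]) (use jac_gs jac_bracket in blast)+

lemma jacobi:
  assumes "x \<in> pure q" "y \<in> pure r"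
  shows "br x (br y z) = br (br x y) z + scale (koszul_sign q r) (br y (br x z))"
proof (rule linear_eq_on_keys[where f = "\<lambda>x. br x (br y z)" and g = "\<lambda>x. br (br x y) z + scale (koszul_sign q r) (br y (br x z))"])
  fix k assume "k \<in> Poly_Mapping.keys x"
  then have "p k = q" using assms(1) by (auto simp: pure_def)
  then show "br (v k) (br y z) = br (br (v k) y) z + scale (koszul_sign q r) (br y (br (v k) z))"
    using jac_pure[OF jac_all assms(2)] by blast
qed (auto intro!: pm_linearI simp: pm.scale_right_distrib mult.commute)

text \<open>The map sending \<open>x\<close> to \<open>[x, [x, x]]\<close> is additive on odd
  elements: its mixed terms are the left-hand sides of \<open>1\<close> and \<open>2\<close>, which
  vanish by the Jacobi identity and skew-symmetry. So basis vectors suffice, but for them the cube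
  has to be checked in the table.\<close>

lemma cube:
  assumes "x \<in> pure 1" shows "br x (br x x) = 0"
proof -
  have step: "br (x + y) (br (x + y) (x + y)) = 0"
    if x: "x \<in> pure 1" "br x (br x x) = 0" and y: "y \<in> pure 1" "br y (br y y) = 0" for x y
  proof -
    have yx: "br y x = br x y" using skew[OF y(1) x(1)] by (simp add: koszul_sign_def)
    have xx: "br x x \<in> pure 0" "br y y \<in> pure 0" using pure_br[OF x(1) x(1)] pure_br[OF y(1) y(1)] by simp_all
    have 1: "br x (br x y) + br x (br x y) + br y (br x x) = 0"
      using jacobi[OF x(1) x(1), of y] skew[OF xx(1) y(1)] by (simp add: koszul_sign_def algebra_simps)
    have 2: "br y (br y x) + br y (br y x) + br x (br y y) = 0"
      using jacobi[OF y(1) y(1), of x] skew[OF xx(2) x(1)] by (simp add: koszul_sign_def algebra_simps)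
    have "br (x + y) (br (x + y) (x + y)) = br x (br x x) + br y (br y y)
        + (br x (br x y) + br x (br x y) + br y (br x x)) + (br y (br y x) + br y (br y x) + br x (br y y))"
      by (simp add: yx algebra_simps)
    then show ?thesis using 1 2 x(2) y(2) by simp
  qed
  have "(\<Sum>k\<in>F. scale (Poly_Mapping.lookup x k) (v k)) \<in> pure 1 \<and>
      br (\<Sum>k\<in>F. scale (Poly_Mapping.lookup x k) (v k)) (br (\<Sum>k\<in>F. scale (Poly_Mapping.lookup x k) (v k)) (\<Sum>k\<in>F. scale (Poly_Mapping.lookup x k) (v k))) = 0"
    if "finite F" "F \<subseteq> Poly_Mapping.keys x" for F
    using that
  proof (induction F rule: finite_induct)
    case empty
    then show ?case by (simp add: pure_simps)
  next
    case (insert k F)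
    let ?c = "Poly_Mapping.lookup x k" and ?s = "\<Sum>k\<in>F. scale (Poly_Mapping.lookup x k) (v k)"
    have pk: "p k = 1" using assms insert.prems by (auto simp: pure_def)
    have "br (v k) (br (v k) (v k)) = 0"
      using vanishing_lin[OF char3, of "tmult tb [(k, 1)] (tb k k)"] tb_cube[OF pk] by (simp add: table_cube_def T_def)
    then have c: "br (scale ?c (v k)) (br (scale ?c (v k)) (scale ?c (v k))) = 0"
      by (simp only: bil_simps pm.scale_zero_right)
    have vk: "scale ?c (v k) \<in> pure 1" using pure_simps(1)[of k] pure_simps(3) pk by metis
    have IH: "?s \<in> pure 1" "br ?s (br ?s ?s) = 0" using insert by blast+
    show ?case
      unfolding sum.insert[OF insert.hyps]
      using step[OF vk c IH] pure_simps(2)[OF vk IH(1)] by blast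
  qed
  from conjunct2[OF this[OF finite_keys order.refl]] show ?thesis
    by (simp only: lext_def[symmetric] lext_id)
qed

lemma lie: "lie_relators alg \<subseteq> {0}"
proof -
  have H: "homog alg q = pure q" for q by (auto simp: pure_def)
  have m: "a \<ominus>\<^bsub>alg\<^esub> b = a - b" for a b by (rule pm_minus) simp_all
  show ?thesis
    unfolding lie_relators_def H m
  proof (intro Un_least subsetI; elim CollectE exE conjE)
    show "a \<in> {0}" if "a = (x \<otimes>\<^bsub>alg\<^esub> y) \<oplus>\<^bsub>alg\<^esub> (koszul_sign q r \<odot>\<^bsub>alg\<^esub> (y \<otimes>\<^bsub>alg\<^esub> x))" "x \<in> pure q" "y \<in> pure r" for a x y q r
      using that skew[of x q y r] by simp
    show "a \<in> {0}" if "a = (x \<otimes>\<^bsub>alg\<^esub> (y \<otimes>\<^bsub>alg\<^esub> z)) - (((x \<otimes>\<^bsub>alg\<^esub> y) \<otimes>\<^bsub>alg\<^esub> z) \<oplus>\<^bsub>alg\<^esub>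
        (koszul_sign q r \<odot>\<^bsub>alg\<^esub> (y \<otimes>\<^bsub>alg\<^esub> (x \<otimes>\<^bsub>alg\<^esub> z))))" "x \<in> pure q" "y \<in> pure r" "z \<in> pure s" for a x y z q r s
      using that jacobi[of x q y r z] by simp
    show "a \<in> {0}" if "a = x \<otimes>\<^bsub>alg\<^esub> (x \<otimes>\<^bsub>alg\<^esub> x)" "x \<in> pure 1" for a x
      using that cube by simp
  qed
qed

lemma generated:
  assumes "\<And>c a. a \<in> U \<Longrightarrow> scale c a \<in> U" "\<And>a b. a \<in> U \<Longrightarrow> b \<in> U \<Longrightarrow> br a b \<in> U" "\<And>i. i \<in> set gs \<Longrightarrow> v i \<in> U"
  shows "v i \<in> U"
proof (rule reached_induct[OF tb_reached, where P = "\<lambda>i. v i \<in> U"])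
  fix i j b c assume ij: "v i \<in> U" "v j \<in> U" and c: "c = 1 \<or> c = - 1" "tb i j = [(b, c)]"
  have "(of_int c * of_int c :: 'k) = 1" using c(1) by auto
  then have "v b = scale (of_int c) (br (v i) (v j))" by (simp add: T_def c(2))
  then show "v b \<in> U" using assms(1)[OF assms(2)[OF ij]] by metis
qed (rule assms(3))

end

section \<open>Structure constants\<close>

datatype g0 = T1 | T2 | A1 | A2 | A3 | A4 | B1 | B2 | B3 | B4
datatype g1 = U1 | U2 | U3 | U4 | V1 | V2 | V3 | V4

text \<open>The algebra \<open>br\<^sub>3\<close> is \<open>g\<^sub>0 \<oplus> sl\<^sub>2 \<oplus> g\<^sub>1 \<otimes> V\<close>, where \<open>V\<close> is the natural
  two-dimensional module of the copy of \<open>sl\<^sub>2\<close> containing \<open>e\<^sub>1\<close>, while \<open>brj\<^sub>2\<^sub>;\<^sub>3\<close> is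
  \<open>g\<^sub>0 \<oplus> g\<^sub>1\<close>. Both brackets are assembled from the bracket of \<open>g\<^sub>0\<close>, its action on \<open>g\<^sub>1\<close>, an
  invariant symmetric map \<open>g\<^sub>1 \<times> g\<^sub>1 \<rightarrow> g\<^sub>0\<close> and an invariant alternating form on \<open>g\<^sub>1\<close>. The
  letters \<open>A\<close> and \<open>U\<close> denote positive, \<open>B\<close> and \<open>V\<close> negative root vectors.\<close>

primrec g0_bracket :: "g0 \<Rightarrow> (g0 \<times> (g0 \<times> int) list) list" where
  "g0_bracket T1 = [(A2, [(A2, - 1)]), (A3, [(A3, - 1)]), (A4, [(A4, - 1)]), (B2, [(B2, 1)]), (B3, [(B3, 1)]), (B4, [(B4, 1)])]"
| "g0_bracket T2 = [(A1, [(A1, 1)]), (A2, [(A2, - 1)]), (A4, [(A4, 1)]), (B1, [(B1, - 1)]), (B2, [(B2, 1)]), (B4, [(B4, - 1)])]"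
| "g0_bracket A1 = [(T2, [(A1, - 1)]), (A2, [(A3, 1)]), (A3, [(A4, 1)]), (B1, [(T1, - 1)]), (B3, [(B2, - 1)]), (B4, [(B3, 1)])]"
| "g0_bracket A2 = [(T1, [(A2, 1)]), (T2, [(A2, 1)]), (A1, [(A3, - 1)]), (B2, [(T1, - 1), (T2, - 1)]), (B3, [(B1, - 1)])]"
| "g0_bracket A3 = [(T1, [(A3, 1)]), (A1, [(A4, - 1)]), (B1, [(A2, 1)]), (B2, [(A1, 1)]), (B3, [(T2, - 1)]), (B4, [(B1, 1)])]"
| "g0_bracket A4 = [(T1, [(A4, 1)]), (T2, [(A4, - 1)]), (B1, [(A3, - 1)]), (B3, [(A1, - 1)]), (B4, [(T1, - 1), (T2, 1)])]"
| "g0_bracket B1 = [(T2, [(B1, 1)]), (A1, [(T1, 1)]), (A3, [(A2, - 1)]), (A4, [(A3, 1)]), (B2, [(B3, 1)]), (B3, [(B4, 1)])]"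
| "g0_bracket B2 = [(T1, [(B2, - 1)]), (T2, [(B2, - 1)]), (A2, [(T1, 1), (T2, 1)]), (A3, [(A1, - 1)]), (B1, [(B3, - 1)])]"
| "g0_bracket B3 = [(T1, [(B3, - 1)]), (A1, [(B2, 1)]), (A2, [(B1, 1)]), (A3, [(T2, 1)]), (A4, [(A1, 1)]), (B1, [(B4, - 1)])]"
| "g0_bracket B4 = [(T1, [(B4, - 1)]), (T2, [(B4, 1)]), (A1, [(B3, - 1)]), (A3, [(B1, - 1)]), (A4, [(T1, 1), (T2, - 1)])]"

text \<open>Under the pair \<open>T1\<close>, \<open>T2\<close> the vectors \<open>U1\<close>, ...,
  \<open>U4\<close> have weights (1,0), (1,1), (1,-1), (0,1), and the \<open>V\<close> vectors the
  opposite ones. Modulo 3 these are all eight nonzero weights, and the roots of \<open>g0\<close>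
  are the same eight. Cartan weights thus cannot tell \<open>g0\<close> from \<open>g1\<close>; the
  integral roots below can.\<close>

primrec g0_action :: "g0 \<Rightarrow> (g1 \<times> (g1 \<times> int) list) list" where
  "g0_action T1 = [(U1, [(U1, 1)]), (U2, [(U2, 1)]), (U3, [(U3, 1)]), (V1, [(V1, - 1)]), (V2, [(V2, - 1)]), (V3, [(V3, - 1)])]"
| "g0_action T2 = [(U2, [(U2, 1)]), (U3, [(U3, - 1)]), (U4, [(U4, 1)]), (V2, [(V2, - 1)]), (V3, [(V3, 1)]), (V4, [(V4, - 1)])]"
| "g0_action A1 = [(U1, [(U2, 1)]), (U2, [(U3, 1)]), (V2, [(V1, 1)]), (V3, [(V2, - 1)])]"
| "g0_action A2 = [(U3, [(U4, - 1)]), (V1, [(U3, - 1)]), (V2, [(U2, 1)]), (V3, [(U1, 1)]), (V4, [(V3, - 1)])]"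
| "g0_action A3 = [(U2, [(U4, 1)]), (V2, [(U3, - 1)]), (V3, [(U2, - 1)]), (V4, [(V2, 1)])]"
| "g0_action A4 = [(U1, [(U4, - 1)]), (V3, [(U3, 1)]), (V4, [(V1, 1)])]"
| "g0_action B1 = [(U2, [(U1, 1)]), (U3, [(U2, - 1)]), (V1, [(V2, 1)]), (V2, [(V3, 1)])]"
| "g0_action B2 = [(U1, [(V3, - 1)]), (U2, [(V2, 1)]), (U3, [(V1, 1)]), (U4, [(U3, 1)]), (V3, [(V4, 1)])]"
| "g0_action B3 = [(U2, [(V3, - 1)]), (U3, [(V2, - 1)]), (U4, [(U2, - 1)]), (V2, [(V4, - 1)])]"
| "g0_action B4 = [(U3, [(V3, 1)]), (U4, [(U1, - 1)]), (V1, [(V4, 1)])]"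

primrec g1_square :: "g1 \<Rightarrow> (g1 \<times> (g0 \<times> int) list) list" where
  "g1_square U1 = [(U3, [(A2, - 1)]), (V1, [(T2, 1)]), (V2, [(B1, 1)]), (V4, [(B4, 1)])]"
| "g1_square U2 = [(U2, [(A2, 1)]), (U3, [(A3, - 1)]), (V1, [(A1, - 1)]), (V2, [(T1, - 1), (T2, - 1)]), (V3, [(B1, 1)]), (V4, [(B3, 1)])]"
| "g1_square U3 = [(U1, [(A2, - 1)]), (U2, [(A3, - 1)]), (U3, [(A4, - 1)]), (V2, [(A1, - 1)]), (V3, [(T1, 1), (T2, - 1)]), (V4, [(B2, - 1)])]"
| "g1_square U4 = [(V1, [(A4, 1)]), (V2, [(A3, 1)]), (V3, [(A2, - 1)]), (V4, [(T1, 1)])]"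
| "g1_square V1 = [(U1, [(T2, 1)]), (U2, [(A1, - 1)]), (U4, [(A4, 1)]), (V3, [(B2, 1)])]"
| "g1_square V2 = [(U1, [(B1, 1)]), (U2, [(T1, - 1), (T2, - 1)]), (U3, [(A1, - 1)]), (U4, [(A3, 1)]), (V2, [(B2, - 1)]), (V3, [(B3, 1)])]"
| "g1_square V3 = [(U2, [(B1, 1)]), (U3, [(T1, 1), (T2, - 1)]), (U4, [(A2, - 1)]), (V1, [(B2, 1)]), (V2, [(B3, 1)]), (V3, [(B4, 1)])]"
| "g1_square V4 = [(U1, [(B4, 1)]), (U2, [(B3, 1)]), (U3, [(B2, - 1)]), (U4, [(T1, 1)])]"

primrec g1_form :: "g1 \<Rightarrow> (g1 \<times> int list) list" where
  "g1_form U1 = [(V1, [- 1])]"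
| "g1_form U2 = [(V2, [1])]"
| "g1_form U3 = [(V3, [1])]"
| "g1_form U4 = [(V4, [- 1])]"
| "g1_form V1 = [(U1, [1])]"
| "g1_form V2 = [(U2, [- 1])]"
| "g1_form V3 = [(U3, [- 1])]"
| "g1_form V4 = [(U4, [1])]"

text \<open>A missing key stands for the zero combination. This is why the values of the form are
  stored as one-element lists.\<close>

primrec entry :: "('a \<times> 'c list) list \<Rightarrow> 'a \<Rightarrow> 'c list" where
  "entry [] a = []"
| "entry (x # xs) a = (if fst x = a then snd x else entry xs a)"

definition tmap :: "('a \<Rightarrow> 'b) \<Rightarrow> int \<Rightarrow> ('a \<times> int) list \<Rightarrow> ('b \<times> int) list" where
  "tmap f s = map (\<lambda>(k, c). (f k, s * c))"

datatype brj_basis = Ev g0 | Od g1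

fun brj_table :: "brj_basis \<Rightarrow> brj_basis \<Rightarrow> (brj_basis \<times> int) list" where
  "brj_table (Ev a) (Ev b) = tmap Ev 1 (entry (g0_bracket a) b)"
| "brj_table (Ev a) (Od u) = tmap Od 1 (entry (g0_action a) u)"
| "brj_table (Od u) (Ev a) = tmap Od (- 1) (entry (g0_action a) u)"
| "brj_table (Od u) (Od v) = tmap Ev 1 (entry (g1_square u) v)"

primrec brj_parity :: "brj_basis \<Rightarrow> bit" where
  "brj_parity (Ev a) = 0"
| "brj_parity (Od u) = 1"

text \<open>With \<open>E, H, F\<close> the standard basis of \<open>sl\<^sub>2\<close>, the vectors \<open>Lo u\<close> and \<open>Hi u = [E, Lo u]\<close> span a
  copy of \<open>V\<close>.\<close>

datatype br3_basis = Inv g0 | Lo g1 | Hi g1 | F | H | E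

text \<open>The bracket on the tensor product of \<open>g1\<close> and \<open>V\<close> is the sum
  of two pairings: the symmetric map on \<open>g1\<close> times the alternating form on
  \<open>V\<close>, with values in \<open>g0\<close>, and the alternating form on \<open>g1\<close>
  times a symmetric map from pairs in \<open>V\<close> to \<open>sl2\<close>. Hence exchanging the
  roles of \<open>Lo\<close> and \<open>Hi\<close> reverses the sign of the \<open>Inv\<close> part
  and keeps that of the \<open>H\<close> part. The entry \<open>[H, E] = - E\<close> is the usual
  \<open>2 E\<close> read modulo 3.\<close>

fun br3_table :: "br3_basis \<Rightarrow> br3_basis \<Rightarrow> (br3_basis \<times> int) list" where
  "br3_table (Inv a) (Inv b) = tmap Inv 1 (entry (g0_bracket a) b)"
| "br3_table (Inv a) (Lo u) = tmap Lo 1 (entry (g0_action a) u)"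
| "br3_table (Inv a) (Hi u) = tmap Hi 1 (entry (g0_action a) u)"
| "br3_table (Lo u) (Inv a) = tmap Lo (- 1) (entry (g0_action a) u)"
| "br3_table (Hi u) (Inv a) = tmap Hi (- 1) (entry (g0_action a) u)"
| "br3_table (Lo u) (Lo v) = map (\<lambda>c. (F, - c)) (entry (g1_form u) v)"
| "br3_table (Hi u) (Hi v) = map (\<lambda>c. (E, c)) (entry (g1_form u) v)"
| "br3_table (Lo u) (Hi v) = tmap Inv 1 (entry (g1_square u) v) @ map (\<lambda>c. (H, c)) (entry (g1_form u) v)"
| "br3_table (Hi u) (Lo v) = tmap Inv (- 1) (entry (g1_square u) v) @ map (\<lambda>c. (H, c)) (entry (g1_form u) v)"
| "br3_table E (Lo u) = [(Hi u, 1)]"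
| "br3_table (Lo u) E = [(Hi u, - 1)]"
| "br3_table F (Hi u) = [(Lo u, 1)]"
| "br3_table (Hi u) F = [(Lo u, - 1)]"
| "br3_table H (Lo u) = [(Lo u, - 1)]"
| "br3_table (Lo u) H = [(Lo u, 1)]"
| "br3_table H (Hi u) = [(Hi u, 1)]"
| "br3_table (Hi u) H = [(Hi u, - 1)]"
| "br3_table E F = [(H, 1)]"
| "br3_table F E = [(H, - 1)]"
| "br3_table H E = [(E, - 1)]"
| "br3_table E H = [(E, 1)]"
| "br3_table H F = [(F, 1)]"
| "br3_table F H = [(F, - 1)]"
| "br3_table _ _ = []"

text \<open>Turns a quantifier over basis vectors into a finite conjunction, on which the tables can
  be evaluated by rewriting.\<close>

lemma all_g0: "(\<forall>x. P x) \<longleftrightarrow> P T1 \<and> P T2 \<and> P A1 \<and> P A2 \<and> P A3 \<and> P A4 \<and> P B1 \<and> P B2 \<and> P B3 \<and> P B4"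
  by (metis (full_types) g0.exhaust)

lemma all_g1: "(\<forall>x. P x) \<longleftrightarrow> P U1 \<and> P U2 \<and> P U3 \<and> P U4 \<and> P V1 \<and> P V2 \<and> P V3 \<and> P V4"
  by (metis (full_types) g1.exhaust)

lemma all_brj: "(\<forall>x. P x) \<longleftrightarrow> (\<forall>a. P (Ev a)) \<and> (\<forall>u. P (Od u))"
  by (metis brj_basis.exhaust)

lemma all_br3: "(\<forall>x. P x) \<longleftrightarrow> (\<forall>a. P (Inv a)) \<and> (\<forall>u. P (Lo u)) \<and> (\<forall>u. P (Hi u)) \<and> P F \<and> P H \<and> P E"
  by (metis br3_basis.exhaust)

lemmas table_eval = tmult_def tscale_def tmap_def table_skew_def table_jacobi_def table_cube_def tsign_def

text \<open>Coordinates in the simple roots \<alpha>_1, \<alpha>_2, \<alpha>_3 of br3, carried by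
  \<open>E\<close>, \<open>Lo U1\<close> and \<open>Inv A1\<close>; \<open>g1_root u\<close> is the
  root of \<open>Lo u\<close>, and that of \<open>Hi u\<close> is larger by \<alpha>_1. The roots of
  \<open>g0\<close> have the shape of B2, with \<open>A1\<close>, \<open>A3\<close> short and
  \<open>A2\<close>, \<open>A4\<close> long. In the table, \<open>[A1, B1] = - T1\<close> and
  \<open>T1\<close> kills \<open>A1\<close> and \<open>B1\<close>, and likewise for
  \<open>A3\<close>, \<open>B3\<close> and \<open>T2\<close>: short root vectors span Heisenberg
  algebras, not copies of \<open>sl2\<close> as in so(5). This reflects the zero on the diagonal of
  the Cartan matrix of br3; the simple roots \<open>A2\<close>, \<open>A1\<close> have Cartan matrix
  with rows (2, -1), (-1, 0) after rescaling.\<close>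

primrec g0_root :: "g0 \<Rightarrow> int list" where
  "g0_root T1 = [0, 0, 0]"
| "g0_root T2 = [0, 0, 0]"
| "g0_root A1 = [0, 0, 1]"
| "g0_root A2 = [1, 2, 2]"
| "g0_root A3 = [1, 2, 3]"
| "g0_root A4 = [1, 2, 4]"
| "g0_root B1 = [0, 0, - 1]"
| "g0_root B2 = [- 1, - 2, - 2]"
| "g0_root B3 = [- 1, - 2, - 3]"
| "g0_root B4 = [- 1, - 2, - 4]"

primrec g1_root :: "g1 \<Rightarrow> int list" where
  "g1_root U1 = [0, 1, 0]"
| "g1_root U2 = [0, 1, 1]"
| "g1_root U3 = [0, 1, 2]"
| "g1_root U4 = [1, 3, 4]"
| "g1_root V1 = [- 1, - 1, 0]"
| "g1_root V2 = [- 1, - 1, - 1]"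
| "g1_root V3 = [- 1, - 1, - 2]"
| "g1_root V4 = [- 2, - 3, - 4]"

primrec br3_root :: "br3_basis \<Rightarrow> int list" where
  "br3_root (Inv a) = g0_root a"
| "br3_root (Lo u) = g1_root u"
| "br3_root (Hi u) = map2 (+) [1, 0, 0] (g1_root u)"
| "br3_root F = [- 1, 0, 0]"
| "br3_root H = [0, 0, 0]"
| "br3_root E = [1, 0, 0]"

text \<open>Forgetting the coefficient of \<open>\<alpha>\<^sub>1\<close> identifies \<open>Lo u\<close> with \<open>Hi u\<close>.\<close>

primrec brj_root :: "brj_basis \<Rightarrow> int list" where
  "brj_root (Ev a) = tl (g0_root a)"
| "brj_root (Od u) = tl (g1_root u)"

text \<open>With \<alpha>_1 forgotten, \<alpha>_2 of br3 becomes the odd simple root of brj and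
  \<alpha>_3 the even one.\<close>

abbreviation brj_gens where "brj_gens \<equiv> [Od U1, Od V1, Ev A1, Ev B1]"

abbreviation brj_steps where "brj_steps \<equiv>
    [(Od U1, Od V1, Ev T2), (Od U1, Ev A1, Od U2), (Od V1, Ev B1, Od V2), (Ev A1, Ev B1, Ev T1),
     (Ev A1, Od U2, Od U3), (Ev B1, Od V2, Od V3), (Od U1, Od U3, Ev A2), (Od V1, Od V3, Ev B2),
     (Ev A1, Ev A2, Ev A3), (Ev B1, Ev B2, Ev B3), (Od U2, Ev A3, Od U4), (Od V2, Ev B3, Od V4),
     (Od U3, Od U3, Ev A4), (Od V3, Od V3, Ev B4)]"

text \<open>The root \<alpha>_2 is the lower end of its \<alpha>_1-string and -\<alpha>_2 the upper
  end, so e_2 is taken from the \<open>Lo\<close> vectors and f_2 from the \<open>Hi\<close>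
  vectors. This gives \<open>[Lo U1, F] = 0\<close> and \<open>[E, Hi V1] = 0\<close>, as the
  relations demand.\<close>

abbreviation br3_gens where "br3_gens \<equiv> [E, F, Lo U1, Hi V1, Inv A1, Inv B1]"

text \<open>Each step must be a bracket with a single term. Since \<open>[Lo U1, Hi V1]\<close>
  involves both \<open>Inv T2\<close> and \<open>H\<close>, the vector \<open>Inv T2\<close> is
  reached from \<open>Inv A3\<close> and \<open>Inv B3\<close> instead, at the very end.\<close>

abbreviation br3_steps where "br3_steps \<equiv>
    [(E, F, H), (E, Lo U1, Hi U1), (F, Hi V1, Lo V1), (Lo U1, Inv A1, Lo U2), (Hi V1, Inv B1, Hi V2),
     (Inv A1, Inv B1, Inv T1), (Inv A1, Hi U1, Hi U2), (Inv A1, Lo U2, Lo U3), (Inv B1, Lo V1, Lo V2),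
     (Inv B1, Hi V2, Hi V3), (E, Lo U3, Hi U3), (F, Hi V3, Lo V3), (Lo U1, Hi U3, Inv A2),
     (Hi V1, Lo V3, Inv B2), (Inv A1, Inv A2, Inv A3), (Inv B1, Inv B2, Inv B3), (Lo U2, Inv A3, Lo U4),
     (Hi V2, Inv B3, Hi V4), (Hi U2, Inv A3, Hi U4), (Lo U3, Hi U3, Inv A4), (Lo V2, Inv B3, Lo V4),
     (Hi V3, Lo V3, Inv B4), (Inv A3, Inv B3, Inv T2)]"

section \<open>Verification of the tables\<close>

lemma brj_skew: "table_skew brj_parity brj_table i j"
proof -
  have "\<forall>i j. table_skew brj_parity brj_table i j"
    by (simp add: all_brj all_g0 all_g1 table_eval)
  then show ?thesis by blast
qed

lemma brj_jacobi: "i \<in> set brj_gens \<Longrightarrow> table_jacobi brj_parity brj_table i j k"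
proof -
  have "\<forall>j k. table_jacobi brj_parity brj_table (Od U1) j k" "\<forall>j k. table_jacobi brj_parity brj_table (Od V1) j k"
    "\<forall>j k. table_jacobi brj_parity brj_table (Ev A1) j k" "\<forall>j k. table_jacobi brj_parity brj_table (Ev B1) j k"
    by (simp_all add: all_brj all_g0 all_g1 table_eval)
  then show "i \<in> set brj_gens \<Longrightarrow> table_jacobi brj_parity brj_table i j k" by auto
qed

lemma brj_cube: "table_cube brj_table i"
proof -
  have "\<forall>i. brj_parity i = 1 \<longrightarrow> table_cube brj_table i"
    by (simp add: all_brj all_g0 all_g1 table_eval)
  moreover have "table_cube brj_table (Ev a)" for a
  proof -
    have "\<forall>a. table_cube brj_table (Ev a)" by (simp add: all_g0 table_eval)
    then show ?thesis by blast
  qed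
  ultimately show ?thesis by (cases i) auto
qed

lemma brj_root_add: "z \<in> set (brj_table i j) \<Longrightarrow> brj_root (fst z) = map2 (+) (brj_root i) (brj_root j)"
proof -
  have "\<forall>i j. \<forall>z\<in>set (brj_table i j). brj_root (fst z) = map2 (+) (brj_root i) (brj_root j)"
    by (simp add: all_brj all_g0 all_g1 table_eval)
  then show "z \<in> set (brj_table i j) \<Longrightarrow> ?thesis" by blast
qed

text \<open>Root spaces of nonzero degree are lines, so transitivity has to be checked on basis
  vectors only.\<close>

lemma brj_root_inj: "brj_root b = brj_root b' \<Longrightarrow> b = b' \<or> brj_root b = [0, 0]"
proof -
  have "\<forall>b b'. brj_root b = brj_root b' \<longrightarrow> b = b' \<or> brj_root b = [0, 0]"
    by (simp add: all_brj all_g0 all_g1)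
  then show "brj_root b = brj_root b' \<Longrightarrow> ?thesis" by blast
qed

lemma brj_reached: "reached brj_table brj_gens brj_steps"
  by (simp add: all_brj all_g0 all_g1 table_eval)

lemma br3_skew: "table_skew (\<lambda>_. 0) br3_table i j"
proof -
  have "\<forall>i j. table_skew (\<lambda>_. 0) br3_table i j"
    by (simp add: all_br3 all_g0 all_g1 table_eval)
  then show ?thesis by blast
qed

lemma br3_jacobi_sl2: "\<forall>j k. table_jacobi (\<lambda>_. 0) br3_table E j k" "\<forall>j k. table_jacobi (\<lambda>_. 0) br3_table F j k"
  by (simp_all add: all_br3 all_g0 all_g1 table_eval)

lemma br3_jacobi_g1: "\<forall>j k. table_jacobi (\<lambda>_. 0) br3_table (Lo U1) j k" "\<forall>j k. table_jacobi (\<lambda>_. 0) br3_table (Hi V1) j k"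
  by (simp_all add: all_br3 all_g0 all_g1 table_eval)

lemma br3_jacobi_g0: "\<forall>j k. table_jacobi (\<lambda>_. 0) br3_table (Inv A1) j k" "\<forall>j k. table_jacobi (\<lambda>_. 0) br3_table (Inv B1) j k"
  by (simp_all add: all_br3 all_g0 all_g1 table_eval)

lemma br3_jacobi:
  "i \<in> set br3_gens \<Longrightarrow> table_jacobi (\<lambda>_. 0) br3_table i j k"
  using br3_jacobi_sl2 br3_jacobi_g1 br3_jacobi_g0 by auto

lemma br3_root_add: "z \<in> set (br3_table i j) \<Longrightarrow> br3_root (fst z) = map2 (+) (br3_root i) (br3_root j)"
proof -
  have "\<forall>i j. \<forall>z\<in>set (br3_table i j). br3_root (fst z) = map2 (+) (br3_root i) (br3_root j)"
    by (simp add: all_br3 all_g0 all_g1 table_eval)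
  then show "z \<in> set (br3_table i j) \<Longrightarrow> ?thesis" by blast
qed

lemma br3_root_inj: "br3_root b = br3_root b' \<Longrightarrow> b = b' \<or> br3_root b = [0, 0, 0]"
proof -
  have "\<forall>b b'. br3_root b = br3_root b' \<longrightarrow> b = b' \<or> br3_root b = [0, 0, 0]"
    by (simp add: all_br3 all_g0 all_g1)
  then show "br3_root b = br3_root b' \<Longrightarrow> ?thesis" by blast
qed

lemma br3_reached: "reached br3_table br3_gens br3_steps"
  by (simp add: all_br3 all_g0 all_g1 table_eval)

section \<open>Degrees and heights of roots\<close>

definition degree_of :: "int list \<Rightarrow> (nat \<Rightarrow>\<^sub>0 int)" where
  "degree_of xs = (\<Sum>i<length xs. Poly_Mapping.single i (xs ! i))"

lemma lookup_degree_of: "Poly_Mapping.lookup (degree_of xs) i = (if i < length xs then xs ! i else 0)"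
  by (simp add: degree_of_def lookup_sum lookup_single when_def)

lemma degree_of_add: "length xs = length ys \<Longrightarrow> degree_of (map2 (+) xs ys) = degree_of xs + degree_of ys"
  by (rule poly_mapping_eqI) (simp add: lookup_degree_of lookup_add)

lemma degree_of_inj: "length xs = length ys \<Longrightarrow> degree_of xs = degree_of ys \<Longrightarrow> xs = ys"
  by (rule nth_equalityI) (metis lookup_degree_of)+

lemma degree_of_zero: "degree_of (replicate n 0) = 0"
  by (rule poly_mapping_eqI) (simp add: lookup_degree_of)

definition height :: "nat \<Rightarrow> (nat \<Rightarrow>\<^sub>0 int) \<Rightarrow> int" where
  "height n q = (\<Sum>i<n. Poly_Mapping.lookup q i)"

lemma height_add: "height n (q + r) = height n q + height n r"
  by (simp add: height_def lookup_add sum.distrib)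

lemma height_degree_of: "length xs = n \<Longrightarrow> height n (degree_of xs) = sum_list xs"
  by (simp add: height_def lookup_degree_of sum_list_sum_nth atLeast0LessThan)

text \<open>A sufficient test that looks at the head only: its coefficient is nonzero modulo 3 and
  no later entry can cancel it.\<close>

primrec nonvanishing :: "('b \<times> int) list \<Rightarrow> bool" where
  "nonvanishing [] = False"
| "nonvanishing (x # xs) = (\<not> 3 dvd snd x \<and> fst x \<notin> fst ` set xs)"

text \<open>The sign \<open>sF i\<close> rescales the basis vector chosen for f_i so that the
  bracket of e_i and f_i is exactly the image of h_i.\<close>

primrec gen_image :: "('h \<Rightarrow> ('b \<Rightarrow>\<^sub>0 'k::field)) \<Rightarrow> (nat \<Rightarrow> 'b) \<Rightarrow> (nat \<Rightarrow> 'b) \<Rightarrow> (nat \<Rightarrow> int) \<Rightarrow> 'h generator \<Rightarrow> ('b \<Rightarrow>\<^sub>0 'k)" where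
  "gen_image \<eta> bE bF sF (GenH x) = \<eta> x"
| "gen_image \<eta> bE bF sF (GenE i) = Poly_Mapping.single (bE i) 1"
| "gen_image \<eta> bE bF sF (GenF i) = Poly_Mapping.single (bF i) (of_int (sF i))"

locale table_contragredient = contragredient_data A par R + table_superalgebra p tb gs st T
  for A :: "int mat" and par :: "nat \<Rightarrow> bit" and R :: "('k::field, 'h) realization"
    and p :: "'b \<Rightarrow> bit" and tb gs st and T :: "'b \<Rightarrow> 'b \<Rightarrow> ('b \<Rightarrow>\<^sub>0 'k)" +
  fixes rt :: "'b \<Rightarrow> int list" and bE bF :: "nat \<Rightarrow> 'b" and sF :: "nat \<Rightarrow> int" and \<eta> :: "'h \<Rightarrow> ('b \<Rightarrow>\<^sub>0 'k)"
  assumes rt_length: "length (rt b) = dim_row A"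
    and rt_add: "z \<in> set (tb i j) \<Longrightarrow> rt (fst z) = map2 (+) (rt i) (rt j)"
    and sF: "sF m = 1 \<or> sF m = - 1"
    and gens_degree: "m < dim_row A \<Longrightarrow> degree_of (rt (bE m)) = Poly_Mapping.single m 1"
      "m < dim_row A \<Longrightarrow> degree_of (rt (bF m)) = - Poly_Mapping.single m 1"
    and gens_parity: "m < dim_row A \<Longrightarrow> p (bE m) = par m" "m < dim_row A \<Longrightarrow> p (bF m) = par m"
    and gs: "set gs = bE ` {..<dim_row A} \<union> bF ` {..<dim_row A}"
    and EF: "m < dim_row A \<Longrightarrow> l < dim_row A \<Longrightarrow>
      scale (of_int (sF l)) (T (bE m) (bF l)) = (if m = l then \<eta> (coroot R m) else 0)"
    and \<eta>_add: "x \<in> carrier (cartan_space R) \<Longrightarrow> y \<in> carrier (cartan_space R) \<Longrightarrow>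
      \<eta> (x \<oplus>\<^bsub>cartan_space R\<^esub> y) = \<eta> x + \<eta> y"
    and \<eta>_smult: "x \<in> carrier (cartan_space R) \<Longrightarrow> \<eta> (c \<odot>\<^bsub>cartan_space R\<^esub> x) = scale c (\<eta> x)"
    and \<eta>_keys: "b \<in> Poly_Mapping.keys (\<eta> x) \<Longrightarrow> p b = 0 \<and> rt b = replicate (dim_row A) 0"
    and \<eta>_E: "x \<in> carrier (cartan_space R) \<Longrightarrow> m < dim_row A \<Longrightarrow>
      bil T (\<eta> x) (Poly_Mapping.single (bE m) 1) = scale (simple_root R m x) (Poly_Mapping.single (bE m) 1)"
    and \<eta>_F: "x \<in> carrier (cartan_space R) \<Longrightarrow> m < dim_row A \<Longrightarrow>
      bil T (\<eta> x) (Poly_Mapping.single (bF m) 1) = - scale (simple_root R m x) (Poly_Mapping.single (bF m) 1)"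
    and \<eta>_\<eta>: "bil T (\<eta> x) (\<eta> y) = 0"
    and \<eta>_inj: "x \<in> carrier (cartan_space R) \<Longrightarrow> \<eta> x = 0 \<Longrightarrow> x = \<zero>\<^bsub>cartan_space R\<^esub>"
    and rt_inj: "rt b = rt b' \<Longrightarrow> b = b' \<or> rt b = replicate (dim_row A) 0"
    and lowering: "rt b \<noteq> replicate (dim_row A) 0 \<Longrightarrow>
      \<exists>g\<in>set gs. nonvanishing (tb g b) \<and> \<bar>sum_list (rt g) + sum_list (rt b)\<bar> < \<bar>sum_list (rt b)\<bar>"
begin

abbreviation \<gamma> where "\<gamma> \<equiv> gen_image \<eta> bE bF sF"

lemma F_eq: "v (bF i) = scale (of_int (sF i)) (\<gamma> (GenF i))"
proof -
  have "(of_int (sF i) * of_int (sF i) :: 'k) = 1" using sF[of i] by auto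
  then show ?thesis by simp
qed

lemma gs_image:
  assumes "g \<in> set gs"
  shows "\<exists>y\<in>generators (dim_row A) R. \<exists>c. v g = scale c (\<gamma> y) \<and> word_degree (Letter y) = degree_of (rt g)"
proof -
  from assms consider (E) i where "i < dim_row A" "g = bE i" | (F) i where "i < dim_row A" "g = bF i"
    unfolding gs by blast
  then show ?thesis
  proof cases
    case E
    then show ?thesis using gens_degree(1)[OF E(1)]
      by (intro bexI[of _ "GenE i"] exI[of _ 1]) auto
  next
    case F
    then show ?thesis using gens_degree(2)[OF F(1)] F_eq[of i]
      by (intro bexI[of _ "GenF i"] exI[of _ "of_int (sF i)"]) (auto simp del: gen_image.simps)
  qed
qed

sublocale contragredient_model A par R p T "\<lambda>b. degree_of (rt b)" \<gamma> "\<lambda>q. nat \<bar>height (dim_row A) q\<bar>"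
proof
  show "p b = p u + p w" if "b \<in> Poly_Mapping.keys (T u w)" for b u w
    using T_parity[OF that] .
  show "degree_of (rt b) = degree_of (rt u) + degree_of (rt w)" if "b \<in> Poly_Mapping.keys (T u w)" for b u w
  proof -
    have "b \<in> fst ` set (tb u w)" using that unfolding T_def by (rule subsetD[OF keys_lin])
    then obtain z where "z \<in> set (tb u w)" "b = fst z" by blast
    then show ?thesis using rt_add[of z u w] degree_of_add[of "rt u" "rt w"] rt_length by simp
  qed
  show "lie_relators alg \<subseteq> {0}" by (rule lie)
  show "p b = gen_parity par z" if "z \<in> gens" "b \<in> Poly_Mapping.keys (\<gamma> z)" for z b
    using that \<eta>_keys gens_parity by (cases z) (auto split: if_splits)
  show "degree_of (rt b) = word_degree (Letter z)" if "z \<in> gens" "b \<in> Poly_Mapping.keys (\<gamma> z)" for z b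
    using that \<eta>_keys gens_degree degree_of_zero by (cases z) (auto split: if_splits)
  show "\<gamma> (GenH (x \<oplus>\<^bsub>h\<^esub> y)) = \<gamma> (GenH x) + \<gamma> (GenH y)" if "x \<in> carrier h" "y \<in> carrier h" for x y
    using \<eta>_add[OF that] by simp
  show "\<gamma> (GenH (c \<odot>\<^bsub>h\<^esub> x)) = scale c (\<gamma> (GenH x))" if "x \<in> carrier h" for x c
    using \<eta>_smult[OF that] by simp
  show "br (\<gamma> (GenE i)) (\<gamma> (GenF j)) = (if i = j then \<gamma> (GenH (coroot R i)) else 0)"
    if "i < dim_row A" "j < dim_row A" for i j
    using EF[OF that] by simp
  show "br (\<gamma> (GenH x)) (\<gamma> (GenE j)) = scale (simple_root R j x) (\<gamma> (GenE j))"
    if "x \<in> carrier h" "j < dim_row A" for x j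
    using \<eta>_E[OF that] by simp
  show "br (\<gamma> (GenH x)) (\<gamma> (GenF j)) = - scale (simple_root R j x) (\<gamma> (GenF j))"
    if "x \<in> carrier h" "j < dim_row A" for x j
  proof -
    have "\<gamma> (GenF j) = scale (of_int (sF j)) (v (bF j))" by simp
    then have "br (\<gamma> (GenH x)) (\<gamma> (GenF j)) = scale (of_int (sF j)) (br (\<eta> x) (v (bF j)))"
      by (simp only: gen_image.simps bil_simps)
    also have "\<dots> = - scale (simple_root R j x) (scale (of_int (sF j)) (v (bF j)))"
      unfolding \<eta>_F[OF that] by (simp add: mult.commute)
    finally show ?thesis by simp
  qed
  show "br (\<gamma> (GenH x)) (\<gamma> (GenH y)) = 0" for x y by (simp add: \<eta>_\<eta>)
  show "x = \<zero>\<^bsub>h\<^esub>" if "x \<in> carrier h" "\<gamma> (GenH x) = 0" for x using \<eta>_inj that by simp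
  show "v b \<in> U"
    if "\<And>a b. a \<in> U \<Longrightarrow> b \<in> U \<Longrightarrow> a + b \<in> U" and scl: "\<And>c a. a \<in> U \<Longrightarrow> scale c a \<in> U"
      and mult: "\<And>a b. a \<in> U \<Longrightarrow> b \<in> U \<Longrightarrow> br a b \<in> U" and gen: "\<And>x. x \<in> gens \<Longrightarrow> \<gamma> x \<in> U" for U b
  proof (rule generated[OF scl mult])
    fix i assume "i \<in> set gs"
    from gs_image[OF this] obtain y c where "y \<in> gens" "v i = scale c (\<gamma> y)" by blast
    then show "v i \<in> U" using scl[OF gen] by metis
  qed
  show "\<exists>y\<in>gens. br (\<gamma> y) g \<noteq> 0 \<and> nat \<bar>height (dim_row A) (word_degree (Letter y) + q)\<bar> < nat \<bar>height (dim_row A) q\<bar>"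
    if nz: "g \<noteq> 0" and q: "\<And>b. b \<in> Poly_Mapping.keys g \<Longrightarrow> degree_of (rt b) = q" "q \<noteq> 0" for g q
  proof -
    obtain b where b: "b \<in> Poly_Mapping.keys g" using nz by (metis keys_eq_empty ex_in_conv)
    have qb: "q = degree_of (rt b)" using q(1)[OF b] by simp
    have rb: "rt b \<noteq> replicate (dim_row A) 0" using q(2) qb degree_of_zero by metis
    \<comment> \<open>By \<open>rt_inj\<close> the part of degree \<open>q\<close> is a line, so
      \<open>g\<close> is a multiple of \<open>v b\<close> and a single table entry decides whether
      a bracket with it vanishes.\<close>
    have "b' = b" if "b' \<in> Poly_Mapping.keys g" for b'
      using q(1)[OF that] rt_inj[of b b'] rb degree_of_inj[of "rt b'" "rt b"] rt_length qb by metis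
    then have "Poly_Mapping.keys g = {b}" using b by blast
    then have g: "g = scale (Poly_Mapping.lookup g b) (v b)"
      by (intro poly_mapping_eqI) (auto simp: lookup_single when_def in_keys_iff)
    have c: "Poly_Mapping.lookup g b \<noteq> 0" using b by (simp add: in_keys_iff)
    from lowering[OF rb] obtain a where a: "a \<in> set gs" "nonvanishing (tb a b)"
      "\<bar>sum_list (rt a) + sum_list (rt b)\<bar> < \<bar>sum_list (rt b)\<bar>" by blast
    from gs_image[OF a(1)] obtain y d where y: "y \<in> gens" "v a = scale d (\<gamma> y)"
      "word_degree (Letter y) = degree_of (rt a)" by blast
    have "T a b \<noteq> 0"
    proof (cases "tb a b")
      case (Cons z zs)
      obtain k m where z: "z = (k, m)" by force
      show ?thesis unfolding T_def Cons z by (rule lin_nonzero[OF char3]) (use a(2) Cons z in auto)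
    qed (use a(2) in simp)
    moreover have "T a b = scale d (br (\<gamma> y) (v b))"
      using arg_cong[OF y(2), of "\<lambda>x. br x (v b)"] by simp
    ultimately have "br (\<gamma> y) (v b) \<noteq> 0" by auto
    then have "br (\<gamma> y) g \<noteq> 0" using c by (subst g) (simp del: scale_single)
    moreover have "nat \<bar>height (dim_row A) (word_degree (Letter y) + q)\<bar> < nat \<bar>height (dim_row A) q\<bar>"
      unfolding y(3) qb height_add height_degree_of[OF rt_length] using a(3) by simp
    ultimately show ?thesis using y(1) by blast
  qed
qed

end

text \<open>Full rank gives the Cartan space dimension 2n - n = n, so the coroots are a basis of it.
  For the last claim, let \<open>x\<close> be the combination of the coroots with coefficient vector
  \<open>w\<close>: if all simple roots vanish on \<open>x\<close>, then the transposed Cartan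
  matrix kills \<open>w\<close>, so \<open>w = 0\<close>. Cartan elements may therefore be described
  by the values of the simple roots on them, which yields injectivity of the map to the
  model.\<close>

lemma realizes_nondegenerate:
  fixes R :: "('k::field, 'h) realization"
  assumes R: "realizes A R" and n: "n = dim_row A" and det: "det (map_mat of_int A :: 'k mat) \<noteq> 0"
  shows "vectorspace class_ring (cartan_space R)" "\<And>i. i < n \<Longrightarrow> coroot R i \<in> carrier (cartan_space R)"
    "\<And>j x y. j < n \<Longrightarrow> x \<in> carrier (cartan_space R) \<Longrightarrow> y \<in> carrier (cartan_space R) \<Longrightarrow>
      simple_root R j (x \<oplus>\<^bsub>cartan_space R\<^esub> y) = simple_root R j x + simple_root R j y"
    "\<And>j c x. j < n \<Longrightarrow> x \<in> carrier (cartan_space R) \<Longrightarrow>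
      simple_root R j (c \<odot>\<^bsub>cartan_space R\<^esub> x) = c * simple_root R j x"
    "\<And>i j. i < n \<Longrightarrow> j < n \<Longrightarrow> simple_root R j (coroot R i) = of_int (A $$ (i, j))"
    "\<And>x. x \<in> carrier (cartan_space R) \<Longrightarrow> (\<And>j. j < n \<Longrightarrow> simple_root R j x = 0) \<Longrightarrow> x = \<zero>\<^bsub>cartan_space R\<^esub>"
proof -
  let ?h = "cartan_space R" and ?A = "map_mat of_int A :: 'k mat"
  from R n have A: "A \<in> carrier_mat n n" and vs: "vectorspace class_ring ?h" and fin: "vectorspace.fin_dim class_ring ?h"
    and dim: "vectorspace.dim class_ring ?h = 2 * n - vec_space.rank n ?A"
    and co: "coroot R ` {..<n} \<subseteq> carrier ?h" and inj: "inj_on (coroot R) {..<n}"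
    and li: "\<not> LinearCombinations.module.lin_dep class_ring ?h (coroot R ` {..<n})"
    and add: "\<forall>j<n. \<forall>x \<in> carrier ?h. \<forall>y \<in> carrier ?h. simple_root R j (x \<oplus>\<^bsub>?h\<^esub> y) = simple_root R j x + simple_root R j y"
    and smult: "\<forall>j<n. \<forall>c. \<forall>x \<in> carrier ?h. simple_root R j (c \<odot>\<^bsub>?h\<^esub> x) = c * simple_root R j x"
    and cartan: "\<forall>i<n. \<forall>j<n. simple_root R j (coroot R i) = ?A $$ (i, j)"
    unfolding realizes_def Let_def by auto
  interpret h: vectorspace class_ring ?h by (rule vs)
  have A': "?A \<in> carrier_mat n n" using A by simp
  show "vectorspace class_ring ?h" by (rule vs)
  show co': "coroot R i \<in> carrier ?h" if "i < n" for i using co that by blast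
  show add': "simple_root R j (x \<oplus>\<^bsub>?h\<^esub> y) = simple_root R j x + simple_root R j y"
    if "j < n" "x \<in> carrier ?h" "y \<in> carrier ?h" for j x y using add that by blast
  show smult': "simple_root R j (c \<odot>\<^bsub>?h\<^esub> x) = c * simple_root R j x" if "j < n" "x \<in> carrier ?h" for j c x
    using smult that by blast
  show cartan': "simple_root R j (coroot R i) = of_int (A $$ (i, j))" if "i < n" "j < n" for i j
    using cartan A that by simp
  show "x = \<zero>\<^bsub>?h\<^esub>" if x: "x \<in> carrier ?h" and zero: "\<And>j. j < n \<Longrightarrow> simple_root R j x = 0" for x
  proof -
    let ?B = "coroot R ` {..<n}"
    have "vec_space.rank n ?A = n" using vec_space.det_rank_iff[OF A'] det by blast
    then have "card ?B = h.dim" using dim inj by (simp add: card_image)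
    then have "h.basis ?B" using h.dim_li_is_basis[OF fin _ co] li by simp
    then have "x \<in> h.span ?B" using x unfolding h.basis_def by blast
    then obtain c where c: "x = h.lincomb c ?B" "c \<in> ?B \<rightarrow> UNIV"
      using h.finite_span[of ?B] co by (auto simp: class_ring_simps)
    have sm: "a \<odot>\<^bsub>?h\<^esub> u \<in> carrier ?h" if "u \<in> carrier ?h" for a u
      using h.smult_closed[of a u] that by (simp add: class_ring_simps)
    have lin: "h.lincomb c F \<in> carrier ?h \<and> simple_root R j (h.lincomb c F) = (\<Sum>u\<in>F. c u * simple_root R j u)"
      if "finite F" "F \<subseteq> carrier ?h" "j < n" for F j
      using that
    proof (induction F rule: finite_induct)
      case empty
      have "0 \<odot>\<^bsub>?h\<^esub> \<zero>\<^bsub>?h\<^esub> = \<zero>\<^bsub>?h\<^esub>" using h.lmult_0[of "\<zero>\<^bsub>?h\<^esub>"] by (simp add: class_ring_simps)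
      then have "simple_root R j \<zero>\<^bsub>?h\<^esub> = 0" using smult'[OF empty(2) h.M.zero_closed, of 0] by simp
      then show ?case by (simp add: h.lincomb_def)
    next
      case (insert u F)
      have "h.lincomb c (insert u F) = (c u \<odot>\<^bsub>?h\<^esub> u) \<oplus>\<^bsub>?h\<^esub> h.lincomb c F"
        unfolding h.lincomb_def using insert.hyps insert.prems sm by (intro h.M.finsum_insert) auto
      then show ?case using insert sm add' smult' by simp
    qed
    define w where "w = vec n (\<lambda>i. c (coroot R i))"
    have w: "w \<in> carrier_vec n" by (simp add: w_def)
    have "transpose_mat ?A *\<^sub>v w = 0\<^sub>v n"
    proof (rule eq_vecI)
      fix j assume "j < dim_vec (0\<^sub>v n)"
      then have j: "j < n" by simp
      have "0 = simple_root R j x" using zero[OF j] by simp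
      also have "\<dots> = (\<Sum>u\<in>?B. c u * simple_root R j u)" using lin[OF _ co j] c(1) by simp
      also have "\<dots> = (\<Sum>i<n. c (coroot R i) * simple_root R j (coroot R i))"
        by (rule sum.reindex_cong[OF inj refl refl])
      also have "\<dots> = (transpose_mat ?A *\<^sub>v w) $ j"
        using j A' cartan' A by (simp add: w_def scalar_prod_def atLeast0LessThan mult.commute)
      finally show "(transpose_mat ?A *\<^sub>v w) $ j = 0\<^sub>v n $ j" using j by simp
    qed (use A' in simp)
    moreover have "det (transpose_mat ?A) \<noteq> 0" using det det_transpose[OF A'] by simp
    ultimately have "w = 0\<^sub>v n"
      using det_0_iff_vec_prod_zero_field[of "transpose_mat ?A" n] A' w by auto
    then have c0: "c u = 0" if "u \<in> ?B" for u
      using that unfolding w_def by (auto simp: vec_eq_iff)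
    have "h.lincomb c F = \<zero>\<^bsub>?h\<^esub>" if "finite F" "F \<subseteq> ?B" for F
      using that
    proof (induction F rule: finite_induct)
      case empty
      then show ?case by (simp add: h.lincomb_def)
    next
      case (insert u F)
      have u: "u \<in> carrier ?h" "c u = 0" using insert.prems co c0 by auto
      have "h.lincomb c (insert u F) = (c u \<odot>\<^bsub>?h\<^esub> u) \<oplus>\<^bsub>?h\<^esub> h.lincomb c F"
        unfolding h.lincomb_def
        using insert.hyps sm u(1) subsetD[OF co subsetD[OF insert.prems]] by (intro h.M.finsum_insert) auto
      also have "c u \<odot>\<^bsub>?h\<^esub> u = \<zero>\<^bsub>?h\<^esub>" using h.lmult_0[OF u(1)] u(2) by (simp add: class_ring_simps)
      finally show ?case using insert by simp
    qed
    then show ?thesis using c(1) by simp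
  qed
qed

section \<open>The two contragredient superalgebras\<close>

text \<open>A certificate of generation ends with a list that contains every basis vector.\<close>

lemma reached_finite: "reached tb known st \<Longrightarrow> finite (UNIV :: 'b set)" for tb :: "'b \<Rightarrow> 'b \<Rightarrow> ('b \<times> int) list"
proof (induction st arbitrary: known)
  case Nil
  then have "UNIV \<subseteq> set known" by auto
  then show ?case by (rule finite_subset) simp
next
  case (Cons s st)
  then show ?case by (cases s) auto
qed

lemma pm_lie_superalgebra:
  fixes T :: "'b \<Rightarrow> 'b \<Rightarrow> ('b \<Rightarrow>\<^sub>0 'k::field)"
  assumes "lie_relators (pm_superalgebra UNIV p T) \<subseteq> {0}"
    and parity: "\<And>b i j. b \<in> Poly_Mapping.keys (T i j) \<Longrightarrow> p b = p i + p j"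
  shows "lie_superalgebra (pm_superalgebra UNIV p T)"
  unfolding lie_superalgebra_def
proof (intro conjI allI ballI)
  let ?G = "pm_superalgebra UNIV p T"
  show vs: "vectorspace class_ring ?G" by (rule pm_vectorspace)
  show "subspace class_ring (homog ?G q) ?G" for q
    using vs unfolding subspace_def submodule_def
    by (auto simp: vectorspace_def class_ring_simps dest!: subsetD[OF keys_add] subsetD[OF keys_scale])
  show "homog ?G 0 \<inter> homog ?G 1 = {\<zero>\<^bsub>?G\<^esub>}"
  proof
    show "homog ?G 0 \<inter> homog ?G 1 \<subseteq> {\<zero>\<^bsub>?G\<^esub>}"
    proof
      fix a assume "a \<in> homog ?G 0 \<inter> homog ?G 1"
      then have "Poly_Mapping.keys a = {}" by fastforce
      then show "a \<in> {\<zero>\<^bsub>?G\<^esub>}" by simp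
    qed
  qed simp
  show "homog ?G 0 <+>\<^bsub>?G\<^esub> homog ?G 1 = carrier ?G"
  proof
    show "carrier ?G \<subseteq> homog ?G 0 <+>\<^bsub>?G\<^esub> homog ?G 1"
    proof
      fix a assume "a \<in> carrier ?G"
      have "a = pm_filter (\<lambda>b. p b = 0) a + pm_filter (\<lambda>b. p b = 1) a"
        by (rule poly_mapping_eqI) (simp add: lookup_add)
      moreover have "pm_filter (\<lambda>b. p b = q) a \<in> homog ?G q" for q by (simp add: keys_pm_filter)
      ultimately show "a \<in> homog ?G 0 <+>\<^bsub>?G\<^esub> homog ?G 1"
        unfolding set_add_def' pm_superalgebra_simps(4) by blast
    qed
  qed simp
  show "(\<lambda>y. x \<otimes>\<^bsub>?G\<^esub> y) \<in> LinearCombinations.module_hom class_ring ?G ?G"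
    "(\<lambda>y. y \<otimes>\<^bsub>?G\<^esub> x) \<in> LinearCombinations.module_hom class_ring ?G ?G" for x
    by (simp_all add: LinearCombinations.module_hom_def)
  show "x \<otimes>\<^bsub>?G\<^esub> y \<in> homog ?G (q + r)" if "x \<in> homog ?G q" "y \<in> homog ?G r" for q r x y
    using that by (auto simp: parity dest!: subsetD[OF keys_bil])
  show "lie_relators ?G \<subseteq> {\<zero>\<^bsub>?G\<^esub>}" using assms(1) by simp
qed

lemma char3_numerals:
  assumes "CHAR('k::field) = 3" shows "(3::'k) = 0" "(2::'k) = - 1"
proof -
  show three: "(3::'k) = 0" using of_nat_CHAR[where 'a = 'k] assms by simp
  have "(2::'k) = 3 - 1" by simp
  then show "(2::'k) = - 1" using three by simp
qed

lemma det_nonzero_if_inverse: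
  fixes A B :: "'k::field mat"
  assumes "A \<in> carrier_mat n n" "B \<in> carrier_mat n n" "A * B = 1\<^sub>m n"
  shows "det A \<noteq> 0"
  using det_mult[OF assms(1,2)] assms(3) by auto

subsection \<open>The algebra \<open>br\<^sub>3\<close>\<close>

text \<open>The weights of \<open>E\<close>, \<open>Lo U1\<close> and \<open>Inv A1\<close> under
  \<open>H\<close>, \<open>Inv T1\<close>, \<open>Inv T2\<close> are (-1,0,0), (-1,1,0) and (0,0,1).
  The coefficients solve the linear system saying that the image of \<open>x\<close> acts on these
  three vectors by the three simple roots.\<close>

definition br3_cartan :: "('k::field, 'h) realization \<Rightarrow> 'h \<Rightarrow> (br3_basis \<Rightarrow>\<^sub>0 'k)" where
  "br3_cartan R x = Poly_Mapping.single H (- simple_root R 0 x)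
     + Poly_Mapping.single (Inv T1) (simple_root R 1 x - simple_root R 0 x)
     + Poly_Mapping.single (Inv T2) (simple_root R 2 x)"

definition br3_E :: "nat \<Rightarrow> br3_basis" where
  "br3_E i = (if i = 0 then E else if i = 1 then Lo U1 else Inv A1)"

definition br3_F :: "nat \<Rightarrow> br3_basis" where
  "br3_F i = (if i = 0 then F else if i = 1 then Hi V1 else Inv B1)"

lemma lessThan_3: "{..<3::nat} = {0, 1, 2}" and lessThan_2: "{..<2::nat} = {0, 1}"
  by auto

lemma less_3_cases: "m < (3::nat) \<Longrightarrow> m = 0 \<or> m = 1 \<or> m = 2" and less_2_cases: "m < (2::nat) \<Longrightarrow> m = 0 \<or> m = 1"
  by auto

lemma degree_of_unit:
  "degree_of [1, 0, 0] = Poly_Mapping.single 0 1" "degree_of [0, 1, 0] = Poly_Mapping.single 1 1"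
  "degree_of [0, 0, 1] = Poly_Mapping.single 2 1" "degree_of [- 1, 0, 0] = - Poly_Mapping.single 0 1"
  "degree_of [0, - 1, 0] = - Poly_Mapping.single 1 1" "degree_of [0, 0, - 1] = - Poly_Mapping.single 2 1"
  "degree_of [1, 0] = Poly_Mapping.single 0 1" "degree_of [0, 1] = Poly_Mapping.single 1 1"
  "degree_of [- 1, 0] = - Poly_Mapping.single 0 1" "degree_of [0, - 1] = - Poly_Mapping.single 1 1"
  by (simp_all add: degree_of_def eval_nat_numeral single_uminus)

lemma br3_table_superalgebra:
  assumes "CHAR('k::field) = 3"
  shows "table_superalgebra (\<lambda>_. 0) br3_table br3_gens br3_steps (tconst br3_table :: _ \<Rightarrow> _ \<Rightarrow> (_ \<Rightarrow>\<^sub>0 'k))"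
  by (rule table_superalgebra.intro[OF assms refl _ br3_skew br3_jacobi _ br3_reached]) simp_all

lemma br3_det:
  assumes char: "CHAR('k::field) = 3" shows "det (map_mat of_int br3_matrix :: 'k mat) \<noteq> 0"
proof (rule det_nonzero_if_inverse)
  \<comment> \<open>An inverse modulo 3 only; over the integers the determinant of the Cartan matrix
    is -2.\<close>
  let ?B = "mat_of_rows_list 3 [[- 1, 0, 1], [0, 0, - 1], [1, - 1, 0]] :: 'k mat"
  let ?A = "map_mat of_int br3_matrix :: 'k mat"
  show A: "?A \<in> carrier_mat 3 3" and B: "?B \<in> carrier_mat 3 3"
    by (auto simp: br3_matrix_def mat_of_rows_list_def)
  show "?A * ?B = 1\<^sub>m 3"
  proof (rule eq_matI)
    fix i j :: nat assume "i < dim_row (1\<^sub>m 3 :: 'k mat)" "j < dim_col (1\<^sub>m 3 :: 'k mat)"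
    then have ij: "i < 3" "j < 3" by simp_all
    have "(?A * ?B) $$ (i, j) = (\<Sum>k\<in>{..<3}. ?A $$ (i, k) * ?B $$ (k, j))"
      using A B ij by (simp add: scalar_prod_def atLeast0LessThan)
    also have "\<dots> = (1\<^sub>m 3) $$ (i, j)"
      using less_3_cases[OF ij(1)] less_3_cases[OF ij(2)] unfolding lessThan_3
      by (elim disjE; simp add: br3_matrix_def mat_of_rows_list_def char3_numerals[OF char])
    finally show "(?A * ?B) $$ (i, j) = (1\<^sub>m 3) $$ (i, j)" .
  qed (use A B in simp_all)
qed

lemma br3_entries:
  "dim_row br3_matrix = 3" "br3_matrix $$ (0, 0) = 2" "br3_matrix $$ (0, 1) = - 1" "br3_matrix $$ (0, 2) = 0"
  "br3_matrix $$ (1, 0) = - 1" "br3_matrix $$ (1, 1) = 2" "br3_matrix $$ (1, 2) = - 1"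
  "br3_matrix $$ (2, 0) = 0" "br3_matrix $$ (2, 1) = - 1" "br3_matrix $$ (2, 2) = 0"
  by (simp_all add: br3_matrix_def mat_of_rows_list_def)

lemma br3_root_length: "length (br3_root b) = 3"
proof -
  have "\<forall>b. length (br3_root b) = 3" by (simp add: all_br3 all_g0 all_g1)
  then show ?thesis by blast
qed

lemma br3_lowering:
  "br3_root b \<noteq> [0, 0, 0] \<Longrightarrow>
    \<exists>g\<in>set br3_gens. nonvanishing (br3_table g b) \<and> \<bar>sum_list (br3_root g) + sum_list (br3_root b)\<bar> < \<bar>sum_list (br3_root b)\<bar>"
proof -
  have "\<forall>b. br3_root b \<noteq> [0, 0, 0] \<longrightarrow>
    (\<exists>g\<in>set br3_gens. nonvanishing (br3_table g b) \<and> \<bar>sum_list (br3_root g) + sum_list (br3_root b)\<bar> < \<bar>sum_list (br3_root b)\<bar>)"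
    by (simp add: all_br3 all_g0 all_g1 tmap_def)
  then show "br3_root b \<noteq> [0, 0, 0] \<Longrightarrow> ?thesis" by blast
qed

text \<open>The sign of f_2: the table has \<open>[Lo U1, Hi V1] = Inv T2 - H\<close>, whereas the
  second coroot, with root values -1, 2, -1, is mapped to \<open>H - Inv T2\<close>, its coefficient
  3 at \<open>Inv T1\<close> being 0.\<close>

lemma br3_table_contragredient:
  fixes R :: "('k::field, 'h) realization"
  assumes char: "CHAR('k) = 3" and R: "realizes br3_matrix R"
  shows "table_contragredient br3_matrix (\<lambda>_. 0) R (\<lambda>_. 0) br3_table br3_gens br3_steps (tconst br3_table)
    br3_root br3_E br3_F (\<lambda>i. if i = 1 then - 1 else 1) (br3_cartan R)"
proof -
  note real = realizes_nondegenerate[OF R br3_entries(1)[symmetric] br3_det[OF char]]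
  note num = char3_numerals[OF char]
  have r: "replicate (dim_row br3_matrix) (0::int) = [0, 0, 0]" by (simp add: br3_entries(1) numeral_3_eq_3)
  have real5: "simple_root R j (coroot R i) = of_int (br3_matrix $$ (i, j))" if "i < 3" "j < 3" for i j
    using real(5) that .
  have roots: "simple_root R 0 (coroot R 0) = 2" "simple_root R 1 (coroot R 0) = - 1" "simple_root R 2 (coroot R 0) = 0"
    "simple_root R 0 (coroot R 1) = - 1" "simple_root R 1 (coroot R 1) = 2" "simple_root R 2 (coroot R 1) = - 1"
    "simple_root R 0 (coroot R 2) = 0" "simple_root R 1 (coroot R 2) = - 1" "simple_root R 2 (coroot R 2) = 0"
    by (simp_all add: real5 br3_entries del: One_nat_def)
  show ?thesis
  proof (rule table_contragredient.intro[OF contragredient_data.intro br3_table_superalgebra[OF char]], goal_cases)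
    case 1 show ?case by (rule real(1))
  next
    case (2 i) then show ?case using real(2) br3_entries(1) by simp
  next
    case 3
    show ?case
      unfolding table_contragredient_axioms_def r unfolding br3_entries(1)
    proof (intro conjI allI impI)
      fix m l :: nat assume ml: "m < 3" "l < 3"
      show "scale (of_int (if l = 1 then - 1 else 1)) (lin (br3_table (br3_E m) (br3_F l))) =
        (if m = l then br3_cartan R (coroot R m) else (0 :: br3_basis \<Rightarrow>\<^sub>0 'k))"
        using less_3_cases[OF ml(1)] less_3_cases[OF ml(2)]
        by (elim disjE; simp add: br3_E_def br3_F_def br3_cartan_def tmap_def roots num single_uminus del: One_nat_def)
    next
      fix x m assume x: "x \<in> carrier (cartan_space R)" and m: "m < (3::nat)"
      show "bil (tconst br3_table) (br3_cartan R x) (Poly_Mapping.single (br3_E m) 1) =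
          scale (simple_root R m x) (Poly_Mapping.single (br3_E m) (1::'k))"
        "bil (tconst br3_table) (br3_cartan R x) (Poly_Mapping.single (br3_F m) 1) =
          - scale (simple_root R m x) (Poly_Mapping.single (br3_F m) (1::'k))"
        using less_3_cases[OF m]
        by (elim disjE; simp add: br3_E_def br3_F_def br3_cartan_def tmap_def single_add[symmetric] single_uminus[symmetric])+
    next
      fix x assume x: "x \<in> carrier (cartan_space R)" and z: "br3_cartan R x = 0"
      have "Poly_Mapping.lookup (br3_cartan R x) b = 0" for b using z by simp
      from this[of H] this[of "Inv T1"] this[of "Inv T2"]
      have "simple_root R 0 x = 0 \<and> simple_root R 1 x = 0 \<and> simple_root R 2 x = 0"
        by (simp add: br3_cartan_def lookup_add lookup_single)
      then show "x = \<zero>\<^bsub>cartan_space R\<^esub>" using real(6)[OF x] less_3_cases by metis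
    next
      fix m :: nat assume m: "m < 3"
      show "degree_of (br3_root (br3_E m)) = Poly_Mapping.single m 1" "degree_of (br3_root (br3_F m)) = - Poly_Mapping.single m 1"
        using less_3_cases[OF m] by (elim disjE; simp add: br3_E_def br3_F_def degree_of_unit)+
    next
      fix b x assume "b \<in> Poly_Mapping.keys (br3_cartan R x)"
      then show "br3_root b = [0, 0, 0]"
        by (auto simp: br3_cartan_def in_keys_iff lookup_add lookup_single when_def split: if_splits)
    next
      fix x y assume xy: "x \<in> carrier (cartan_space R)" "y \<in> carrier (cartan_space R)"
      show "br3_cartan R (x \<oplus>\<^bsub>cartan_space R\<^esub> y) = br3_cartan R x + br3_cartan R y"
        by (rule poly_mapping_eqI)
          (simp add: br3_cartan_def lookup_add lookup_single when_def real(3) xy)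
    next
      fix c x assume x: "x \<in> carrier (cartan_space R)"
      show "br3_cartan R (c \<odot>\<^bsub>cartan_space R\<^esub> x) = scale c (br3_cartan R x)"
        by (rule poly_mapping_eqI)
          (simp add: br3_cartan_def lookup_add lookup_single when_def real(4) x algebra_simps)
    next
      show "set br3_gens = br3_E ` {..<3} \<union> br3_F ` {..<3}"
        unfolding lessThan_3 by (auto simp: br3_E_def br3_F_def)
    next
      fix x y show "bil (tconst br3_table) (br3_cartan R x) (br3_cartan R y) = 0"
        by (simp add: br3_cartan_def tmap_def)
    next
      show "length (br3_root b) = 3" for b by (rule br3_root_length)
      show "br3_root (fst z) = map2 (+) (br3_root i) (br3_root j)" if "z \<in> set (br3_table i j)" for z i j
        by (rule br3_root_add[OF that])
      show "b = b' \<or> br3_root b = [0, 0, 0]" if "br3_root b = br3_root b'" for b b'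
        by (rule br3_root_inj[OF that])
      show "\<exists>g\<in>set br3_gens. nonvanishing (br3_table g b) \<and>
          \<bar>sum_list (br3_root g) + sum_list (br3_root b)\<bar> < \<bar>sum_list (br3_root b)\<bar>" if "br3_root b \<noteq> [0, 0, 0]" for b
        by (rule br3_lowering[OF that])
    qed simp_all
  qed
qed

subsection \<open>The superalgebra \<open>brj\<^sub>2\<^sub>;\<^sub>3\<close>\<close>

text \<open>\<open>T1\<close> and \<open>T2\<close> are dual to the simple roots: the weights of
  \<open>Od U1\<close> and \<open>Ev A1\<close> are (1,0) and (0,1).\<close>

definition brj_cartan :: "('k::field, 'h) realization \<Rightarrow> 'h \<Rightarrow> (brj_basis \<Rightarrow>\<^sub>0 'k)" where
  "brj_cartan S x = Poly_Mapping.single (Ev T1) (simple_root S 0 x) + Poly_Mapping.single (Ev T2) (simple_root S 1 x)"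

definition brj_E :: "nat \<Rightarrow> brj_basis" where
  "brj_E i = (if i = 0 then Od U1 else Ev A1)"

definition brj_F :: "nat \<Rightarrow> brj_basis" where
  "brj_F i = (if i = 0 then Od V1 else Ev B1)"

lemma brj_table_superalgebra:
  assumes "CHAR('k::field) = 3"
  shows "table_superalgebra brj_parity brj_table brj_gens brj_steps (tconst brj_table :: _ \<Rightarrow> _ \<Rightarrow> (_ \<Rightarrow>\<^sub>0 'k))"
proof (rule table_superalgebra.intro[OF assms refl _ brj_skew brj_jacobi brj_cube brj_reached])
  show "brj_parity (fst k) = brj_parity i + brj_parity j" if "k \<in> set (brj_table i j)" for k i j
    using that by (cases i; cases j) (auto simp: tmap_def)
qed

lemma brj_entries:
  "dim_row brj23_matrix = 2" "brj23_matrix $$ (0, 0) = 0" "brj23_matrix $$ (0, 1) = - 1"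
  "brj23_matrix $$ (1, 0) = - 1" "brj23_matrix $$ (1, 1) = 0"
  by (simp_all add: brj23_matrix_def mat_of_rows_list_def)

lemma brj_det: "det (map_mat of_int brj23_matrix :: 'k::field mat) \<noteq> 0"
proof (rule det_nonzero_if_inverse)
  let ?A = "map_mat of_int brj23_matrix :: 'k mat"
  show A: "?A \<in> carrier_mat 2 2" "?A \<in> carrier_mat 2 2"
    by (auto simp: brj23_matrix_def mat_of_rows_list_def)
  show "?A * ?A = 1\<^sub>m 2"
  proof (rule eq_matI)
    fix i j :: nat assume "i < dim_row (1\<^sub>m 2 :: 'k mat)" "j < dim_col (1\<^sub>m 2 :: 'k mat)"
    then have ij: "i < 2" "j < 2" by simp_all
    have "(?A * ?A) $$ (i, j) = (\<Sum>k\<in>{..<2}. ?A $$ (i, k) * ?A $$ (k, j))"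
      using A ij by (simp add: scalar_prod_def atLeast0LessThan)
    also have "\<dots> = (1\<^sub>m 2) $$ (i, j)"
      using less_2_cases[OF ij(1)] less_2_cases[OF ij(2)] unfolding lessThan_2
      by (elim disjE; simp add: brj23_matrix_def mat_of_rows_list_def)
    finally show "(?A * ?A) $$ (i, j) = (1\<^sub>m 2) $$ (i, j)" .
  qed (use A in simp_all)
qed

lemma brj_root_length: "length (brj_root b) = 2"
proof -
  have "\<forall>b. length (brj_root b) = 2" by (simp add: all_brj all_g0 all_g1)
  then show ?thesis by blast
qed

lemma brj_lowering:
  "brj_root b \<noteq> [0, 0] \<Longrightarrow>
    \<exists>g\<in>set brj_gens. nonvanishing (brj_table g b) \<and> \<bar>sum_list (brj_root g) + sum_list (brj_root b)\<bar> < \<bar>sum_list (brj_root b)\<bar>"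
proof -
  have "\<forall>b. brj_root b \<noteq> [0, 0] \<longrightarrow>
    (\<exists>g\<in>set brj_gens. nonvanishing (brj_table g b) \<and> \<bar>sum_list (brj_root g) + sum_list (brj_root b)\<bar> < \<bar>sum_list (brj_root b)\<bar>)"
    by (simp add: all_brj all_g0 all_g1 tmap_def)
  then show "brj_root b \<noteq> [0, 0] \<Longrightarrow> ?thesis" by blast
qed

text \<open>The sign of the odd f_1: the table has \<open>[Od U1, Od V1] = Ev T2\<close>, whereas
  the first coroot, with root values 0 and -1, is mapped to \<open>- Ev T2\<close>.\<close>

lemma brj_table_contragredient:
  fixes S :: "('k::field, 'h) realization"
  assumes char: "CHAR('k) = 3" and S: "realizes brj23_matrix S"
  shows "table_contragredient brj23_matrix (\<lambda>i. if i = 0 then 1 else 0) S brj_parity brj_table brj_gens brj_steps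
    (tconst brj_table) brj_root brj_E brj_F (\<lambda>i. if i = 0 then - 1 else 1) (brj_cartan S)"
proof -
  note real = realizes_nondegenerate[OF S brj_entries(1)[symmetric] brj_det]
  have r: "replicate (dim_row brj23_matrix) (0::int) = [0, 0]" by (simp add: brj_entries(1) numeral_2_eq_2)
  have real5: "simple_root S j (coroot S i) = of_int (brj23_matrix $$ (i, j))" if "i < 2" "j < 2" for i j
    using real(5) that .
  have roots: "simple_root S 0 (coroot S 0) = 0" "simple_root S 1 (coroot S 0) = - 1"
    "simple_root S 0 (coroot S 1) = - 1" "simple_root S 1 (coroot S 1) = 0"
    by (simp_all add: real5 brj_entries del: One_nat_def)
  show ?thesis
  proof (rule table_contragredient.intro[OF contragredient_data.intro brj_table_superalgebra[OF char]], goal_cases)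
    case 1 show ?case by (rule real(1))
  next
    case (2 i) then show ?case using real(2) brj_entries(1) by simp
  next
    case 3
    show ?case
      unfolding table_contragredient_axioms_def r unfolding brj_entries(1)
    proof (intro conjI allI impI)
      fix m l :: nat assume ml: "m < 2" "l < 2"
      show "scale (of_int (if l = 0 then - 1 else 1)) (lin (brj_table (brj_E m) (brj_F l))) =
        (if m = l then brj_cartan S (coroot S m) else (0 :: brj_basis \<Rightarrow>\<^sub>0 'k))"
        using less_2_cases[OF ml(1)] less_2_cases[OF ml(2)]
        by (elim disjE; simp add: brj_E_def brj_F_def brj_cartan_def tmap_def roots single_uminus del: One_nat_def)
    next
      fix x m assume x: "x \<in> carrier (cartan_space S)" and m: "m < (2::nat)"
      show "bil (tconst brj_table) (brj_cartan S x) (Poly_Mapping.single (brj_E m) 1) =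
          scale (simple_root S m x) (Poly_Mapping.single (brj_E m) (1::'k))"
        "bil (tconst brj_table) (brj_cartan S x) (Poly_Mapping.single (brj_F m) 1) =
          - scale (simple_root S m x) (Poly_Mapping.single (brj_F m) (1::'k))"
        using less_2_cases[OF m]
        by (elim disjE; simp add: brj_E_def brj_F_def brj_cartan_def tmap_def single_add[symmetric] single_uminus[symmetric])+
    next
      fix x assume x: "x \<in> carrier (cartan_space S)" and z: "brj_cartan S x = 0"
      have "Poly_Mapping.lookup (brj_cartan S x) b = 0" for b using z by simp
      from this[of "Ev T1"] this[of "Ev T2"]
      have "simple_root S 0 x = 0 \<and> simple_root S 1 x = 0"
        by (simp add: brj_cartan_def lookup_add lookup_single)
      then show "x = \<zero>\<^bsub>cartan_space S\<^esub>" using real(6)[OF x] less_2_cases by metis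
    next
      fix m :: nat assume m: "m < 2"
      show "degree_of (brj_root (brj_E m)) = Poly_Mapping.single m 1" "degree_of (brj_root (brj_F m)) = - Poly_Mapping.single m 1"
        using less_2_cases[OF m] by (elim disjE; simp add: brj_E_def brj_F_def degree_of_unit)+
      show "brj_parity (brj_E m) = (if m = 0 then 1 else 0)" "brj_parity (brj_F m) = (if m = 0 then 1 else 0)"
        by (simp_all add: brj_E_def brj_F_def)
    next
      fix b x assume "b \<in> Poly_Mapping.keys (brj_cartan S x)"
      then show "brj_root b = [0, 0]" "brj_parity b = 0"
        by (auto simp: brj_cartan_def in_keys_iff lookup_add lookup_single when_def split: if_splits)
    next
      fix x y assume xy: "x \<in> carrier (cartan_space S)" "y \<in> carrier (cartan_space S)"
      show "brj_cartan S (x \<oplus>\<^bsub>cartan_space S\<^esub> y) = brj_cartan S x + brj_cartan S y"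
        by (rule poly_mapping_eqI)
          (simp add: brj_cartan_def lookup_add lookup_single when_def real(3) xy)
    next
      fix c x assume x: "x \<in> carrier (cartan_space S)"
      show "brj_cartan S (c \<odot>\<^bsub>cartan_space S\<^esub> x) = scale c (brj_cartan S x)"
        by (rule poly_mapping_eqI)
          (simp add: brj_cartan_def lookup_add lookup_single when_def real(4) x algebra_simps)
    next
      show "set brj_gens = brj_E ` {..<2} \<union> brj_F ` {..<2}"
        unfolding lessThan_2 by (auto simp: brj_E_def brj_F_def)
    next
      fix x y show "bil (tconst brj_table) (brj_cartan S x) (brj_cartan S y) = 0"
        by (simp add: brj_cartan_def tmap_def)
    next
      show "length (brj_root b) = 2" for b by (rule brj_root_length)
      show "brj_root (fst z) = map2 (+) (brj_root i) (brj_root j)" if "z \<in> set (brj_table i j)" for z i j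
        by (rule brj_root_add[OF that])
      show "b = b' \<or> brj_root b = [0, 0]" if "brj_root b = brj_root b'" for b b'
        by (rule brj_root_inj[OF that])
      show "\<exists>g\<in>set brj_gens. nonvanishing (brj_table g b) \<and>
          \<bar>sum_list (brj_root g) + sum_list (brj_root b)\<bar> < \<bar>sum_list (brj_root b)\<bar>" if "brj_root b \<noteq> [0, 0]" for b
        by (rule brj_lowering[OF that])
    qed simp_all
  qed
qed

section \<open>The semisimplification of \<open>br\<^sub>3\<close>\<close>

primrec even_part :: "br3_basis \<Rightarrow> (brj_basis \<Rightarrow>\<^sub>0 'k::field)" where
  "even_part (Inv a) = Poly_Mapping.single (Ev a) 1"
| "even_part (Lo u) = 0"
| "even_part (Hi u) = 0"
| "even_part F = 0"
| "even_part H = 0"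
| "even_part E = 0"

primrec odd_part :: "br3_basis \<Rightarrow> (brj_basis \<Rightarrow>\<^sub>0 'k::field)" where
  "odd_part (Inv a) = 0"
| "odd_part (Lo u) = Poly_Mapping.single (Od u) 1"
| "odd_part (Hi u) = 0"
| "odd_part F = 0"
| "odd_part H = 0"
| "odd_part E = 0"

text \<open>A common section of both projections: \<open>Ev\<close> vectors go into the kernel of
  \<open>ad_E\<close>, \<open>Od\<close> vectors into the kernel of its square.\<close>

primrec lift_basis :: "brj_basis \<Rightarrow> (br3_basis \<Rightarrow>\<^sub>0 'k::field)" where
  "lift_basis (Ev a) = Poly_Mapping.single (Inv a) 1"
| "lift_basis (Od u) = Poly_Mapping.single (Lo u) 1"

abbreviation br3_T :: "br3_basis \<Rightarrow> br3_basis \<Rightarrow> (br3_basis \<Rightarrow>\<^sub>0 'k::field)" where "br3_T \<equiv> tconst br3_table"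
abbreviation brj_T :: "brj_basis \<Rightarrow> brj_basis \<Rightarrow> (brj_basis \<Rightarrow>\<^sub>0 'k::field)" where "brj_T \<equiv> tconst brj_table"
abbreviation ad_E :: "(br3_basis \<Rightarrow>\<^sub>0 'k::field) \<Rightarrow> (br3_basis \<Rightarrow>\<^sub>0 'k)" where
  "ad_E \<equiv> bil br3_T (Poly_Mapping.single E 1)"

lemma lext_tmap:
  "lext even_part (lin (tmap Inv s xs)) = lin (tmap Ev s xs)"
  "lext even_part (lin (tmap Lo s ys)) = 0" "lext even_part (lin (tmap Hi s ys)) = 0"
  "lext even_part (lin (map (\<lambda>c. (F, f c)) zs)) = 0" "lext even_part (lin (map (\<lambda>c. (H, f c)) zs)) = 0"
  "lext even_part (lin (map (\<lambda>c. (E, f c)) zs)) = 0"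
  "lext odd_part (lin (tmap Inv s xs)) = 0"
  "lext odd_part (lin (tmap Lo s ys)) = lin (tmap Od s ys)" "lext odd_part (lin (tmap Hi s ys)) = 0"
  "lext odd_part (lin (map (\<lambda>c. (F, f c)) zs)) = 0" "lext odd_part (lin (map (\<lambda>c. (H, f c)) zs)) = 0"
  "lext odd_part (lin (map (\<lambda>c. (E, f c)) zs)) = 0"
proof -
  show "lext even_part (lin (tmap Inv s xs)) = lin (tmap Ev s xs)" "lext odd_part (lin (tmap Inv s xs)) = 0"
    by (induction xs) (auto simp: tmap_def)
  show "lext even_part (lin (tmap Lo s ys)) = 0" "lext even_part (lin (tmap Hi s ys)) = 0"
    "lext odd_part (lin (tmap Lo s ys)) = lin (tmap Od s ys)" "lext odd_part (lin (tmap Hi s ys)) = 0"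
    by (induction ys) (auto simp: tmap_def)
  show "lext even_part (lin (map (\<lambda>c. (F, f c)) zs)) = 0" "lext even_part (lin (map (\<lambda>c. (H, f c)) zs)) = 0"
    "lext even_part (lin (map (\<lambda>c. (E, f c)) zs)) = 0"
    "lext odd_part (lin (map (\<lambda>c. (F, f c)) zs)) = 0" "lext odd_part (lin (map (\<lambda>c. (H, f c)) zs)) = 0"
    "lext odd_part (lin (map (\<lambda>c. (E, f c)) zs)) = 0"
    by (induction zs) auto
qed

lemma lin_tmap_minus: "lin (tmap f (- 1) xs) = - lin (tmap f 1 xs)"
  by (induction xs) (auto simp: tmap_def single_uminus)

lemma ad_E_eq: "ad_E a = lext (br3_T E) a"
  by (simp add: bil_def)

text \<open>On basis vectors the nonzero values of \<open>ad_E\<close> are \<open>Hi u\<close> at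
  \<open>Lo u\<close>, \<open>H\<close> at \<open>F\<close> and \<open>E\<close> at
  \<open>H\<close>, each with coefficient 1, so every target coordinate has a single source.\<close>

lemma lookup_ad_E:
  "Poly_Mapping.lookup (ad_E a) (Hi u) = Poly_Mapping.lookup a (Lo u)"
  "Poly_Mapping.lookup (ad_E a) H = Poly_Mapping.lookup a F"
  "Poly_Mapping.lookup (ad_E a) E = Poly_Mapping.lookup a H"
  unfolding ad_E_eq
proof -
  show "Poly_Mapping.lookup (lext (br3_T E) a) (Hi u) = Poly_Mapping.lookup a (Lo u)"
    by (rule lookup_lext_delta, case_tac b) (auto simp: lookup_single when_def)
  show "Poly_Mapping.lookup (lext (br3_T E) a) H = Poly_Mapping.lookup a F"
    by (rule lookup_lext_delta, case_tac b) (auto simp: lookup_single when_def)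
  show "Poly_Mapping.lookup (lext (br3_T E) a) E = Poly_Mapping.lookup a H"
    by (rule lookup_lext_delta, case_tac b) (auto simp: lookup_single when_def)
qed

lemma lookup_parts:
  "Poly_Mapping.lookup (lext even_part a) (Ev x) = Poly_Mapping.lookup a (Inv x)"
  "Poly_Mapping.lookup (lext odd_part a) (Od u) = Poly_Mapping.lookup a (Lo u)"
proof -
  show "Poly_Mapping.lookup (lext even_part a) (Ev x) = Poly_Mapping.lookup a (Inv x)"
    by (rule lookup_lext_delta, case_tac b) (auto simp: lookup_single when_def)
  show "Poly_Mapping.lookup (lext odd_part a) (Od u) = Poly_Mapping.lookup a (Lo u)"
    by (rule lookup_lext_delta, case_tac b) (auto simp: lookup_single when_def)
qed

lemma ad_E_kernel_keys:
  assumes "ad_E a = 0" "b \<in> Poly_Mapping.keys a"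
  shows "b \<in> range Inv \<union> range Hi \<union> {E}"
proof (cases b)
  case (Lo u)
  then show ?thesis using assms lookup_ad_E(1)[of a u] by (simp add: in_keys_iff)
next
  case F
  then show ?thesis using assms lookup_ad_E(2)[of a] by (simp add: in_keys_iff)
next
  case H
  then show ?thesis using assms lookup_ad_E(3)[of a] by (simp add: in_keys_iff)
qed simp_all

lemma ad_E_kernel2_keys:
  assumes "ad_E (ad_E a) = 0" "b \<in> Poly_Mapping.keys a"
  shows "b \<noteq> F"
  using assms lookup_ad_E(2)[of a] lookup_ad_E(3)[of "ad_E a"] by (auto simp: in_keys_iff)

lemma parts_kill_image: "lext even_part (ad_E a) = 0" "lext odd_part (ad_E a) = 0"
proof -
  have "lext even_part (br3_T E k :: _ \<Rightarrow>\<^sub>0 'a) = 0" "lext odd_part (br3_T E k :: _ \<Rightarrow>\<^sub>0 'a) = 0" for k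
    by (cases k; simp)+
  note s = this
  show "lext even_part (ad_E a) = 0"
    by (rule linear_zeroI[where f = "\<lambda>a. lext even_part (ad_E a)", OF pm_linearI]; simp add: s)
  show "lext odd_part (ad_E a) = 0"
    by (rule linear_zeroI[where f = "\<lambda>a. lext odd_part (ad_E a)", OF pm_linearI]; simp add: s)
qed

lemma odd_part_kernel:
  assumes "ad_E a = 0" shows "lext odd_part a = 0"
proof (rule linear_zeroI[OF pm_linear_lext])
  fix k assume "k \<in> Poly_Mapping.keys a"
  from ad_E_kernel_keys[OF assms this] show "lext odd_part (Poly_Mapping.single k 1) = 0" by auto
qed

lemma ad_E_nilpotent: "ad_E (ad_E (ad_E a)) = 0"
proof -
  have s: "ad_E (ad_E (br3_T E k :: _ \<Rightarrow>\<^sub>0 'a)) = 0" for k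
    by (cases k) simp_all
  show ?thesis
    by (rule linear_zeroI[where f = "\<lambda>a. ad_E (ad_E (ad_E a))", OF pm_linearI]; simp add: s)
qed

text \<open>Without kernel conditions the projections are not multiplicative:
  \<open>[Lo u, Hi v]\<close> has a component in \<open>g0\<close>, and
  \<open>[Hi u, F] = - Lo u\<close>. The kernel of \<open>ad_E\<close> excludes \<open>Lo\<close>,
  \<open>F\<close> and \<open>H\<close> from the support, and the kernel of its square excludes
  \<open>F\<close>.\<close>

lemma parts_mult:
  fixes a b :: "br3_basis \<Rightarrow>\<^sub>0 'k::field"
  assumes char: "CHAR('k) = 3"
  shows "ad_E a = 0 \<Longrightarrow> ad_E b = 0 \<Longrightarrow>
      lext even_part (bil br3_T a b) = bil brj_T (lext even_part a) (lext even_part b)"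
    and "ad_E a = 0 \<Longrightarrow> ad_E (ad_E b) = 0 \<Longrightarrow>
      lext odd_part (bil br3_T a b) = bil brj_T (lext even_part a) (lext odd_part b)"
    and "ad_E (ad_E a) = 0 \<Longrightarrow> ad_E b = 0 \<Longrightarrow>
      lext odd_part (bil br3_T a b) = bil brj_T (lext odd_part a) (lext even_part b)"
    and "ad_E (ad_E a) = 0 \<Longrightarrow> ad_E (ad_E b) = 0 \<Longrightarrow>
      lext even_part (- bil br3_T a (ad_E b) + bil br3_T (ad_E a) b) = bil brj_T (lext odd_part a) (lext odd_part b)"
proof -
  assume "ad_E a = 0" "ad_E b = 0"
  note k = ad_E_kernel_keys[OF this(1)] ad_E_kernel_keys[OF this(2)]
  show "lext even_part (bil br3_T a b) = bil brj_T (lext even_part a) (lext even_part b)"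
  proof (rule bilinear_eqI[where F = "\<lambda>a b. lext even_part (bil br3_T a b)" and
        G = "\<lambda>a b. bil brj_T (lext even_part a) (lext even_part b)"])
    fix u w assume "u \<in> Poly_Mapping.keys a" "w \<in> Poly_Mapping.keys b"
    from k(1)[OF this(1)] k(2)[OF this(2)]
    show "lext even_part (bil br3_T (Poly_Mapping.single u 1) (Poly_Mapping.single w 1)) =
        bil brj_T (lext even_part (Poly_Mapping.single u 1)) (lext even_part (Poly_Mapping.single w 1))"
      by (auto simp: lext_tmap)
  qed (rule pm_linearI; simp)+
next
  assume "ad_E a = 0" "ad_E (ad_E b) = 0"
  note k = ad_E_kernel_keys[OF this(1)] ad_E_kernel2_keys[OF this(2)]
  show "lext odd_part (bil br3_T a b) = bil brj_T (lext even_part a) (lext odd_part b)"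
  proof (rule bilinear_eqI[where F = "\<lambda>a b. lext odd_part (bil br3_T a b)" and
        G = "\<lambda>a b. bil brj_T (lext even_part a) (lext odd_part b)"])
    fix u w assume "u \<in> Poly_Mapping.keys a" "w \<in> Poly_Mapping.keys b"
    from k(1)[OF this(1)] k(2)[OF this(2)]
    show "lext odd_part (bil br3_T (Poly_Mapping.single u 1) (Poly_Mapping.single w 1)) =
        bil brj_T (lext even_part (Poly_Mapping.single u 1)) (lext odd_part (Poly_Mapping.single w 1))"
      by (cases w) (auto simp: lext_tmap)
  qed (rule pm_linearI; simp)+
next
  assume "ad_E (ad_E a) = 0" "ad_E b = 0"
  note k = ad_E_kernel2_keys[OF this(1)] ad_E_kernel_keys[OF this(2)]
  show "lext odd_part (bil br3_T a b) = bil brj_T (lext odd_part a) (lext even_part b)"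
  proof (rule bilinear_eqI[where F = "\<lambda>a b. lext odd_part (bil br3_T a b)" and
        G = "\<lambda>a b. bil brj_T (lext odd_part a) (lext even_part b)"])
    fix u w assume "u \<in> Poly_Mapping.keys a" "w \<in> Poly_Mapping.keys b"
    from k(1)[OF this(1)] k(2)[OF this(2)]
    show "lext odd_part (bil br3_T (Poly_Mapping.single u 1) (Poly_Mapping.single w 1)) =
        bil brj_T (lext odd_part (Poly_Mapping.single u 1)) (lext even_part (Poly_Mapping.single w 1))"
      by (cases u) (auto simp: lext_tmap)
  qed (rule pm_linearI; simp)+
next
  assume "ad_E (ad_E a) = 0" "ad_E (ad_E b) = 0"
  note k = ad_E_kernel2_keys[OF this(1)] ad_E_kernel2_keys[OF this(2)]
  \<comment> \<open>\<open>- 2 = 1\<close> turns the antisymmetrization into the symmetric map itself.\<close>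
  have two: "- x - x = x" for x :: "brj_basis \<Rightarrow>\<^sub>0 'k"
  proof -
    have "- x - x = scale (- 2) x"
      using pm.scale_left_diff_distrib[of "- 1" 1 x] by simp
    then show ?thesis using char3_numerals(2)[OF char] by simp
  qed
  show "lext even_part (- bil br3_T a (ad_E b) + bil br3_T (ad_E a) b) = bil brj_T (lext odd_part a) (lext odd_part b)"
  proof (rule bilinear_eqI[where F = "\<lambda>a b. lext even_part (- bil br3_T a (ad_E b) + bil br3_T (ad_E a) b)" and
        G = "\<lambda>a b. bil brj_T (lext odd_part a) (lext odd_part b)"])
    fix u w assume "u \<in> Poly_Mapping.keys a" "w \<in> Poly_Mapping.keys b"
    from k(1)[OF this(1)] k(2)[OF this(2)]
    show "lext even_part (- bil br3_T (Poly_Mapping.single u (1::'k)) (ad_E (Poly_Mapping.single w 1)) +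
          bil br3_T (ad_E (Poly_Mapping.single u 1)) (Poly_Mapping.single w 1)) =
        bil brj_T (lext odd_part (Poly_Mapping.single u 1)) (lext odd_part (Poly_Mapping.single w 1))"
      by (cases u; cases w) (simp_all add: lext_tmap lin_tmap_minus two)
  qed (rule pm_linearI; simp add: pm.scale_right_diff_distrib)+
qed

lemma parts_surj:
  shows "(\<And>b. b \<in> Poly_Mapping.keys g \<Longrightarrow> brj_parity b = 0) \<Longrightarrow> \<exists>a. ad_E a = 0 \<and> lext even_part a = g"
    and "(\<And>b. b \<in> Poly_Mapping.keys g \<Longrightarrow> brj_parity b = 1) \<Longrightarrow> \<exists>a. ad_E (ad_E a) = 0 \<and> lext odd_part a = g"
proof -
  assume even: "\<And>b. b \<in> Poly_Mapping.keys g \<Longrightarrow> brj_parity b = 0"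
  have e: "b \<in> range Ev" if "b \<in> Poly_Mapping.keys g" for b using even[OF that] by (cases b) auto
  have "ad_E (lext lift_basis g) = 0"
  proof (rule linear_zeroI[where f = "\<lambda>g. ad_E (lext lift_basis g)"])
    fix k assume "k \<in> Poly_Mapping.keys g"
    from e[OF this] show "ad_E (lext lift_basis (Poly_Mapping.single k 1)) = 0" by auto
  qed (rule pm_linearI; simp)
  moreover have "lext even_part (lext lift_basis g) = g"
  proof (rule linear_idI[where f = "\<lambda>g. lext even_part (lext lift_basis g)"])
    fix k assume "k \<in> Poly_Mapping.keys g"
    from e[OF this] show "lext even_part (lext lift_basis (Poly_Mapping.single k 1)) = Poly_Mapping.single k 1" by auto
  qed (rule pm_linearI; simp)
  ultimately show "\<exists>a. ad_E a = 0 \<and> lext even_part a = g" by blast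
next
  assume odd: "\<And>b. b \<in> Poly_Mapping.keys g \<Longrightarrow> brj_parity b = 1"
  have o: "b \<in> range Od" if "b \<in> Poly_Mapping.keys g" for b using odd[OF that] by (cases b) auto
  have "ad_E (ad_E (lext lift_basis g)) = 0"
  proof (rule linear_zeroI[where f = "\<lambda>g. ad_E (ad_E (lext lift_basis g))"])
    fix k assume "k \<in> Poly_Mapping.keys g"
    from o[OF this] show "ad_E (ad_E (lext lift_basis (Poly_Mapping.single k 1))) = 0" by auto
  qed (rule pm_linearI; simp)
  moreover have "lext odd_part (lext lift_basis g) = g"
  proof (rule linear_idI[where f = "\<lambda>g. lext odd_part (lext lift_basis g)"])
    fix k assume "k \<in> Poly_Mapping.keys g"
    from o[OF this] show "lext odd_part (lext lift_basis (Poly_Mapping.single k 1)) = Poly_Mapping.single k 1" by auto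
  qed (rule pm_linearI; simp)
  ultimately show "\<exists>a. ad_E (ad_E a) = 0 \<and> lext odd_part a = g" by blast
qed

text \<open>A right inverse of \<open>ad_E\<close> on its image, extended by 0 to the other basis
  vectors.\<close>

primrec preimage :: "br3_basis \<Rightarrow> (br3_basis \<Rightarrow>\<^sub>0 'k::field)" where
  "preimage (Inv a) = 0"
| "preimage (Lo u) = 0"
| "preimage (Hi u) = Poly_Mapping.single (Lo u) 1"
| "preimage F = 0"
| "preimage H = Poly_Mapping.single F 1"
| "preimage E = Poly_Mapping.single H 1"

text \<open>In the first case the support is reduced to \<open>Hi\<close> vectors and
  \<open>E\<close>, which are images. In the second the \<open>Inv\<close> terms form the kernel
  element, and the remaining \<open>Hi\<close>, \<open>H\<close> and \<open>E\<close> terms are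
  images.\<close>

lemma parts_inj:
  "ad_E a = 0 \<Longrightarrow> lext even_part a = 0 \<Longrightarrow> \<exists>w. a = ad_E w"
  "ad_E (ad_E a) = 0 \<Longrightarrow> lext odd_part a = 0 \<Longrightarrow> \<exists>b w. ad_E b = 0 \<and> a = b + ad_E w"
proof -
  assume a: "ad_E a = 0" "lext even_part a = 0"
  have k: "b \<in> range Hi \<union> {E}" if "b \<in> Poly_Mapping.keys a" for b
    using ad_E_kernel_keys[OF a(1) that] that lookup_parts(1)[of a] a(2) by (auto simp: in_keys_iff)
  have "ad_E (lext preimage a) = a"
  proof (rule linear_idI[where f = "\<lambda>a. ad_E (lext preimage a)"])
    fix b assume "b \<in> Poly_Mapping.keys a"
    from k[OF this] show "ad_E (lext preimage (Poly_Mapping.single b 1)) = Poly_Mapping.single b 1" by auto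
  qed (rule pm_linearI; simp)
  then show "\<exists>w. a = ad_E w" by metis
next
  assume a: "ad_E (ad_E a) = 0" "lext odd_part a = 0"
  have k: "b \<noteq> F \<and> b \<notin> range Lo" if "b \<in> Poly_Mapping.keys a" for b
    using ad_E_kernel2_keys[OF a(1) that] that lookup_parts(2)[of a] a(2) by (auto simp: in_keys_iff)
  let ?b = "\<lambda>a. lext lift_basis (lext even_part a)"
  have "ad_E (?b a) = 0"
  proof (rule linear_zeroI[where f = "\<lambda>a. ad_E (?b a)"])
    fix b show "ad_E (?b (Poly_Mapping.single b 1)) = 0" by (cases b) simp_all
  qed (rule pm_linearI; simp)
  moreover have "?b a + ad_E (lext preimage a) = a"
  proof (rule linear_idI[where f = "\<lambda>a. ?b a + ad_E (lext preimage a)"])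
    fix b assume "b \<in> Poly_Mapping.keys a"
    from k[OF this] show "?b (Poly_Mapping.single b 1) + ad_E (lext preimage (Poly_Mapping.single b 1)) = Poly_Mapping.single b 1"
      by (cases b) auto
  qed (rule pm_linearI; simp add: pm.scale_right_distrib)
  ultimately show "\<exists>b w. ad_E b = 0 \<and> a = b + ad_E w" by metis
qed

lemma parts_parity:
  "b \<in> Poly_Mapping.keys (lext even_part a) \<Longrightarrow> brj_parity b = 0"
  "b \<in> Poly_Mapping.keys (lext odd_part a) \<Longrightarrow> brj_parity b = 1"
proof -
  have "brj_parity c = 0" if "c \<in> Poly_Mapping.keys (even_part k :: _ \<Rightarrow>\<^sub>0 'a)" for c k
    using that by (cases k) (auto split: if_splits)
  then show "b \<in> Poly_Mapping.keys (lext even_part a) \<Longrightarrow> brj_parity b = 0"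
    using keys_lext[of even_part a] by blast
  have "brj_parity c = 1" if "c \<in> Poly_Mapping.keys (odd_part k :: _ \<Rightarrow>\<^sub>0 'a)" for c k
    using that by (cases k) (auto split: if_splits)
  then show "b \<in> Poly_Mapping.keys (lext odd_part a) \<Longrightarrow> brj_parity b = 1"
    using keys_lext[of odd_part a] by blast
qed

theorem corollary4p2p1:
  fixes R :: "('k::alg_closed_field, 'a) realization"
    and S :: "('k, 'b) realization"
  assumes "CHAR('k) = 3"
    and "realizes br3_matrix R"
    and "realizes brj23_matrix S"
  shows "lie_algebra_in_Rep_alpha3 (br3 R) (ad (br3 R) (br3_e1 R)) \<and>
    (\<forall>n1 n2 n3 x. jordan_decomposition (br3 R) (ad (br3 R) (br3_e1 R)) n1 n2 n3 x \<longrightarrow>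
       isomorphic_superalgebras
         (semisimplification (br3 R) (ad (br3 R) (br3_e1 R)) n1 n2 n3 x) (brj23 S))"
proof -
  let ?M = "pm_superalgebra UNIV (\<lambda>_. 0) (br3_T :: _ \<Rightarrow> _ \<Rightarrow> (_ \<Rightarrow>\<^sub>0 'k))"
  let ?N = "pm_superalgebra UNIV brj_parity (brj_T :: _ \<Rightarrow> _ \<Rightarrow> (_ \<Rightarrow>\<^sub>0 'k))"
  interpret B: table_contragredient br3_matrix "\<lambda>_. 0" R "\<lambda>_. 0" br3_table br3_gens br3_steps br3_T
    br3_root br3_E br3_F "\<lambda>i. if i = 1 then - 1 else 1" "br3_cartan R"
    by (rule br3_table_contragredient[OF assms(1,2)])
  interpret J: table_contragredient brj23_matrix "\<lambda>i. if i = 0 then 1 else 0" S brj_parity brj_table brj_gens brj_steps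
    brj_T brj_root brj_E brj_F "\<lambda>i. if i = 0 then - 1 else 1" "brj_cartan S"
    by (rule brj_table_contragredient[OF assms(1,3)])
  let ?G = "br3 R" and ?e = "br3_e1 R"
  let ?d = "ad ?G ?e"
  obtain \<psi> where \<psi>: "superalgebra_iso \<psi> ?M ?G"
    and \<psi>_gen: "\<And>x. x \<in> generators (dim_row br3_matrix) R \<Longrightarrow>
      \<psi> (B.\<gamma> x) = contragredient_gen br3_matrix (\<lambda>_. 0) R x"
    by (rule B.contragredient_iso[folded br3_def]) (rule that)
  obtain \<chi> where \<chi>: "superalgebra_iso \<chi> ?N (brj23 S)"
    by (rule J.contragredient_iso[folded brj23_def])
  have lieM: "lie_superalgebra ?M" by (rule pm_lie_superalgebra[OF B.lie]) simp
  have lieG: "lie_superalgebra ?G" by (rule lie_superalgebra_iso[OF lieM \<psi>])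
  interpret G: bilinear_superalgebra ?G by (rule bilinear_lie_superalgebra[OF lieG])
  have \<psi>_epi: "superalgebra_epi \<psi> ?M ?G" using \<psi> unfolding superalgebra_iso_def by blast
  obtain \<phi> where \<phi>: "superalgebra_iso \<phi> ?G ?M" and \<phi>\<psi>: "\<And>a. \<phi> (\<psi> a) = a"
    by (rule superalgebra_iso_inverse[OF bilinear_lie_superalgebra[OF lieM] lie_superalgebra_homog_subset[OF lieM] \<psi>]) auto
  have epi: "superalgebra_epi \<phi> ?G ?M" and inj: "inj_on \<phi> (carrier ?G)"
    using \<phi> unfolding superalgebra_iso_def by blast+
  note e = superalgebra_epiD[OF epi, simplified]
  have "\<psi> (Poly_Mapping.single E 1) = ?e"
    using \<psi>_gen[of "GenE 0"] by (simp add: br3_e1_def br3_entries br3_E_def generators_def)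
  then have e1: "\<phi> ?e = Poly_Mapping.single E 1" "?e \<in> carrier ?G"
    using \<phi>\<psi>[of "Poly_Mapping.single E 1"] superalgebra_epiD(7)[OF \<psi>_epi, of "Poly_Mapping.single E 1"] by simp_all
  have d: "?d v \<in> carrier ?G" "\<phi> (?d v) = ad_E (\<phi> v)" if "v \<in> carrier ?G" for v
    using that e1 e(4) by (simp_all add: ad_def)
  \<comment> \<open>The Leibniz rule for \<open>ad_E\<close> is the Jacobi identity with all
    parities 0.\<close>
  have deriv: "ad_E (bil br3_T a b) = bil br3_T (ad_E a) b + bil br3_T a (ad_E b)" for a b :: "_ \<Rightarrow>\<^sub>0 'k"
    using B.jacobi[of "Poly_Mapping.single E 1" 0 a 0 b] by (simp add: B.pure_def koszul_sign_def)
  have "lie_algebra_in_Rep_alpha3 ?G ?d"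
    unfolding lie_algebra_in_Rep_alpha3_def
  proof (intro conjI ballI)
    show "lie_superalgebra ?G" by (rule lieG)
    have "homog ?M 1 = {0}" by (auto simp: keys_eq_empty[symmetric] simp del: keys_eq_empty)
    then show "homog ?G 1 = {\<zero>\<^bsub>?G\<^esub>}"
      using superalgebra_epiD(2)[OF \<psi>_epi] superalgebra_epiD(6)[OF \<psi>_epi, of 1] by simp
    show "vectorspace.fin_dim class_ring ?G"
      by (rule fin_dim_image[OF reached_finite[OF br3_reached] \<psi>_epi])
    show "?d \<in> LinearCombinations.module_hom class_ring ?G ?G"
      using e1(2) by (simp add: LinearCombinations.module_hom_def ad_def G.mult_add_right G.mult_smult_right)
    \<comment> \<open>The identities for the derivation hold in the model and are pulled back by
      injectivity of \<open>\<phi>\<close>.\<close>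
    show "?d (x \<otimes>\<^bsub>?G\<^esub> y) = (?d x \<otimes>\<^bsub>?G\<^esub> y) \<oplus>\<^bsub>?G\<^esub> (x \<otimes>\<^bsub>?G\<^esub> ?d y)"
      if x: "x \<in> carrier ?G" and y: "y \<in> carrier ?G" for x y
      by (rule inj_onD[OF inj]) (simp_all add: d e x y deriv)
    show "?d (?d (?d x)) = \<zero>\<^bsub>?G\<^esub>" if x: "x \<in> carrier ?G" for x
      by (rule inj_onD[OF inj]) (simp_all add: d e x ad_E_nilpotent)
  qed
  moreover have "isomorphic_superalgebras (semisimplification ?G ?d n1 n2 n3 x) (brj23 S)"
    if jd: "jordan_decomposition ?G ?d n1 n2 n3 x" for n1 n2 n3 x
  proof (rule isomorphic_superalgebras_trans[OF _ superalgebra_iso_isomorphic[OF \<chi>]])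
    show "isomorphic_superalgebras (semisimplification ?G ?d n1 n2 n3 x) ?N"
      by (rule semisimplification_isomorphic[OF G.bilinear_superalgebra_axioms \<phi> linear_bil_right deriv d jd
            pm_linear_lext pm_linear_lext parts_kill_image odd_part_kernel parts_mult[OF assms(1)] parts_parity parts_surj parts_inj])
  qed
  ultimately show ?thesis by blast
qed

end
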